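(* Let $E$ be a finite directed graph without sinks and let $u\in\mathcal U_E\cap\mathcal N_{\mathcal F_E^k}(\mathcal D_E^k)$ for some $k\ge1$. Then the following conditions are equivalent: (1) $\lambda_u$ restricts to an automorphism of $\mathcal D_E$; (2) the ring $A_u^D$ is nilpotent; (3) $\Xi_u^D\subseteq\mathcal D_E^0$.
   Context: A directed graph $E=(E^0,E^1,r,s)$ has vertex set $E^0$, edge set $E^1$, and range and source maps $r,s:E^1\to E^0$; it is finite if $E^0$ and $E^1$ are finite. A sink is a vertex emitting no edges. $C^*(E)$ is the universal $C^*$-algebra generated by mutually orthogonal projections $P_v$ ($v\in E^0$) and partial isometries $S_e$ ($e\in E^1$) with $S_e^*S_e=P_{r(e)}$, $S_e^*S_f=0$ for $e\ne f$, $S_eS_e^*\le P_{s(e)}$, and $P_v=\sum_{s(e)=v}S_eS_e^*$ whenever $v$ emits finitely many and at least one edge. A path of length $k\ge1$ is $\mu=(\mu_1,\ldots,\mu_k)$ with $\mu_j\in E^1$ and $r(\mu_j)=s(\mu_{j+1})$; vertices are the paths of length $0$; put $|\mu|$ for the length, $S_\mu=S_{\mu_1}\cdots S_{\mu_k}$, $S_v=P_v$, $P_\mu=S_\mu S_\mu^*$. $\mathcal D_E$ is the $C^*$-subalgebra generated by all $P_\mu$, $\mathcal D_E^k=\mathrm{span}\{P_\mu:|\mu|=k\}$ for $k\geq 0$, and $\mathcal F_E^k=\mathrm{span}\{S_\mu S_\nu^*:|\mu|=|\nu|=k\}$. $\mathcal U_E$ is the group of unitaries in $C^*(E)$ commuting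 with all $P_v$. For $u\in\mathcal U_E$, $\lambda_u$ is the unital $*$-endomorphism of $C^*(E)$ with $\lambda_u(S_e)=uS_e$, $\lambda_u(P_v)=P_v$. For $A\subseteq B$ with common unit, $\mathcal N_B(A)=\{u\in\mathcal U(B):uAu^*=A\}$, where $\mathcal U(B)$ is the unitary group of $B$. For $u\in\mathcal U_E\cap\mathcal N_{\mathcal F_E^k}(\mathcal D_E^k)$ and $e,f\in E^1$, the linear map $x\mapsto S_e^*u^*xuS_f$ on $\mathcal F_E^{k-1}$ leaves $\mathcal D_E^{k-1}$ and $\mathcal D_E^0$ invariant; $b^u_{e,f}$ is its restriction to $\mathcal D_E^{k-1}$ and $\tilde b^u_{e,f}$ is the induced map on the quotient vector space $V_k^D=\mathcal D_E^{k-1}/\mathcal D_E^0$. $A_u^D$ is the (not necessarily unital) subring of the ring $\mathcal L(V_k^D)$ of linear maps on $V_k^D$ generated by $\{\tilde b^u_{e,f}:e,f\in E^1\}$; it is nilpotent if $(A_u^D)^l=\{0\}$ for some $l$. Let $H$ be the linear span of $\{S_e:e\in E^1\}$. Define $\Xi_0^D=\mathcal D_E^{k-1}$ and $\Xi_r^D=\lambda_u(H)^*\Xi_{r-1}^D\lambda_u(H)$ (linear span of such products) for $r\ge1$, a nested sequence of subspaces of $\mathcal D_E^{k-1}$, and $\Xi_u^D=\bigcap_r\Xi_r^D$. *)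

theory Defs
  imports
    "HOL-Algebra.Module"
    "HOL-Algebra.AbelCoset"
    "HOL-Algebra.Ideal_Product"
    "HOL-Analysis.Analysis"
    "Graph_Theory.Digraph"
    "Graph_Theory.Arc_Walk"
begin

section \<open>C*-algebras\<close>

definition complex_ring :: "complex ring" where
  "complex_ring = \<lparr>carrier = UNIV, monoid.mult = (*), one = 1, ring.zero = 0, add = (+)\<rparr>"

record 'a cstar = "(complex, 'a) module" +
  invol :: "'a \<Rightarrow> 'a"  (\<open>adj\<index> _\<close> [81] 80)
  cnorm :: "'a \<Rightarrow> real"  (\<open>nrm\<index> _\<close> [81] 80)

text \<open>The library locale of metric spaces wants a distance that is symmetric and nonnegative on the
  whole type, hence the value 0 outside of the carrier.\<close>

definition cdist :: "('a, 'm) cstar_scheme \<Rightarrow> 'a \<Rightarrow> 'a \<Rightarrow> real" where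
  "cdist A x y = (if x \<in> carrier A \<and> y \<in> carrier A then nrm (x \<ominus> y) else 0)" for A (structure)

text \<open>A C*-algebra need not be unital. The field \<open>one\<close> is the unit if there is a unit, and is
  unspecified otherwise. The zero algebra is allowed, with unit 0.\<close>

locale cstar_algebra = Module.module complex_ring A for A :: "('a, 'm) cstar_scheme" (structure) +
  assumes mult_closed: "\<lbrakk>x \<in> carrier A; y \<in> carrier A\<rbrakk> \<Longrightarrow> x \<otimes> y \<in> carrier A"
    and mult_assoc: "\<lbrakk>x \<in> carrier A; y \<in> carrier A; z \<in> carrier A\<rbrakk>
      \<Longrightarrow> (x \<otimes> y) \<otimes> z = x \<otimes> (y \<otimes> z)"
    and mult_l_distr: "\<lbrakk>x \<in> carrier A; y \<in> carrier A; z \<in> carrier A\<rbrakk>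
      \<Longrightarrow> (x \<oplus> y) \<otimes> z = x \<otimes> z \<oplus> y \<otimes> z"
    and mult_r_distr: "\<lbrakk>x \<in> carrier A; y \<in> carrier A; z \<in> carrier A\<rbrakk>
      \<Longrightarrow> z \<otimes> (x \<oplus> y) = z \<otimes> x \<oplus> z \<otimes> y"
    and smult_mult_l: "\<lbrakk>x \<in> carrier A; y \<in> carrier A\<rbrakk> \<Longrightarrow> (c \<odot> x) \<otimes> y = c \<odot> (x \<otimes> y)"
    and smult_mult_r: "\<lbrakk>x \<in> carrier A; y \<in> carrier A\<rbrakk> \<Longrightarrow> x \<otimes> (c \<odot> y) = c \<odot> (x \<otimes> y)"
    and one_is_unit: "\<lbrakk>e \<in> carrier A; \<And>x. x \<in> carrier A \<Longrightarrow> e \<otimes> x = x \<and> x \<otimes> e = x\<rbrakk> \<Longrightarrow> \<one> = e"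
    and adj_closed: "x \<in> carrier A \<Longrightarrow> adj x \<in> carrier A"
    and adj_adj: "x \<in> carrier A \<Longrightarrow> adj (adj x) = x"
    and adj_add: "\<lbrakk>x \<in> carrier A; y \<in> carrier A\<rbrakk> \<Longrightarrow> adj (x \<oplus> y) = adj x \<oplus> adj y"
    and adj_smult: "x \<in> carrier A \<Longrightarrow> adj (c \<odot> x) = cnj c \<odot> adj x"
    and adj_mult: "\<lbrakk>x \<in> carrier A; y \<in> carrier A\<rbrakk> \<Longrightarrow> adj (x \<otimes> y) = adj y \<otimes> adj x"
    and nrm_nonneg: "x \<in> carrier A \<Longrightarrow> 0 \<le> nrm x"
    and nrm_eq_zero: "x \<in> carrier A \<Longrightarrow> nrm x = 0 \<longleftrightarrow> x = \<zero>"
    and nrm_add: "\<lbrakk>x \<in> carrier A; y \<in> carrier A\<rbrakk> \<Longrightarrow> nrm (x \<oplus> y) \<le> nrm x + nrm y"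
    and nrm_smult: "x \<in> carrier A \<Longrightarrow> nrm (c \<odot> x) = cmod c * nrm x"
    and nrm_mult: "\<lbrakk>x \<in> carrier A; y \<in> carrier A\<rbrakk> \<Longrightarrow> nrm (x \<otimes> y) \<le> nrm x * nrm y"
    and nrm_cstar: "x \<in> carrier A \<Longrightarrow> nrm (adj x \<otimes> x) = (nrm x)\<^sup>2"
    and complete: "Metric_space.mcomplete (carrier A) (cdist A)"

definition star_hom :: "('a, 'm) cstar_scheme \<Rightarrow> ('b, 'n) cstar_scheme \<Rightarrow> ('a \<Rightarrow> 'b) \<Rightarrow> bool" where
  "star_hom A B \<phi> \<longleftrightarrow> \<phi> \<in> carrier A \<rightarrow> carrier B \<and>
    (\<forall>x\<in>carrier A. \<forall>y\<in>carrier A. \<phi> (x \<oplus>\<^bsub>A\<^esub> y) = \<phi> x \<oplus>\<^bsub>B\<^esub> \<phi> y) \<and>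
    (\<forall>c. \<forall>x\<in>carrier A. \<phi> (c \<odot>\<^bsub>A\<^esub> x) = c \<odot>\<^bsub>B\<^esub> \<phi> x) \<and>
    (\<forall>x\<in>carrier A. \<forall>y\<in>carrier A. \<phi> (x \<otimes>\<^bsub>A\<^esub> y) = \<phi> x \<otimes>\<^bsub>B\<^esub> \<phi> y) \<and>
    (\<forall>x\<in>carrier A. \<phi> (adj\<^bsub>A\<^esub> x) = adj\<^bsub>B\<^esub> (\<phi> x))"

definition star_aut :: "('a, 'm) cstar_scheme \<Rightarrow> ('a \<Rightarrow> 'a) \<Rightarrow> bool" where
  "star_aut A \<phi> \<longleftrightarrow> star_hom A A \<phi> \<and> bij_betw \<phi> (carrier A) (carrier A)"

definition lspan :: "('a, 'm) cstar_scheme \<Rightarrow> 'a set \<Rightarrow> 'a set" where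
  "lspan A Y = \<Inter> {V. submodule V complex_ring A \<and> Y \<subseteq> V}"

definition cstar_subalgebra :: "'a set \<Rightarrow> ('a, 'm) cstar_scheme \<Rightarrow> bool" where
  "cstar_subalgebra B A \<longleftrightarrow> submodule B complex_ring A \<and>
    (\<forall>x\<in>B. \<forall>y\<in>B. x \<otimes> y \<in> B) \<and> (\<forall>x\<in>B. adj x \<in> B) \<and>
    closedin (Metric_space.mtopology (carrier A) (cdist A)) B" for A (structure)

definition cstar_gen :: "('a, 'm) cstar_scheme \<Rightarrow> 'a set \<Rightarrow> 'a set" where
  "cstar_gen A Y = \<Inter> {B. cstar_subalgebra B A \<and> Y \<subseteq> B}"

definition is_projection :: "('a, 'm) cstar_scheme \<Rightarrow> 'a \<Rightarrow> bool" where
  "is_projection A p \<longleftrightarrow> p \<in> carrier A \<and> p \<otimes> p = p \<and> adj p = p" for A (structure)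

definition is_partial_isometry :: "('a, 'm) cstar_scheme \<Rightarrow> 'a \<Rightarrow> bool" where
  "is_partial_isometry A s \<longleftrightarrow> s \<in> carrier A \<and> s \<otimes> adj s \<otimes> s = s" for A (structure)

text \<open>The order on self-adjoint elements; the positive elements are those of the form \<open>x\<^sup>* x\<close>.\<close>

definition cle :: "('a, 'm) cstar_scheme \<Rightarrow> 'a \<Rightarrow> 'a \<Rightarrow> bool" where
  "cle A a b \<longleftrightarrow> a \<in> carrier A \<and> b \<in> carrier A \<and> adj a = a \<and> adj b = b \<and>
    (\<exists>x\<in>carrier A. b \<ominus> a = adj x \<otimes> x)" for A (structure)

text \<open>\<open>unitaries A B\<close> and \<open>normalizer A B D\<close> are meant for subalgebras \<open>D \<subseteq> B \<subseteq> A\<close> that contain the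
  unit of \<open>A\<close>.\<close>

definition unitaries :: "('a, 'm) cstar_scheme \<Rightarrow> 'a set \<Rightarrow> 'a set" where
  "unitaries A B = {u \<in> B. adj u \<otimes> u = \<one> \<and> u \<otimes> adj u = \<one>}" for A (structure)

definition normalizer :: "('a, 'm) cstar_scheme \<Rightarrow> 'a set \<Rightarrow> 'a set \<Rightarrow> 'a set" where
  "normalizer A B D = {u \<in> unitaries A B. (\<lambda>x. u \<otimes> x \<otimes> adj u) ` D = D}" for A (structure)


section \<open>Graph C*-algebras\<close>

text \<open>In a digraph \<open>E\<close> the source and range maps are \<open>tail E\<close> and \<open>head E\<close>.\<close>

definition is_sink :: "('v, 'e) pre_digraph \<Rightarrow> 'v \<Rightarrow> bool" where
  "is_sink E v \<longleftrightarrow> v \<in> verts E \<and> out_arcs E v = {}"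

definition ck_family ::
  "('v, 'e) pre_digraph \<Rightarrow> ('a, 'm) cstar_scheme \<Rightarrow> ('v \<Rightarrow> 'a) \<Rightarrow> ('e \<Rightarrow> 'a) \<Rightarrow> bool" where
  "ck_family E A P S \<longleftrightarrow>
    (\<forall>v\<in>verts E. is_projection A (P v)) \<and>
    (\<forall>v\<in>verts E. \<forall>w\<in>verts E. v \<noteq> w \<longrightarrow> P v \<otimes> P w = \<zero>) \<and>
    (\<forall>e\<in>arcs E. is_partial_isometry A (S e)) \<and>
    (\<forall>e\<in>arcs E. adj (S e) \<otimes> S e = P (head E e)) \<and>
    (\<forall>e\<in>arcs E. \<forall>f\<in>arcs E. e \<noteq> f \<longrightarrow> adj (S e) \<otimes> S f = \<zero>) \<and>
    (\<forall>e\<in>arcs E. cle A (S e \<otimes> adj (S e)) (P (tail E e))) \<and>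
    (\<forall>v\<in>verts E. finite (out_arcs E v) \<and> out_arcs E v \<noteq> {} \<longrightarrow>
      P v = (\<Oplus>e\<in>out_arcs E v. S e \<otimes> adj (S e)))" for A (structure)

text \<open>\<open>A\<close>, with the family \<open>(P, S)\<close>, is \<open>C\<^sup>*(E)\<close>. Since one cannot quantify over all types, the
  universal property is stated for the C*-algebras \<open>B\<close> carried by the same type \<open>'a\<close>. For a
  countable \<open>E\<close> this is no restriction: a C*-algebra generated by a Cuntz-Krieger \<open>E\<close>-family is
  separable, hence has at most continuum many elements, and therefore has an isomorphic copy on any
  type with at least that many elements. That \<open>'a\<close> is such a type is the injectivity condition,
  which holds automatically as soon as \<open>A\<close> is nonzero.\<close>

definition is_graph_cstar_algebra ::
  "('v, 'e) pre_digraph \<Rightarrow> 'a cstar \<Rightarrow> ('v \<Rightarrow> 'a) \<Rightarrow> ('e \<Rightarrow> 'a) \<Rightarrow> bool" where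
  "is_graph_cstar_algebra E A P S \<longleftrightarrow>
    cstar_algebra A \<and> ck_family E A P S \<and>
    carrier A = cstar_gen A (P ` verts E \<union> S ` arcs E) \<and>
    (\<exists>\<iota> :: complex \<Rightarrow> 'a. inj \<iota>) \<and>
    (\<forall>(B :: 'a cstar) Q T. cstar_algebra B \<and> ck_family E B Q T \<longrightarrow>
      (\<exists>\<phi>. star_hom A B \<phi> \<and> (\<forall>v\<in>verts E. \<phi> (P v) = Q v) \<and> (\<forall>e\<in>arcs E. \<phi> (S e) = T e)))"

text \<open>A path is encoded as its source vertex together with its list of edges, so that \<open>(v, [])\<close> is
  the vertex \<open>v\<close> as a path of length 0.\<close>

definition paths :: "('v, 'e) pre_digraph \<Rightarrow> ('v \<times> 'e list) set" where
  "paths E = {(v, p). \<exists>w. pre_digraph.awalk E v p w}"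

definition paths_of_length :: "('v, 'e) pre_digraph \<Rightarrow> nat \<Rightarrow> ('v \<times> 'e list) set" where
  "paths_of_length E k = {\<mu> \<in> paths E. length (snd \<mu>) = k}"

fun S_path :: "('a, 'm) cstar_scheme \<Rightarrow> ('v \<Rightarrow> 'a) \<Rightarrow> ('e \<Rightarrow> 'a) \<Rightarrow> 'v \<times> 'e list \<Rightarrow> 'a" where
  "S_path A P S (v, []) = P v"
| "S_path A P S (v, [e]) = S e"
| "S_path A P S (v, e # f # p) = S e \<otimes>\<^bsub>A\<^esub> S_path A P S (v, f # p)"

definition P_path :: "('a, 'm) cstar_scheme \<Rightarrow> ('v \<Rightarrow> 'a) \<Rightarrow> ('e \<Rightarrow> 'a) \<Rightarrow> 'v \<times> 'e list \<Rightarrow> 'a" where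
  "P_path A P S \<mu> = S_path A P S \<mu> \<otimes> adj (S_path A P S \<mu>)" for A (structure)

definition D_alg ::
  "('v, 'e) pre_digraph \<Rightarrow> ('a, 'm) cstar_scheme \<Rightarrow> ('v \<Rightarrow> 'a) \<Rightarrow> ('e \<Rightarrow> 'a) \<Rightarrow> 'a set" where
  "D_alg E A P S = cstar_gen A (P_path A P S ` paths E)"

definition D_level ::
  "('v, 'e) pre_digraph \<Rightarrow> ('a, 'm) cstar_scheme \<Rightarrow> ('v \<Rightarrow> 'a) \<Rightarrow> ('e \<Rightarrow> 'a) \<Rightarrow> nat \<Rightarrow> 'a set" where
  "D_level E A P S k = lspan A (P_path A P S ` paths_of_length E k)"

definition F_level ::
  "('v, 'e) pre_digraph \<Rightarrow> ('a, 'm) cstar_scheme \<Rightarrow> ('v \<Rightarrow> 'a) \<Rightarrow> ('e \<Rightarrow> 'a) \<Rightarrow> nat \<Rightarrow> 'a set" where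
  "F_level E A P S k = lspan A {S_path A P S \<mu> \<otimes> adj (S_path A P S \<nu>) | \<mu> \<nu>.
    \<mu> \<in> paths_of_length E k \<and> \<nu> \<in> paths_of_length E k}" for A (structure)

definition U_group ::
  "('v, 'e) pre_digraph \<Rightarrow> ('a, 'm) cstar_scheme \<Rightarrow> ('v \<Rightarrow> 'a) \<Rightarrow> 'a set" where
  "U_group E A P = {u \<in> unitaries A (carrier A). \<forall>v\<in>verts E. u \<otimes> P v = P v \<otimes> u}"
    for A (structure)

text \<open>The endomorphism \<open>\<lambda>\<^sub>u\<close>. It exists by the universal property of \<open>A\<close> and is determined on the
  carrier of \<open>A\<close>, outside of which its values are irrelevant.\<close>

definition graph_endo ::
  "('v, 'e) pre_digraph \<Rightarrow> ('a, 'm) cstar_scheme \<Rightarrow> ('v \<Rightarrow> 'a) \<Rightarrow> ('e \<Rightarrow> 'a) \<Rightarrow> 'a \<Rightarrow> 'a \<Rightarrow> 'a" where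
  "graph_endo E A P S u = (SOME \<phi>. star_hom A A \<phi> \<and> \<phi> \<one> = \<one> \<and>
    (\<forall>e\<in>arcs E. \<phi> (S e) = u \<otimes> S e) \<and> (\<forall>v\<in>verts E. \<phi> (P v) = P v))" for A (structure)


section \<open>Quotient spaces and rings of linear maps\<close>

text \<open>Quotient of a complex vector space; its product and unit are of no meaning.\<close>

definition quot_space :: "(complex, 'a, 'm) module_scheme \<Rightarrow> 'a set \<Rightarrow> (complex, 'a set) module" where
  "quot_space M W = \<lparr>carrier = a_rcosets W, monoid.mult = undefined, one = undefined, ring.zero = W,
    add = set_add M, module.smult = (\<lambda>c Y. the_elem ((\<lambda>x. W +> (c \<odot> x)) ` Y))\<rparr>" for M (structure)

definition quot_map ::
  "(complex, 'a, 'm) module_scheme \<Rightarrow> 'a set \<Rightarrow> ('a \<Rightarrow> 'a) \<Rightarrow> 'a set \<Rightarrow> 'a set" where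
  "quot_map M W f = (\<lambda>Y\<in>a_rcosets W. the_elem ((\<lambda>x. W +> f x) ` Y))" for M (structure)

definition linear_map_ring :: "(complex, 'b, 'm) module_scheme \<Rightarrow> ('b \<Rightarrow> 'b) ring" where
  "linear_map_ring M =
    \<lparr>carrier = {f \<in> carrier M \<rightarrow>\<^sub>E carrier M.
       (\<forall>x\<in>carrier M. \<forall>y\<in>carrier M. f (x \<oplus> y) = f x \<oplus> f y) \<and>
       (\<forall>c. \<forall>x\<in>carrier M. f (c \<odot> x) = c \<odot> f x)},
     monoid.mult = compose (carrier M),
     one = (\<lambda>x\<in>carrier M. x),
     ring.zero = (\<lambda>x\<in>carrier M. \<zero>),
     add = (\<lambda>f g. \<lambda>x\<in>carrier M. f x \<oplus> g x)\<rparr>" for M (structure)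

text \<open>In contrast to \<open>generate_ring\<close>, the unit of \<open>R\<close> is not thrown in.\<close>

definition generate_rng :: "('a, 'm) ring_scheme \<Rightarrow> 'a set \<Rightarrow> 'a set" where
  "generate_rng R Y = \<Inter> {B. additive_subgroup B R \<and> (\<forall>x\<in>B. \<forall>y\<in>B. x \<otimes> y \<in> B) \<and> Y \<subseteq> B}"
    for R (structure)

text \<open>\<open>rng_power R B n\<close> is \<open>B\<^sup>n\<^sup>+\<^sup>1\<close>: all finite sums of products of \<open>n + 1\<close> elements of \<open>B\<close>.
  (The inductive definition of \<open>ideal_prod\<close> makes sense for arbitrary subsets.)\<close>

primrec rng_power :: "('a, 'm) ring_scheme \<Rightarrow> 'a set \<Rightarrow> nat \<Rightarrow> 'a set" where
  "rng_power R B 0 = B"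
| "rng_power R B (Suc n) = ideal_prod R (rng_power R B n) B"

definition nilpotent_rng :: "('a, 'm) ring_scheme \<Rightarrow> 'a set \<Rightarrow> bool" where
  "nilpotent_rng R B \<longleftrightarrow> (\<exists>n. rng_power R B n = {\<zero>\<^bsub>R\<^esub>})"


section \<open>The ring and the subspaces attached to a unitary\<close>

definition b_map :: "('v, 'e) pre_digraph \<Rightarrow> ('a, 'm) cstar_scheme \<Rightarrow> ('v \<Rightarrow> 'a) \<Rightarrow> ('e \<Rightarrow> 'a) \<Rightarrow>
    nat \<Rightarrow> 'a \<Rightarrow> 'e \<Rightarrow> 'e \<Rightarrow> 'a \<Rightarrow> 'a" where
  "b_map E A P S k u e f =
    (\<lambda>x\<in>D_level E A P S (k - 1). adj (S e) \<otimes> adj u \<otimes> x \<otimes> u \<otimes> S f)" for A (structure)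

definition D_space :: "('v, 'e) pre_digraph \<Rightarrow> 'a cstar \<Rightarrow> ('v \<Rightarrow> 'a) \<Rightarrow> ('e \<Rightarrow> 'a) \<Rightarrow> nat \<Rightarrow> 'a cstar"
  where "D_space E A P S k = A\<lparr>carrier := D_level E A P S k\<rparr>"

definition V_space ::
  "('v, 'e) pre_digraph \<Rightarrow> 'a cstar \<Rightarrow> ('v \<Rightarrow> 'a) \<Rightarrow> ('e \<Rightarrow> 'a) \<Rightarrow> nat \<Rightarrow> (complex, 'a set) module" where
  "V_space E A P S k = quot_space (D_space E A P S (k - 1)) (D_level E A P S 0)"

definition b_quot :: "('v, 'e) pre_digraph \<Rightarrow> 'a cstar \<Rightarrow> ('v \<Rightarrow> 'a) \<Rightarrow> ('e \<Rightarrow> 'a) \<Rightarrow>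
    nat \<Rightarrow> 'a \<Rightarrow> 'e \<Rightarrow> 'e \<Rightarrow> 'a set \<Rightarrow> 'a set" where
  "b_quot E A P S k u e f =
    quot_map (D_space E A P S (k - 1)) (D_level E A P S 0) (b_map E A P S k u e f)"

definition A_ring :: "('v, 'e) pre_digraph \<Rightarrow> 'a cstar \<Rightarrow> ('v \<Rightarrow> 'a) \<Rightarrow> ('e \<Rightarrow> 'a) \<Rightarrow>
    nat \<Rightarrow> 'a \<Rightarrow> ('a set \<Rightarrow> 'a set) set" where
  "A_ring E A P S k u = generate_rng (linear_map_ring (V_space E A P S k))
    {b_quot E A P S k u e f | e f. e \<in> arcs E \<and> f \<in> arcs E}"

primrec Xi_seq :: "('v, 'e) pre_digraph \<Rightarrow> ('a, 'm) cstar_scheme \<Rightarrow> ('v \<Rightarrow> 'a) \<Rightarrow> ('e \<Rightarrow> 'a) \<Rightarrow>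
    nat \<Rightarrow> 'a \<Rightarrow> nat \<Rightarrow> 'a set" where
  "Xi_seq E A P S k u 0 = D_level E A P S (k - 1)"
| "Xi_seq E A P S k u (Suc r) = lspan A
    {adj\<^bsub>A\<^esub> a \<otimes>\<^bsub>A\<^esub> x \<otimes>\<^bsub>A\<^esub> b | a x b.
      a \<in> graph_endo E A P S u ` lspan A (S ` arcs E) \<and>
      x \<in> Xi_seq E A P S k u r \<and>
      b \<in> graph_endo E A P S u ` lspan A (S ` arcs E)}"

definition Xi :: "('v, 'e) pre_digraph \<Rightarrow> ('a, 'm) cstar_scheme \<Rightarrow> ('v \<Rightarrow> 'a) \<Rightarrow> ('e \<Rightarrow> 'a) \<Rightarrow>
    nat \<Rightarrow> 'a \<Rightarrow> 'a set" where
  "Xi E A P S k u = (\<Inter>r. Xi_seq E A P S k u r)"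

end

theory Submission
  imports Defs
begin

text \<open>Write \<open>\<phi>\<close> for \<open>\<lambda>\<^sub>u\<close>, \<open>D\<^sup>m\<close> for the span of the \<open>P\<^sub>\<mu>\<close> with \<open>|\<mu>| = m\<close>, \<open>b\<^sub>e\<^sub>,\<^sub>f(x) = \<phi>(S\<^sub>e)\<^sup>* x \<phi>(S\<^sub>f)\<close>, and
  \<open>X r\<close> for the \<open>r\<close>-th term of the nested sequence that defines \<open>\<Xi>\<close>; it is spanned by the values on
  \<open>D\<^sup>k\<^sup>-\<^sup>1\<close> of the \<open>r\<close>-fold compositions of the maps \<open>b\<^sub>e\<^sub>,\<^sub>f\<close>. All three conditions are equivalent to one
  statement: \<open>X r \<subseteq> D\<^sup>0\<close> for some \<open>r\<close>.

  For \<open>\<Xi> \<subseteq> D\<^sup>0\<close> this is finite dimensionality: the decreasing sequence \<open>X r\<close> of subspaces of \<open>D\<^sup>k\<^sup>-\<^sup>1\<close> is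
  eventually constant (\<open>Xi_subset_D0_iff\<close>).

  For nilpotency, the generators of the ring are the maps that the \<open>b\<^sub>e\<^sub>,\<^sub>f\<close> induce on \<open>D\<^sup>k\<^sup>-\<^sup>1 / D\<^sup>0\<close>. Every
  element of the ring carries the image of \<open>X j\<close> into that of \<open>X (j + 1)\<close>, so a high power
  vanishes once some \<open>X r\<close> is zero modulo \<open>D\<^sup>0\<close> (\<open>nilpotent_if_X_vanishes\<close>); and if a power vanishes,
  all sufficiently long compositions of the \<open>b\<^sub>e\<^sub>,\<^sub>f\<close> end in \<open>D\<^sup>0\<close> (\<open>X_vanishes_if_nilpotent\<close>).

  For automorphisms, the key identity is \<open>b\<^sub>e\<^sub>,\<^sub>f(\<phi>(z)) = \<phi>(S\<^sub>e\<^sup>* z S\<^sub>f)\<close>: applying a \<open>b\<^sub>e\<^sub>,\<^sub>f\<close> lowers the level of a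
  preimage by one. Hence \<open>D\<^sup>k\<^sup>-\<^sup>1 \<subseteq> \<phi>(D\<^sup>r)\<close> gives \<open>X r \<subseteq> \<phi>(D\<^sup>0) = D\<^sup>0\<close>. Conversely, since \<open>u\<close> normalizes
  \<open>D\<^sup>k\<close>, the \<open>b\<^sub>e\<^sub>,\<^sub>f\<close> with \<open>e \<noteq> f\<close> vanish on \<open>D\<^sup>k\<^sup>-\<^sup>1\<close>, so \<open>x\<close> is recovered from its values as
  \<open>\<Sum>\<^sub>e \<phi>(S\<^sub>e) b\<^sub>e\<^sub>,\<^sub>e(x) \<phi>(S\<^sub>e)\<^sup>*\<close>, and \<open>X r \<subseteq> D\<^sup>0\<close> gives \<open>D\<^sup>k\<^sup>-\<^sup>1 \<subseteq> \<phi>(D\<^sup>r)\<close>. It remains to compare this inclusion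
  with surjectivity on the whole diagonal. If \<open>\<phi>\<close> is an automorphism of the diagonal, the preimage
  of each \<open>P\<^sub>\<mu>\<close> is a projection in the closure of the union of the \<open>D\<^sup>m\<close>, hence lies in one of them
  (\<open>projection_in_some_D\<close>). If \<open>D\<^sup>k\<^sup>-\<^sup>1\<close> is in the range, then so is every \<open>D\<^sup>m\<close>, by induction on \<open>m\<close>,
  because \<open>u D\<^sup>m u\<^sup>* = D\<^sup>m\<close> for \<open>m \<ge> k\<close> (\<open>conjugation_preserves_D\<close>), and the range is closed because
  \<open>\<phi>\<close> is isometric on the diagonal.

  Two analytic facts support this. A *-homomorphism is contractive (\<open>star_hom_contractive\<close>): a
  self-adjoint \<open>a\<close> of norm less than 1 is the real part of the unitary \<open>a + i b\<close> with
  \<open>b\<^sup>2 = 1 - a\<^sup>2\<close>. And \<open>\<phi>\<close> is bounded below by 1 on the diagonal, where the norm of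
  \<open>\<Sum> c\<^sub>\<mu> P\<^sub>\<mu>\<close> is the maximum of the \<open>|c\<^sub>\<mu>|\<close> over the nonzero \<open>P\<^sub>\<mu>\<close>: for such \<open>\<mu>\<close> also \<open>\<phi>(P\<^sub>\<mu>)\<close> is nonzero,
  since \<open>S\<^sub>\<mu>\<^sup>* P\<^sub>\<mu> S\<^sub>\<mu>\<close> is some \<open>P\<^sub>v\<close>, which \<open>\<phi>\<close> fixes.\<close>

section \<open>Limits and linear spans in a C*-algebra\<close>

lemma complex_ring_simps [simp]:
  "carrier complex_ring = UNIV" "x \<otimes>\<^bsub>complex_ring\<^esub> y = x * y" "\<one>\<^bsub>complex_ring\<^esub> = 1"
  "\<zero>\<^bsub>complex_ring\<^esub> = 0" "x \<oplus>\<^bsub>complex_ring\<^esub> y = x + y"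
  by (simp_all add: complex_ring_def)

context cstar_algebra
begin

lemma smult_in [simp, intro]: "x \<in> carrier A \<Longrightarrow> c \<odot> x \<in> carrier A"
  using smult_closed by simp

lemma smult_add_l: "x \<in> carrier A \<Longrightarrow> (c + d) \<odot> x = c \<odot> x \<oplus> d \<odot> x"
  using smult_l_distr[of c d x] by simp

lemma smult_add_r: "\<lbrakk>x \<in> carrier A; y \<in> carrier A\<rbrakk> \<Longrightarrow> c \<odot> (x \<oplus> y) = c \<odot> x \<oplus> c \<odot> y"
  using smult_r_distr[of c x y] by simp

lemma smult_smult [simp]: "x \<in> carrier A \<Longrightarrow> c \<odot> (d \<odot> x) = (c * d) \<odot> x"
  using smult_assoc1[of c d x] by simp

lemma one_smult [simp]: "x \<in> carrier A \<Longrightarrow> 1 \<odot> x = x"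
  using smult_one by simp

lemma zero_smult [simp]: "x \<in> carrier A \<Longrightarrow> 0 \<odot> x = \<zero>"
  using smult_l_null by simp

lemma smult_zero [simp]: "c \<odot> \<zero> = \<zero>"
  using smult_r_null[of c] by simp

lemma neg_eq_smult: "x \<in> carrier A \<Longrightarrow> \<ominus> x = (- 1) \<odot> x"
  using smult_add_l[of x 1 "-1"] by (simp add: minus_equality M.add.m_comm)

lemma neg_add: "\<lbrakk>x \<in> carrier A; y \<in> carrier A\<rbrakk> \<Longrightarrow> \<ominus> (x \<oplus> y) = \<ominus> x \<oplus> \<ominus> y"
  by (simp add: neg_eq_smult smult_add_r)

declare mult_closed [simp, intro] adj_closed [simp, intro] adj_adj [simp]

lemma mult_zero [simp]: "x \<in> carrier A \<Longrightarrow> x \<otimes> \<zero> = \<zero>" "x \<in> carrier A \<Longrightarrow> \<zero> \<otimes> x = \<zero>"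
  using smult_mult_r[of x \<zero> 0] smult_mult_l[of \<zero> x 0] by simp_all

lemma adj_zero [simp]: "adj \<zero> = \<zero>"
  using adj_smult[of \<zero> 0] by simp

lemma diff_in [simp, intro]: "\<lbrakk>x \<in> carrier A; y \<in> carrier A\<rbrakk> \<Longrightarrow> x \<ominus> y \<in> carrier A"
  by (simp add: a_minus_def)

lemma diff_eq_smult: "\<lbrakk>x \<in> carrier A; y \<in> carrier A\<rbrakk> \<Longrightarrow> x \<ominus> y = x \<oplus> (- 1) \<odot> y"
  by (simp add: a_minus_def neg_eq_smult)

lemma diff_self [simp]: "x \<in> carrier A \<Longrightarrow> x \<ominus> x = \<zero>"
  by (simp add: a_minus_def M.r_neg)

lemma diff_eq_zero_iff: "\<lbrakk>x \<in> carrier A; y \<in> carrier A\<rbrakk> \<Longrightarrow> x \<ominus> y = \<zero> \<longleftrightarrow> x = y"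
  by (metis M.add.inv_closed M.minus_equality M.r_neg M.minus_minus a_minus_def)

lemma mult_diff_r: "\<lbrakk>x \<in> carrier A; y \<in> carrier A; z \<in> carrier A\<rbrakk> \<Longrightarrow> z \<otimes> (x \<ominus> y) = z \<otimes> x \<ominus> z \<otimes> y"
  by (simp add: diff_eq_smult mult_r_distr smult_mult_r)

lemma mult_diff_l: "\<lbrakk>x \<in> carrier A; y \<in> carrier A; z \<in> carrier A\<rbrakk> \<Longrightarrow> (x \<ominus> y) \<otimes> z = x \<otimes> z \<ominus> y \<otimes> z"
  by (simp add: diff_eq_smult mult_l_distr smult_mult_l)

lemma smult_diff: "\<lbrakk>x \<in> carrier A; y \<in> carrier A\<rbrakk> \<Longrightarrow> c \<odot> (x \<ominus> y) = c \<odot> x \<ominus> c \<odot> y"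
  by (simp add: diff_eq_smult smult_add_r mult.commute)

lemma adj_diff: "\<lbrakk>x \<in> carrier A; y \<in> carrier A\<rbrakk> \<Longrightarrow> adj (x \<ominus> y) = adj x \<ominus> adj y"
  by (simp add: diff_eq_smult adj_add adj_smult)

lemma neg_one_add: "x \<in> carrier A \<Longrightarrow> (- 1) \<odot> x \<oplus> x = \<zero>"
  using smult_add_l[of x "-1" 1] by simp

lemma diff_split:
  assumes "x \<in> carrier A" "y \<in> carrier A" "z \<in> carrier A"
  shows "x \<ominus> z = (x \<ominus> y) \<oplus> (y \<ominus> z)"
proof -
  have "(x \<ominus> y) \<oplus> (y \<ominus> z) = x \<oplus> ((\<ominus> y \<oplus> y) \<oplus> \<ominus> z)"
    using assms by (simp add: a_minus_def M.add.m_assoc)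
  then show ?thesis
    using assms by (simp add: M.l_neg a_minus_def)
qed

lemma add_diff_add:
  assumes "x \<in> carrier A" "y \<in> carrier A" "x' \<in> carrier A" "y' \<in> carrier A"
  shows "(x \<oplus> y) \<ominus> (x' \<oplus> y') = (x \<ominus> x') \<oplus> (y \<ominus> y')"
  using assms by (simp add: a_minus_def neg_add M.add.m_ac)

lemma nrm_zero [simp]: "nrm \<zero> = 0"
  using nrm_eq_zero[of \<zero>] by simp

lemma nrm_swap: "\<lbrakk>x \<in> carrier A; y \<in> carrier A\<rbrakk> \<Longrightarrow> nrm (x \<ominus> y) = nrm (y \<ominus> x)"
proof -
  assume xy: "x \<in> carrier A" "y \<in> carrier A"
  have "nrm (x \<ominus> y) = nrm ((-1) \<odot> (y \<ominus> x))"
    using xy by (simp add: diff_eq_smult smult_add_r M.add.m_comm)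
  then show ?thesis using xy by (subst (asm) nrm_smult) simp_all
qed

lemma nrm_triangle:
  "\<lbrakk>x \<in> carrier A; y \<in> carrier A; z \<in> carrier A\<rbrakk> \<Longrightarrow> nrm (x \<ominus> z) \<le> nrm (x \<ominus> y) + nrm (y \<ominus> z)"
  using nrm_add[of "x \<ominus> y" "y \<ominus> z"] diff_split[of x y z] by simp

lemma nrm_adj [simp]: "x \<in> carrier A \<Longrightarrow> nrm (adj x) = nrm x"
proof -
  have le: "nrm x \<le> nrm (adj x)" if "x \<in> carrier A" for x
  proof (cases "nrm x = 0")
    case False
    have "nrm x * nrm x \<le> nrm (adj x) * nrm x"
      using nrm_cstar[OF that] nrm_mult[of "adj x" x] that by (simp add: power2_eq_square)
    then show ?thesis using False nrm_nonneg[OF that] by simp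
  qed (simp add: nrm_nonneg that)
  assume "x \<in> carrier A"
  then show ?thesis using le[of x] le[of "adj x"] by simp
qed

lemma metric: "Metric_space (carrier A) (cdist A)"
proof
  show "0 \<le> cdist A x y" for x y
    by (simp add: cdist_def nrm_nonneg)
  show "cdist A x y = cdist A y x" for x y
    by (auto simp: cdist_def nrm_swap)
  show "cdist A x y = 0 \<longleftrightarrow> x = y" if "x \<in> carrier A" "y \<in> carrier A" for x y
    using that by (simp add: cdist_def nrm_eq_zero diff_eq_zero_iff)
  show "cdist A x z \<le> cdist A x y + cdist A y z"
    if "x \<in> carrier A" "y \<in> carrier A" "z \<in> carrier A" for x y z
    using that by (simp add: cdist_def nrm_triangle)
qed

text \<open>Norm convergence of sequences. It is the convergence of the metric topology (\<open>conv_limitin\<close>), stated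
  through \<open>nrm\<close> so that norm estimates apply directly; identities pass to limits by \<open>conv_unique\<close>.\<close>

definition conv :: "(nat \<Rightarrow> 'a) \<Rightarrow> 'a \<Rightarrow> bool" where
  "conv \<sigma> x \<longleftrightarrow> range \<sigma> \<subseteq> carrier A \<and> x \<in> carrier A \<and> (\<lambda>n. nrm (\<sigma> n \<ominus> x)) \<longlonglongrightarrow> 0"

lemma conv_limitin: "conv \<sigma> x \<longleftrightarrow> range \<sigma> \<subseteq> carrier A \<and>
    limitin (Metric_space.mtopology (carrier A) (cdist A)) \<sigma> x sequentially"
proof (cases "range \<sigma> \<subseteq> carrier A \<and> x \<in> carrier A")
  case True
  then have "cdist A (\<sigma> n) x = nrm (\<sigma> n \<ominus> x)" "\<sigma> n \<in> carrier A" for n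
    by (auto simp: cdist_def)
  then show ?thesis
    using True by (simp add: conv_def Metric_space.limitin_metric_dist_null[OF metric])
qed (auto simp: conv_def Metric_space.limitin_metric_dist_null[OF metric])

lemma convD: "conv \<sigma> x \<Longrightarrow> \<sigma> n \<in> carrier A" "conv \<sigma> x \<Longrightarrow> x \<in> carrier A"
  "conv \<sigma> x \<Longrightarrow> (\<lambda>n. nrm (\<sigma> n \<ominus> x)) \<longlonglongrightarrow> 0"
  by (auto simp: conv_def)

lemma conv_unique: "\<lbrakk>conv \<sigma> x; conv \<sigma> y\<rbrakk> \<Longrightarrow> x = y"
  using Metric_space.limitin_metric_unique[OF metric, of \<sigma> x sequentially y] by (simp add: conv_limitin)

lemma conv_sandwich:
  assumes "range \<sigma> \<subseteq> carrier A" "x \<in> carrier A" "\<And>n. nrm (\<sigma> n \<ominus> x) \<le> b n" "b \<longlonglongrightarrow> 0"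
  shows "conv \<sigma> x"
  unfolding conv_def
  using assms by (auto intro!: tendsto_sandwich[of "\<lambda>_. 0" "\<lambda>n. nrm (\<sigma> n \<ominus> x)" sequentially b]
      always_eventually nrm_nonneg)

lemma conv_const: "x \<in> carrier A \<Longrightarrow> conv (\<lambda>_. x) x"
  by (auto simp: conv_def)

lemma conv_add:
  assumes "conv \<sigma> x" "conv \<tau> y"
  shows "conv (\<lambda>n. \<sigma> n \<oplus> \<tau> n) (x \<oplus> y)"
proof (rule conv_sandwich)
  note [simp] = convD(1,2)[OF assms(1)] convD(1,2)[OF assms(2)]
  show "nrm (\<sigma> n \<oplus> \<tau> n \<ominus> (x \<oplus> y)) \<le> nrm (\<sigma> n \<ominus> x) + nrm (\<tau> n \<ominus> y)" for n
    by (simp add: add_diff_add nrm_add)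
  show "(\<lambda>n. nrm (\<sigma> n \<ominus> x) + nrm (\<tau> n \<ominus> y)) \<longlonglongrightarrow> 0"
    using tendsto_add[OF convD(3)[OF assms(1)] convD(3)[OF assms(2)]] by simp
qed (auto simp: convD[OF assms(1)] convD[OF assms(2)])

lemma conv_smult:
  assumes "conv \<sigma> x"
  shows "conv (\<lambda>n. c \<odot> \<sigma> n) (c \<odot> x)"
proof (rule conv_sandwich)
  note [simp] = convD(1,2)[OF assms(1)]
  show "nrm (c \<odot> \<sigma> n \<ominus> c \<odot> x) \<le> cmod c * nrm (\<sigma> n \<ominus> x)" for n
    by (simp add: smult_diff[symmetric] nrm_smult)
  show "(\<lambda>n. cmod c * nrm (\<sigma> n \<ominus> x)) \<longlonglongrightarrow> 0"
    using tendsto_mult_left[OF convD(3)[OF assms], of "cmod c"] by simp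
qed (auto simp: convD[OF assms(1)])

lemma conv_adj:
  assumes "conv \<sigma> x"
  shows "conv (\<lambda>n. adj (\<sigma> n)) (adj x)"
  using assms by (auto simp: conv_def image_subset_iff adj_diff[symmetric])

lemma conv_mult:
  assumes "conv \<sigma> x" "conv \<tau> y"
  shows "conv (\<lambda>n. \<sigma> n \<otimes> \<tau> n) (x \<otimes> y)"
proof (rule conv_sandwich)
  note [simp] = convD(1,2)[OF assms(1)] convD(1,2)[OF assms(2)]
  let ?a = "\<lambda>n. nrm (\<sigma> n \<ominus> x)" and ?b = "\<lambda>n. nrm (\<tau> n \<ominus> y)"
  show "nrm (\<sigma> n \<otimes> \<tau> n \<ominus> x \<otimes> y) \<le> ?a n * (?b n + nrm y) + nrm x * ?b n" for n
  proof -
    have "nrm (\<sigma> n \<otimes> \<tau> n \<ominus> x \<otimes> y) \<le> nrm ((\<sigma> n \<ominus> x) \<otimes> \<tau> n) + nrm (x \<otimes> (\<tau> n \<ominus> y))"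
      using nrm_triangle[of "\<sigma> n \<otimes> \<tau> n" "x \<otimes> \<tau> n" "x \<otimes> y"] by (simp add: mult_diff_l mult_diff_r)
    also have "\<dots> \<le> ?a n * nrm (\<tau> n) + nrm x * ?b n"
      by (intro add_mono nrm_mult) simp_all
    also have "nrm (\<tau> n) \<le> ?b n + nrm y"
      using nrm_triangle[of "\<tau> n" y \<zero>] by (simp add: diff_eq_smult[of _ \<zero>])
    finally show ?thesis
      by (simp add: mult_left_mono nrm_nonneg)
  qed
  show "(\<lambda>n. ?a n * (?b n + nrm y) + nrm x * ?b n) \<longlonglongrightarrow> 0"
    using convD(3)[OF assms(1)] convD(3)[OF assms(2)]
    by (auto intro!: tendsto_eq_intros)
qed (auto simp: convD[OF assms(1)] convD[OF assms(2)])

lemma Cauchy_conv: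
  assumes "range \<sigma> \<subseteq> carrier A"
    and "\<And>\<epsilon>. \<epsilon> > 0 \<Longrightarrow> \<exists>N. \<forall>m\<ge>N. \<forall>n\<ge>N. nrm (\<sigma> m \<ominus> \<sigma> n) < \<epsilon>"
  shows "\<exists>x. conv \<sigma> x"
proof -
  have *: "cdist A (\<sigma> m) (\<sigma> n) = nrm (\<sigma> m \<ominus> \<sigma> n)" for m n
    using assms(1) by (auto simp: cdist_def)
  have "Metric_space.MCauchy (carrier A) (cdist A) \<sigma>"
    unfolding Metric_space.MCauchy_def[OF metric] *
    using assms by meson
  then show ?thesis
    using complete assms(1) by (auto simp: conv_limitin Metric_space.mcomplete_def[OF metric])
qed

lemma closedin_iff: "closedin (Metric_space.mtopology (carrier A) (cdist A)) B \<longleftrightarrow>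
    B \<subseteq> carrier A \<and> (\<forall>\<sigma> x. range \<sigma> \<subseteq> B \<and> conv \<sigma> x \<longrightarrow> x \<in> B)"
  unfolding Metric_space.metric_closedin_iff_sequentially_closed[OF metric] conv_limitin by blast

lemma submodule_iff: "submodule V complex_ring A \<longleftrightarrow> V \<subseteq> carrier A \<and> \<zero> \<in> V \<and>
    (\<forall>x\<in>V. \<forall>y\<in>V. x \<oplus> y \<in> V) \<and> (\<forall>c. \<forall>x\<in>V. c \<odot> x \<in> V)"
proof safe
  assume V: "submodule V complex_ring A"
  interpret submodule V complex_ring A by fact
  show "x \<in> V \<Longrightarrow> x \<in> carrier A" for x using subset by auto
  show "\<zero> \<in> V" using one_closed by simp
  show "x \<in> V \<Longrightarrow> y \<in> V \<Longrightarrow> x \<oplus> y \<in> V" for x y using m_closed[of x y] by simp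
  show "x \<in> V \<Longrightarrow> c \<odot> x \<in> V" for c x using smult_closed[of c x] by simp
next
  assume "V \<subseteq> carrier A" "\<zero> \<in> V" "\<forall>x\<in>V. \<forall>y\<in>V. x \<oplus> y \<in> V" "\<forall>c. \<forall>x\<in>V. c \<odot> x \<in> V"
  then show "submodule V complex_ring A"
    by (intro submoduleI) (auto simp: neg_eq_smult subset_iff)
qed

lemma submoduleD:
  assumes "submodule V complex_ring A"
  shows "x \<in> V \<Longrightarrow> x \<in> carrier A" "\<zero> \<in> V" "\<lbrakk>x \<in> V; y \<in> V\<rbrakk> \<Longrightarrow> x \<oplus> y \<in> V" "x \<in> V \<Longrightarrow> c \<odot> x \<in> V"
  using assms by (auto simp: submodule_iff)

lemma cstar_subalgebraI:
  assumes "submodule B complex_ring A" "\<And>x y. \<lbrakk>x \<in> B; y \<in> B\<rbrakk> \<Longrightarrow> x \<otimes> y \<in> B"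
    "\<And>x. x \<in> B \<Longrightarrow> adj x \<in> B" "\<And>\<sigma> x. \<lbrakk>range \<sigma> \<subseteq> B; conv \<sigma> x\<rbrakk> \<Longrightarrow> x \<in> B"
  shows "cstar_subalgebra B A"
  unfolding cstar_subalgebra_def closedin_iff using assms submoduleD(1)[OF assms(1)] by blast

lemma cstar_subalgebraD:
  assumes "cstar_subalgebra B A"
  shows "submodule B complex_ring A" "\<lbrakk>x \<in> B; y \<in> B\<rbrakk> \<Longrightarrow> x \<otimes> y \<in> B"
    "x \<in> B \<Longrightarrow> adj x \<in> B" "\<lbrakk>range \<sigma> \<subseteq> B; conv \<sigma> x\<rbrakk> \<Longrightarrow> x \<in> B"
  using assms unfolding cstar_subalgebra_def closedin_iff by blast+

lemma cstar_gen_least: "\<lbrakk>cstar_subalgebra B A; Y \<subseteq> B\<rbrakk> \<Longrightarrow> cstar_gen A Y \<subseteq> B"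
  by (auto simp: cstar_gen_def)

lemma cstar_gen_incl: "Y \<subseteq> cstar_gen A Y"
  by (auto simp: cstar_gen_def)

lemma carrier_submodule: "submodule (carrier A) complex_ring A"
  by (simp add: submodule_iff)

lemma carrier_subalgebra: "cstar_subalgebra (carrier A) A"
  by (rule cstar_subalgebraI) (auto simp: carrier_submodule convD)

lemma submodule_Inter:
  assumes "\<V> \<noteq> {}" "\<And>V. V \<in> \<V> \<Longrightarrow> submodule V complex_ring A"
  shows "submodule (\<Inter>\<V>) complex_ring A"
  unfolding submodule_iff
proof (intro conjI ballI allI)
  show "\<Inter>\<V> \<subseteq> carrier A" using assms submoduleD(1) by blast
qed (use assms(2) in \<open>auto intro: submoduleD\<close>)

lemma cstar_gen_subalgebra:
  assumes "Y \<subseteq> carrier A"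
  shows "cstar_subalgebra (cstar_gen A Y) A"
  unfolding cstar_gen_def
proof (rule cstar_subalgebraI)
  show "submodule (\<Inter> {B. cstar_subalgebra B A \<and> Y \<subseteq> B}) complex_ring A"
    by (rule submodule_Inter) (use carrier_subalgebra assms cstar_subalgebraD(1) in blast)+
next
  fix \<sigma> x assume "range \<sigma> \<subseteq> \<Inter> {B. cstar_subalgebra B A \<and> Y \<subseteq> B}" "conv \<sigma> x"
  then show "x \<in> \<Inter> {B. cstar_subalgebra B A \<and> Y \<subseteq> B}"
    using cstar_subalgebraD(4)[of _ \<sigma> x] by blast
qed (auto simp: cstar_subalgebraD(2,3))

lemma lspan_least: "\<lbrakk>submodule V complex_ring A; Y \<subseteq> V\<rbrakk> \<Longrightarrow> lspan A Y \<subseteq> V"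
  by (auto simp: lspan_def)

lemma lspan_incl: "Y \<subseteq> lspan A Y"
  by (auto simp: lspan_def)

lemma lspan_submodule:
  assumes "Y \<subseteq> carrier A"
  shows "submodule (lspan A Y) complex_ring A"
  unfolding lspan_def by (rule submodule_Inter) (use carrier_submodule assms in blast)+

lemma lspan_induct [consumes 2, case_names zero base add smult]:
  assumes "x \<in> lspan A Y" "Y \<subseteq> carrier A"
    and zero: "Q \<zero>" and base: "\<And>x. x \<in> Y \<Longrightarrow> Q x"
    and add: "\<And>x y. \<lbrakk>x \<in> lspan A Y; y \<in> lspan A Y; Q x; Q y\<rbrakk> \<Longrightarrow> Q (x \<oplus> y)"
    and smult: "\<And>c x. \<lbrakk>x \<in> lspan A Y; Q x\<rbrakk> \<Longrightarrow> Q (c \<odot> x)"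
  shows "Q x"
proof -
  have "submodule {x \<in> lspan A Y. Q x} complex_ring A"
    using lspan_submodule[OF assms(2)] zero add smult unfolding submodule_iff by auto
  then have "lspan A Y \<subseteq> {x \<in> lspan A Y. Q x}"
    using base lspan_incl[of Y] by (intro lspan_least) auto
  then show ?thesis using assms(1) by auto
qed

lemma submodule_finsum:
  assumes "submodule V complex_ring A" "\<And>i. i \<in> I \<Longrightarrow> f i \<in> V"
  shows "finsum A f I \<in> V"
proof -
  have "V \<subseteq> carrier A" "\<zero> \<in> V" "\<And>x y. x \<in> V \<Longrightarrow> y \<in> V \<Longrightarrow> x \<oplus> y \<in> V"
    using assms(1) by (auto simp: submodule_iff)
  then show ?thesis using assms(2)
    by (induction I rule: infinite_finite_induct) (auto simp: subset_iff M.finsum_insert Pi_iff)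
qed

end

section \<open>Contractivity of *-homomorphisms\<close>

lemma star_homD:
  assumes "star_hom A B \<phi>"
  shows "x \<in> carrier A \<Longrightarrow> \<phi> x \<in> carrier B"
    and "\<lbrakk>x \<in> carrier A; y \<in> carrier A\<rbrakk> \<Longrightarrow> \<phi> (x \<oplus>\<^bsub>A\<^esub> y) = \<phi> x \<oplus>\<^bsub>B\<^esub> \<phi> y"
    and "x \<in> carrier A \<Longrightarrow> \<phi> (c \<odot>\<^bsub>A\<^esub> x) = c \<odot>\<^bsub>B\<^esub> \<phi> x"
    and "\<lbrakk>x \<in> carrier A; y \<in> carrier A\<rbrakk> \<Longrightarrow> \<phi> (x \<otimes>\<^bsub>A\<^esub> y) = \<phi> x \<otimes>\<^bsub>B\<^esub> \<phi> y"
    and "x \<in> carrier A \<Longrightarrow> \<phi> (adj\<^bsub>A\<^esub> x) = adj\<^bsub>B\<^esub> (\<phi> x)"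
  using assms unfolding star_hom_def by auto

context cstar_algebra
begin

lemma nrm_projection:
  assumes "is_projection A p"
  shows "nrm p = 0 \<or> nrm p = 1"
proof -
  have "nrm p = (nrm p)\<^sup>2"
    using assms nrm_cstar[of p] by (simp add: is_projection_def)
  then show ?thesis by (simp add: power2_eq_square)
qed

lemma nrm_projection_le: "is_projection A p \<Longrightarrow> nrm p \<le> 1"
  using nrm_projection by fastforce

lemma projection_zero: "\<lbrakk>is_projection A p; nrm p < 1\<rbrakk> \<Longrightarrow> p = \<zero>"
  using nrm_projection[of p] nrm_eq_zero[of p] by (simp add: is_projection_def)

lemma nrm_le_one_of_isometry:
  assumes "v \<in> carrier A" "is_projection A (adj v \<otimes> v)"
  shows "nrm v \<le> 1"
  using nrm_cstar[OF assms(1)] nrm_projection_le[OF assms(2)] abs_square_le_1[of "nrm v"] by simp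

end

locale unital_cstar_algebra = cstar_algebra A for A :: "('a, 'm) cstar_scheme" (structure) +
  assumes one_in [simp, intro]: "\<one> \<in> carrier A"
    and one_mult [simp]: "x \<in> carrier A \<Longrightarrow> \<one> \<otimes> x = x"
    and mult_one [simp]: "x \<in> carrier A \<Longrightarrow> x \<otimes> \<one> = x"

sublocale unital_cstar_algebra \<subseteq> ring A
  by (unfold_locales) (auto simp: mult_assoc mult_l_distr mult_r_distr)

context unital_cstar_algebra
begin

lemma adj_one [simp]: "adj \<one> = \<one>"
proof -
  have "adj (adj \<one> \<otimes> \<one>) = adj \<one> \<otimes> adj (adj \<one>)"
    by (subst adj_mult) simp_all
  then show ?thesis by simp
qed

lemma one_projection: "is_projection A \<one>"
  by (simp add: is_projection_def)

text \<open>With \<open>b = 1 - y\<close> the equation \<open>a\<^sup>2 + b\<^sup>2 = 1\<close> reads \<open>y = (a\<^sup>2 + y\<^sup>2) / 2\<close>. The right-hand side is a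
  contraction of a small ball of self-adjoint elements that commute with \<open>a\<close>, so its iterates
  converge to a solution \<open>y\<close> in that ball.\<close>

lemma sqrt_one_minus_square:
  assumes a: "a \<in> carrier A" "adj a = a" and less: "nrm a < 1"
  obtains b where "b \<in> carrier A" "adj b = b" "b \<otimes> a = a \<otimes> b" "a \<otimes> a \<oplus> b \<otimes> b = \<one>"
proof -
  define c where "c = a \<otimes> a"
  \<comment> \<open>\<open>\<rho>\<close> is the smaller solution of \<open>\<rho> = (\<parallel>c\<parallel> + \<rho>\<^sup>2) / 2\<close>: the ball of radius \<open>\<rho>\<close> is mapped to itself,
    and on it the map has Lipschitz constant \<open>\<rho> < 1\<close>.\<close>
  define \<rho> where "\<rho> = 1 - sqrt (1 - nrm c)"
  define T where "T y = (1/2) \<odot> (c \<oplus> y \<otimes> y)" for y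
  define I where "I = {y \<in> carrier A. adj y = y \<and> y \<otimes> a = a \<otimes> y \<and> nrm y \<le> \<rho>}"
  define \<sigma> where "\<sigma> n = (T ^^ n) \<zero>" for n
  have [simp]: "c \<in> carrier A" and c_adj: "adj c = c"
    using a by (simp_all add: c_def adj_mult)
  have nc: "nrm c = (nrm a)\<^sup>2"
    using nrm_cstar[of a] a by (simp add: c_def)
  then have c1: "nrm c < 1" and c0: "0 \<le> nrm c"
    using less nrm_nonneg[OF a(1)] by (auto simp: power_less_one_iff abs_square_less_1)
  have r0: "0 \<le> \<rho>" and r1: "\<rho> < 1"
    using c0 c1 by (auto simp: \<rho>_def)
  have fixr: "(nrm c + \<rho>\<^sup>2) / 2 = \<rho>"
  proof -
    have "(sqrt (1 - nrm c))\<^sup>2 = 1 - nrm c" using c1 by simp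
    then show ?thesis by (simp add: \<rho>_def power2_eq_square field_simps)
  qed
  have T_in: "T y \<in> carrier A" if "y \<in> carrier A" for y
    using that by (simp add: T_def)
  have T_I: "T y \<in> I" if y: "y \<in> I" for y
  proof -
    have y': "y \<in> carrier A" "adj y = y" "y \<otimes> a = a \<otimes> y" "nrm y \<le> \<rho>"
      using y by (auto simp: I_def)
    have "y \<otimes> y \<otimes> a = y \<otimes> (a \<otimes> y)"
      using y' a by (simp add: mult_assoc)
    also have "\<dots> = a \<otimes> (y \<otimes> y)"
      using y' a by (simp flip: mult_assoc)
    finally have "T y \<otimes> a = a \<otimes> T y"
      using y' a by (simp add: T_def smult_mult_l smult_mult_r mult_l_distr mult_r_distr c_def mult_assoc)
    moreover have "nrm (T y) \<le> \<rho>"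
    proof -
      have "nrm (T y) = nrm (c \<oplus> y \<otimes> y) / 2"
        using y' by (simp add: T_def nrm_smult)
      also have "\<dots> \<le> (nrm c + nrm y * nrm y) / 2"
        using y' nrm_add[of c "y \<otimes> y"] nrm_mult[of y y] by simp
      also have "\<dots> \<le> (nrm c + \<rho>\<^sup>2) / 2"
        using y' nrm_nonneg[of y] r0 by (simp add: power2_eq_square mult_mono)
      finally show ?thesis using fixr by simp
    qed
    ultimately show ?thesis
      using y' c_adj by (simp add: I_def T_in) (simp add: T_def adj_smult adj_add adj_mult)
  qed
  have T_lip: "nrm (T y \<ominus> T z) \<le> \<rho> * nrm (y \<ominus> z)" if yz: "y \<in> I" "z \<in> I" for y z
  proof -
    have yz': "y \<in> carrier A" "nrm y \<le> \<rho>" "z \<in> carrier A" "nrm z \<le> \<rho>"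
      using yz by (auto simp: I_def)
    have "T y \<ominus> T z = (1/2) \<odot> (y \<otimes> y \<ominus> z \<otimes> z)"
      using yz' by (simp add: T_def add_diff_add flip: smult_diff)
    also have "nrm \<dots> = nrm (y \<otimes> y \<ominus> z \<otimes> z) / 2"
      using yz' by (simp add: nrm_smult)
    also have "nrm (y \<otimes> y \<ominus> z \<otimes> z) \<le> nrm (y \<otimes> (y \<ominus> z)) + nrm ((y \<ominus> z) \<otimes> z)"
      using yz' nrm_triangle[of "y \<otimes> y" "y \<otimes> z" "z \<otimes> z"] by (simp add: mult_diff_r mult_diff_l)
    also have "\<dots> \<le> nrm y * nrm (y \<ominus> z) + nrm (y \<ominus> z) * nrm z"
      using yz' by (intro add_mono nrm_mult) auto
    also have "\<dots> \<le> \<rho> * nrm (y \<ominus> z) + nrm (y \<ominus> z) * \<rho>"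
      using yz' by (intro add_mono mult_right_mono mult_left_mono) (auto intro: nrm_nonneg)
    finally show ?thesis by simp
  qed
  have \<sigma>_I: "\<sigma> n \<in> I" for n
  proof (induction n)
    case (Suc n)
    then show ?case using T_I[of "\<sigma> n"] by (simp add: \<sigma>_def)
  qed (simp add: \<sigma>_def I_def r0 a)
  then have \<sigma>_in [simp]: "\<sigma> n \<in> carrier A" for n
    by (simp add: I_def)
  have geom: "nrm (\<sigma> (n + p) \<ominus> \<sigma> n) \<le> \<rho> ^ n" for n p
  proof (induction n)
    case 0
    have "nrm (\<sigma> p) \<le> 1" using \<sigma>_I[of p] r1 by (simp add: I_def)
    moreover have "\<sigma> p \<ominus> \<sigma> 0 = \<sigma> p" by (simp add: \<sigma>_def[of 0] diff_eq_smult)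
    ultimately show ?case by simp
  next
    case (Suc n)
    have "nrm (\<sigma> (Suc n + p) \<ominus> \<sigma> (Suc n)) \<le> \<rho> * nrm (\<sigma> (n + p) \<ominus> \<sigma> n)"
      using T_lip[OF \<sigma>_I[of "n + p"] \<sigma>_I[of n]] by (simp add: \<sigma>_def)
    also have "\<dots> \<le> \<rho> ^ Suc n"
      using Suc r0 by (simp add: mult_left_mono)
    finally show ?case .
  qed
  have "\<exists>x. conv \<sigma> x"
  proof (rule Cauchy_conv)
    fix \<epsilon> :: real assume "\<epsilon> > 0"
    then obtain N where N: "\<rho> ^ N < \<epsilon>"
      using real_arch_pow_inv r1 by blast
    have *: "nrm (\<sigma> m \<ominus> \<sigma> n) < \<epsilon>" if "n \<le> m" "N \<le> n" for m n
    proof -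
      have "nrm (\<sigma> m \<ominus> \<sigma> n) \<le> \<rho> ^ n" using geom[of n "m - n"] that by simp
      also have "\<dots> \<le> \<rho> ^ N" using that r0 r1 by (intro power_decreasing) auto
      finally show ?thesis using N by simp
    qed
    have "nrm (\<sigma> m \<ominus> \<sigma> n) < \<epsilon>" if "N \<le> m" "N \<le> n" for m n
      using *[of n m] *[of m n] that nrm_swap[of "\<sigma> m" "\<sigma> n"] by (cases "n \<le> m") auto
    then show "\<exists>N. \<forall>m\<ge>N. \<forall>n\<ge>N. nrm (\<sigma> m \<ominus> \<sigma> n) < \<epsilon>" by blast
  qed auto
  then obtain y where y: "conv \<sigma> y" by blast
  have yA [simp]: "y \<in> carrier A" using y convD by blast
  have "conv (\<lambda>n. adj (\<sigma> n)) (adj y)" using y by (rule conv_adj)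
  moreover have "(\<lambda>n. adj (\<sigma> n)) = \<sigma>" using \<sigma>_I by (auto simp: I_def)
  ultimately have y_adj: "adj y = y" using y conv_unique by simp
  have "conv (\<lambda>n. \<sigma> n \<otimes> a) (y \<otimes> a)" "conv (\<lambda>n. a \<otimes> \<sigma> n) (a \<otimes> y)"
    using y a conv_const by (auto intro: conv_mult)
  moreover have "(\<lambda>n. \<sigma> n \<otimes> a) = (\<lambda>n. a \<otimes> \<sigma> n)" using \<sigma>_I by (auto simp: I_def)
  ultimately have y_comm: "y \<otimes> a = a \<otimes> y" using conv_unique by simp
  have "conv (\<lambda>n. \<sigma> (Suc n)) (T y)"
    unfolding \<sigma>_def funpow.simps comp_def T_def
    using y by (intro conv_smult conv_add conv_const conv_mult) (simp_all add: \<sigma>_def[abs_def] T_def[abs_def])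
  moreover have "conv (\<lambda>n. \<sigma> (Suc n)) y"
    using y LIMSEQ_Suc[OF convD(3)[OF y]] by (auto simp: conv_def)
  ultimately have Ty: "T y = y" using conv_unique by blast
  have "c \<oplus> y \<otimes> y = 2 \<odot> T y" by (simp add: T_def)
  then have quad: "c \<oplus> y \<otimes> y = y \<oplus> y" using Ty smult_add_l[of y 1 1] by simp
  define b where "b = \<one> \<ominus> y"
  have "b \<otimes> b = \<one> \<ominus> y \<ominus> (y \<ominus> y \<otimes> y)"
    by (simp add: b_def mult_diff_l mult_diff_r)
  also have "\<dots> = \<one> \<ominus> (y \<oplus> y) \<oplus> y \<otimes> y"
    by (simp add: diff_eq_smult smult_add_r M.add.m_ac)
  also have "\<dots> = \<one> \<ominus> c"
    unfolding quad[symmetric] by (simp add: diff_eq_smult smult_add_r M.add.m_assoc neg_one_add)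
  finally have "a \<otimes> a \<oplus> b \<otimes> b = c \<oplus> (\<one> \<ominus> c)" by (simp add: c_def)
  also have "\<dots> = \<one>"
    by (simp add: a_minus_def M.add.m_lcomm[of c \<one>] M.r_neg)
  finally have "a \<otimes> a \<oplus> b \<otimes> b = \<one>" .
  moreover have "b \<in> carrier A" "adj b = b" "b \<otimes> a = a \<otimes> b"
    using a y_adj y_comm by (simp_all add: b_def adj_diff mult_diff_l mult_diff_r)
  ultimately show thesis using that by blast
qed

text \<open>A self-adjoint \<open>a\<close> of norm less than 1 is the real part of \<open>v = a + i b\<close>, which satisfies
  \<open>v\<^sup>* v = a\<^sup>2 + b\<^sup>2 = 1\<close> for the \<open>b\<close> of the preceding lemma. As \<open>\<phi>(v)\<^sup>* \<phi>(v)\<close> is the projection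
  \<open>\<phi>(1)\<close>, the norm of \<open>\<phi>(v)\<close>, and with it that of \<open>\<phi>(a)\<close>, is at most 1. Scaling gives the claim for
  self-adjoint elements, and the C*-identity for all others.\<close>

lemma star_hom_contractive:
  assumes B: "cstar_algebra B" and \<phi>: "star_hom A B \<phi>" and x: "x \<in> carrier A"
  shows "nrm\<^bsub>B\<^esub> (\<phi> x) \<le> nrm x"
proof -
  interpret B: cstar_algebra B by fact
  note h = star_homD[OF \<phi>]
  have proj1: "is_projection B (\<phi> \<one>)"
    using h(4)[of \<one> \<one>] h(5)[of \<one>] h(1)[of \<one>] by (simp add: is_projection_def)
  have unit_ball: "nrm\<^bsub>B\<^esub> (\<phi> a) \<le> 1" if a: "a \<in> carrier A" "adj a = a" "nrm a < 1" for a
  proof -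
    obtain b where b: "b \<in> carrier A" "adj b = b" "b \<otimes> a = a \<otimes> b" "a \<otimes> a \<oplus> b \<otimes> b = \<one>"
      using sqrt_one_minus_square[OF a] by blast
    define v where "v = a \<oplus> \<i> \<odot> b"
    have v: "v \<in> carrier A" using a b by (simp add: v_def)
    have adj_v: "adj v = a \<oplus> (- \<i>) \<odot> b"
      using a b by (simp add: v_def adj_add adj_smult)
    have "adj v \<otimes> v = (a \<otimes> a \<oplus> (- \<i>) \<odot> (b \<otimes> a)) \<oplus> (\<i> \<odot> (a \<otimes> b) \<oplus> b \<otimes> b)"
      unfolding adj_v unfolding v_def using a b by (simp add: mult_l_distr mult_r_distr smult_mult_l smult_mult_r smult_add_r)
    also have "\<dots> = a \<otimes> a \<oplus> (((- \<i>) \<odot> (a \<otimes> b) \<oplus> \<i> \<odot> (a \<otimes> b)) \<oplus> b \<otimes> b)"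
      using a b by (simp add: M.add.m_assoc)
    also have "\<dots> = \<one>" using a b by (simp flip: smult_add_l)
    finally have "adj v \<otimes> v = \<one>" .
    then have iso: "adj\<^bsub>B\<^esub> (\<phi> v) \<otimes>\<^bsub>B\<^esub> \<phi> v = \<phi> \<one>"
      using v h(4)[of "adj v" v] h(5)[of v] by simp
    then have nv: "nrm\<^bsub>B\<^esub> (\<phi> v) \<le> 1"
      using B.nrm_le_one_of_isometry[of "\<phi> v"] proj1 v by (simp add: h(1))
    have "v \<oplus> adj v = (a \<oplus> a) \<oplus> (\<i> \<odot> b \<oplus> (- \<i>) \<odot> b)"
      unfolding adj_v unfolding v_def using a b by (simp add: M.add.m_ac)
    also have "\<dots> = 2 \<odot> a"
      using a b smult_add_l[of a 1 1] by (simp flip: smult_add_l[of b])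
    finally have "(1/2) \<odot> (v \<oplus> adj v) = a" using a by simp
    then have "\<phi> a = \<phi> ((1/2) \<odot> (v \<oplus> adj v))" by simp
    also have "\<dots> = (1/2) \<odot>\<^bsub>B\<^esub> (\<phi> v \<oplus>\<^bsub>B\<^esub> adj\<^bsub>B\<^esub> (\<phi> v))"
      using v by (simp add: h)
    finally have "nrm\<^bsub>B\<^esub> (\<phi> a) = nrm\<^bsub>B\<^esub> (\<phi> v \<oplus>\<^bsub>B\<^esub> adj\<^bsub>B\<^esub> (\<phi> v)) / 2"
      using v by (simp add: h B.nrm_smult)
    also have "\<dots> \<le> (nrm\<^bsub>B\<^esub> (\<phi> v) + nrm\<^bsub>B\<^esub> (\<phi> v)) / 2"
      using v B.nrm_add[of "\<phi> v" "adj\<^bsub>B\<^esub> (\<phi> v)"] by (simp add: h(1))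
    finally show ?thesis using nv by simp
  qed
  have self_adj: "nrm\<^bsub>B\<^esub> (\<phi> a) \<le> nrm a" if a: "a \<in> carrier A" "adj a = a" for a
  proof (rule dense_ge)
    fix t assume t: "nrm a < t"
    then have t0: "0 < t" using nrm_nonneg[OF a(1)] by simp
    have "nrm\<^bsub>B\<^esub> (\<phi> (complex_of_real (1/t) \<odot> a)) \<le> 1"
      using a t t0 by (intro unit_ball) (simp_all add: adj_smult nrm_smult norm_divide)
    then show "nrm\<^bsub>B\<^esub> (\<phi> a) \<le> t"
      using a t0 by (simp add: h(1,3) B.nrm_smult norm_divide)
  qed
  have "(nrm\<^bsub>B\<^esub> (\<phi> x))\<^sup>2 = nrm\<^bsub>B\<^esub> (\<phi> (adj x \<otimes> x))"
    using x B.nrm_cstar[of "\<phi> x"] by (simp add: h)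
  also have "\<dots> \<le> nrm (adj x \<otimes> x)"
    using x by (intro self_adj) (simp_all add: adj_mult)
  also have "\<dots> = (nrm x)\<^sup>2" using x by (rule nrm_cstar)
  finally show ?thesis using nrm_nonneg[OF x] by (rule power2_le_imp_le)
qed

end

section \<open>Finite sums, closures and block decompositions\<close>

context cstar_algebra
begin

text \<open>Distributivity over finite sums before a unit is available: the unit of a graph algebra is itself
  constructed as such a sum.\<close>

lemma finsum_mult_l:
  assumes "x \<in> carrier A" "\<And>i. i \<in> I \<Longrightarrow> f i \<in> carrier A"
  shows "finsum A f I \<otimes> x = (\<Oplus>i\<in>I. f i \<otimes> x)"
  using assms(2)
proof (induction I rule: infinite_finite_induct)
  case (insert i I)
  then have "f \<in> I \<rightarrow> carrier A" "f i \<in> carrier A" by auto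
  then show ?case
    using insert assms(1) by (simp add: M.finsum_insert mult_l_distr M.finsum_closed Pi_iff)
qed (use assms(1) in auto)

lemma finsum_mult_r:
  assumes "x \<in> carrier A" "\<And>i. i \<in> I \<Longrightarrow> f i \<in> carrier A"
  shows "x \<otimes> finsum A f I = (\<Oplus>i\<in>I. x \<otimes> f i)"
  using assms(2)
proof (induction I rule: infinite_finite_induct)
  case (insert i I)
  then have "f \<in> I \<rightarrow> carrier A" "f i \<in> carrier A" by auto
  then show ?case
    using insert assms(1) by (simp add: M.finsum_insert mult_r_distr M.finsum_closed Pi_iff)
qed (use assms(1) in auto)

lemma adj_finsum:
  assumes "\<And>i. i \<in> I \<Longrightarrow> f i \<in> carrier A"
  shows "adj (finsum A f I) = (\<Oplus>i\<in>I. adj (f i))"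
  using assms
proof (induction I rule: infinite_finite_induct)
  case (insert i I)
  then have "f \<in> I \<rightarrow> carrier A" "f i \<in> carrier A" by auto
  then show ?case
    using insert by (simp add: M.finsum_insert adj_add M.finsum_closed Pi_iff)
qed auto

lemma finsum_cong:
  assumes "\<And>i. i \<in> I \<Longrightarrow> f i = g i" "\<And>i. i \<in> I \<Longrightarrow> g i \<in> carrier A"
  shows "finsum A f I = finsum A g I"
  using assms by (intro M.finsum_cong') auto

lemma finsum_in [intro]: "(\<And>i. i \<in> I \<Longrightarrow> f i \<in> carrier A) \<Longrightarrow> finsum A f I \<in> carrier A"
  by (intro M.finsum_closed) auto

lemma finsum_single:
  assumes "finite I" "i \<in> I" "f i \<in> carrier A" "\<And>j. \<lbrakk>j \<in> I; j \<noteq> i\<rbrakk> \<Longrightarrow> f j = \<zero>"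
  shows "finsum A f I = f i"
proof -
  have "finsum A f I = (\<Oplus>j\<in>I. if i = j then f j else \<zero>)"
    using assms by (intro finsum_cong) auto
  also have "\<dots> = f i"
    using assms by (intro M.add.finprod_singleton) (auto, metis M.zero_closed)
  finally show ?thesis .
qed

definition seq_closure :: "'a set \<Rightarrow> 'a set" where
  "seq_closure X = {x. \<exists>\<sigma>. range \<sigma> \<subseteq> X \<and> conv \<sigma> x}"

lemma seq_closureI: "\<lbrakk>\<And>n. \<sigma> n \<in> X; conv \<sigma> x\<rbrakk> \<Longrightarrow> x \<in> seq_closure X"
  unfolding seq_closure_def by blast

lemma seq_closureE:
  assumes "x \<in> seq_closure X"
  obtains \<sigma> where "\<forall>n. \<sigma> n \<in> X" "conv \<sigma> x"
  using assms unfolding seq_closure_def by blast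

text \<open>Algebraic closure properties pass to limits. That limits of limits are limits is the usual choice of a
  sequence that follows the \<open>n\<close>-th term within distance \<open>1 / (n + 1)\<close>.\<close>

lemma seq_closure_subalgebra:
  assumes "submodule X complex_ring A" "\<And>x y. \<lbrakk>x \<in> X; y \<in> X\<rbrakk> \<Longrightarrow> x \<otimes> y \<in> X" "\<And>x. x \<in> X \<Longrightarrow> adj x \<in> X"
  shows "cstar_subalgebra (seq_closure X) A"
proof (rule cstar_subalgebraI)
  note X = submoduleD[OF assms(1)]
  show "submodule (seq_closure X) complex_ring A"
    unfolding submodule_iff
  proof (intro conjI ballI allI)
    show "seq_closure X \<subseteq> carrier A" by (auto simp: seq_closure_def convD)
    show "\<zero> \<in> seq_closure X"
      using X(2) conv_const[of \<zero>] by (intro seq_closureI[of "\<lambda>_. \<zero>"]) auto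
    fix x y c assume "x \<in> seq_closure X"
    then obtain \<sigma> where \<sigma>: "\<forall>n. \<sigma> n \<in> X" "conv \<sigma> x" by (rule seq_closureE)
    show "c \<odot> x \<in> seq_closure X"
      by (rule seq_closureI[OF X(4)[OF \<sigma>(1)[rule_format]] conv_smult[OF \<sigma>(2)]])
    assume "y \<in> seq_closure X"
    then obtain \<tau> where \<tau>: "\<forall>n. \<tau> n \<in> X" "conv \<tau> y" by (rule seq_closureE)
    show "x \<oplus> y \<in> seq_closure X"
      by (rule seq_closureI[OF X(3)[OF \<sigma>(1)[rule_format] \<tau>(1)[rule_format]] conv_add[OF \<sigma>(2) \<tau>(2)]])
  qed
next
  fix x y assume "x \<in> seq_closure X" "y \<in> seq_closure X"
  then obtain \<sigma> \<tau> where \<sigma>: "\<forall>n. \<sigma> n \<in> X" "conv \<sigma> x" and \<tau>: "\<forall>n. \<tau> n \<in> X" "conv \<tau> y"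
    by (meson seq_closureE)
  show "x \<otimes> y \<in> seq_closure X"
    by (rule seq_closureI[OF assms(2)[OF \<sigma>(1)[rule_format] \<tau>(1)[rule_format]] conv_mult[OF \<sigma>(2) \<tau>(2)]])
next
  fix x assume "x \<in> seq_closure X"
  then obtain \<sigma> where \<sigma>: "\<forall>n. \<sigma> n \<in> X" "conv \<sigma> x" by (rule seq_closureE)
  show "adj x \<in> seq_closure X"
    by (rule seq_closureI[OF assms(3)[OF \<sigma>(1)[rule_format]] conv_adj[OF \<sigma>(2)]])
next
  fix \<sigma> x assume \<sigma>: "range \<sigma> \<subseteq> seq_closure X" "conv \<sigma> x"
  have "\<exists>y\<in>X. y \<in> carrier A \<and> nrm (y \<ominus> \<sigma> n) < 1 / real (Suc n)" for n
  proof -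
    have "\<sigma> n \<in> seq_closure X" using \<sigma>(1) by auto
    then obtain \<tau> where \<tau>: "\<forall>n. \<tau> n \<in> X" "conv \<tau> (\<sigma> n)" by (rule seq_closureE)
    have "\<forall>\<^sub>F m in sequentially. nrm (\<tau> m \<ominus> \<sigma> n) < 1 / real (Suc n)"
      using convD(3)[OF \<tau>(2)] by (rule order_tendstoD) simp
    then obtain m where "nrm (\<tau> m \<ominus> \<sigma> n) < 1 / real (Suc n)"
      using eventually_sequentially by auto
    then show ?thesis using \<tau> convD(1) by blast
  qed
  then obtain \<tau> where \<tau>: "\<tau> n \<in> X" "\<tau> n \<in> carrier A" "nrm (\<tau> n \<ominus> \<sigma> n) < 1 / real (Suc n)" for n
    by metis
  note [simp] = convD(1,2)[OF \<sigma>(2)] \<tau>(2)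
  have "conv \<tau> x"
  proof (rule conv_sandwich)
    show "nrm (\<tau> n \<ominus> x) \<le> 1 / real (Suc n) + nrm (\<sigma> n \<ominus> x)" for n
      using nrm_triangle[of "\<tau> n" "\<sigma> n" x] \<tau>(3)[of n] by simp
    show "(\<lambda>n. 1 / real (Suc n) + nrm (\<sigma> n \<ominus> x)) \<longlonglongrightarrow> 0"
      using tendsto_add[OF LIMSEQ_Suc[OF lim_1_over_n[where 'a=real]] convD(3)[OF \<sigma>(2)]] by simp
  qed auto
  then show "x \<in> seq_closure X"
    by (rule seq_closureI[OF \<tau>(1)])
qed

lemma subset_seq_closure: "X \<subseteq> carrier A \<Longrightarrow> X \<subseteq> seq_closure X"
  by (auto intro: seq_closureI[OF _ conv_const])

end

text \<open>Insert \<open>1 = \<Sum> T\<^sub>i T\<^sub>i\<^sup>*\<close> on both sides of \<open>y\<close>: an element with vanishing off-diagonal entries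
  \<open>T\<^sub>i\<^sup>* y T\<^sub>j\<close> is the sum of its diagonal blocks. It is applied to families of edges and of paths.\<close>

lemma (in unital_cstar_algebra) block_diagonal:
  assumes "finite I" and T: "\<And>i. i \<in> I \<Longrightarrow> T i \<in> carrier A"
    and sum: "(\<Oplus>i\<in>I. T i \<otimes> adj (T i)) = \<one>" and y: "y \<in> carrier A"
    and off: "\<And>i j. \<lbrakk>i \<in> I; j \<in> I; i \<noteq> j\<rbrakk> \<Longrightarrow> adj (T i) \<otimes> y \<otimes> T j = \<zero>"
  shows "y = (\<Oplus>i\<in>I. T i \<otimes> (adj (T i) \<otimes> y \<otimes> T i) \<otimes> adj (T i))"
proof -
  note [simp] = T y
  have row: "adj (T i) \<otimes> y = adj (T i) \<otimes> y \<otimes> T i \<otimes> adj (T i)" if i: "i \<in> I" for i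
  proof -
    have "adj (T i) \<otimes> y = adj (T i) \<otimes> y \<otimes> (\<Oplus>j\<in>I. T j \<otimes> adj (T j))"
      using i by (simp add: sum)
    also have "\<dots> = (\<Oplus>j\<in>I. adj (T i) \<otimes> y \<otimes> (T j \<otimes> adj (T j)))"
      using i by (intro finsum_mult_r) auto
    also have "\<dots> = adj (T i) \<otimes> y \<otimes> (T i \<otimes> adj (T i))"
    proof (rule finsum_single)
      fix j assume j: "j \<in> I" "j \<noteq> i"
      have "adj (T i) \<otimes> y \<otimes> (T j \<otimes> adj (T j)) = adj (T i) \<otimes> y \<otimes> T j \<otimes> adj (T j)"
        using i j by (simp add: mult_assoc)
      also have "\<dots> = \<zero>" using i j by (simp add: off)
      finally show "adj (T i) \<otimes> y \<otimes> (T j \<otimes> adj (T j)) = \<zero>" .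
    qed (use assms(1) i in auto)
    also have "\<dots> = adj (T i) \<otimes> y \<otimes> T i \<otimes> adj (T i)" using i by (simp add: mult_assoc)
    finally show ?thesis .
  qed
  have "y = (\<Oplus>i\<in>I. T i \<otimes> adj (T i)) \<otimes> y" by (simp add: sum)
  also have "\<dots> = (\<Oplus>i\<in>I. T i \<otimes> adj (T i) \<otimes> y)"
    by (intro finsum_mult_l) auto
  also have "\<dots> = (\<Oplus>i\<in>I. T i \<otimes> (adj (T i) \<otimes> y \<otimes> T i) \<otimes> adj (T i))"
  proof (rule finsum_cong)
    fix i assume i: "i \<in> I"
    have "T i \<otimes> adj (T i) \<otimes> y = T i \<otimes> (adj (T i) \<otimes> y)"
      using i by (simp add: mult_assoc)
    also have "\<dots> = T i \<otimes> (adj (T i) \<otimes> y \<otimes> T i \<otimes> adj (T i))"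
      by (subst row[OF i]) (rule refl)
    also have "\<dots> = T i \<otimes> (adj (T i) \<otimes> y \<otimes> T i) \<otimes> adj (T i)"
      using i by (simp add: mult_assoc)
    finally show "T i \<otimes> adj (T i) \<otimes> y = T i \<otimes> (adj (T i) \<otimes> y \<otimes> T i) \<otimes> adj (T i)" .
  qed auto
  finally show ?thesis .
qed

section \<open>The Cuntz-Krieger relations\<close>

lemma ck_familyD:
  fixes A (structure)
  assumes "ck_family E A P S"
  shows "v \<in> verts E \<Longrightarrow> is_projection A (P v)"
    and "\<lbrakk>v \<in> verts E; w \<in> verts E; v \<noteq> w\<rbrakk> \<Longrightarrow> P v \<otimes> P w = \<zero>"
    and "e \<in> arcs E \<Longrightarrow> is_partial_isometry A (S e)"
    and "e \<in> arcs E \<Longrightarrow> adj (S e) \<otimes> S e = P (head E e)"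
    and "\<lbrakk>e \<in> arcs E; f \<in> arcs E; e \<noteq> f\<rbrakk> \<Longrightarrow> adj (S e) \<otimes> S f = \<zero>"
    and "e \<in> arcs E \<Longrightarrow> cle A (S e \<otimes> adj (S e)) (P (tail E e))"
    and "\<lbrakk>v \<in> verts E; finite (out_arcs E v); out_arcs E v \<noteq> {}\<rbrakk>
      \<Longrightarrow> P v = (\<Oplus>e\<in>out_arcs E v. S e \<otimes> adj (S e))"
proof -
  note a = assms[unfolded ck_family_def, THEN conjunct1, rule_format]
    and b1 = assms[unfolded ck_family_def, THEN conjunct2]
  note b = b1[THEN conjunct1, rule_format] and c1 = b1[THEN conjunct2]
  note c = c1[THEN conjunct1, rule_format] and d1 = c1[THEN conjunct2]
  note d = d1[THEN conjunct1, rule_format] and e1 = d1[THEN conjunct2]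
  note e = e1[THEN conjunct1, rule_format] and f1 = e1[THEN conjunct2]
  note f = f1[THEN conjunct1, rule_format] and g = f1[THEN conjunct2, rule_format]
  show "v \<in> verts E \<Longrightarrow> is_projection A (P v)" by (rule a)
  show "\<lbrakk>v \<in> verts E; w \<in> verts E; v \<noteq> w\<rbrakk> \<Longrightarrow> P v \<otimes> P w = \<zero>" by (rule b)
  show "e \<in> arcs E \<Longrightarrow> is_partial_isometry A (S e)" by (rule c)
  show "e \<in> arcs E \<Longrightarrow> adj (S e) \<otimes> S e = P (head E e)" by (rule d)
  show "\<lbrakk>e \<in> arcs E; f \<in> arcs E; e \<noteq> f\<rbrakk> \<Longrightarrow> adj (S e) \<otimes> S f = \<zero>" by (rule e)
  show "e \<in> arcs E \<Longrightarrow> cle A (S e \<otimes> adj (S e)) (P (tail E e))" by (rule f)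
  show "\<lbrakk>v \<in> verts E; finite (out_arcs E v); out_arcs E v \<noteq> {}\<rbrakk>
      \<Longrightarrow> P v = (\<Oplus>e\<in>out_arcs E v. S e \<otimes> adj (S e))" by (rule g) auto
qed

text \<open>What the relations and the generating property give by themselves; the universal property enters
  with \<open>\<lambda>\<^sub>u\<close>.\<close>

locale cuntz_krieger = cstar_algebra A + fin_digraph E
  for A :: "('a, 'm) cstar_scheme" (structure) and E :: "('v, 'e) pre_digraph" +
  fixes P :: "'v \<Rightarrow> 'a" and S :: "'e \<Rightarrow> 'a"
  assumes family: "ck_family E A P S"
    and no_sink: "v \<in> verts E \<Longrightarrow> \<not> is_sink E v"
    and generated: "carrier A = cstar_gen A (P ` verts E \<union> S ` arcs E)"
begin

lemmas P_projection = ck_familyD(1)[OF family]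

lemma P_in [simp, intro]: "v \<in> verts E \<Longrightarrow> P v \<in> carrier A"
  and P_idem: "v \<in> verts E \<Longrightarrow> P v \<otimes> P v = P v"
  and adj_P [simp]: "v \<in> verts E \<Longrightarrow> adj (P v) = P v"
  using P_projection by (auto simp: is_projection_def)

lemma P_mult_P: "\<lbrakk>v \<in> verts E; w \<in> verts E\<rbrakk> \<Longrightarrow> P v \<otimes> P w = (if v = w then P v else \<zero>)"
  using ck_familyD(2)[OF family, of v w] by (auto simp: P_idem)

lemma S_in [simp, intro]: "e \<in> arcs E \<Longrightarrow> S e \<in> carrier A"
  using ck_familyD(3)[OF family, of e] by (simp add: is_partial_isometry_def)

lemma head_in [simp]: "e \<in> arcs E \<Longrightarrow> head E e \<in> verts E"
  and tail_in [simp]: "e \<in> arcs E \<Longrightarrow> tail E e \<in> verts E"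
  by auto

lemma adj_S_mult_S: "\<lbrakk>e \<in> arcs E; f \<in> arcs E\<rbrakk> \<Longrightarrow> adj (S e) \<otimes> S f = (if e = f then P (head E e) else \<zero>)"
  using ck_familyD(4)[OF family, of e] ck_familyD(5)[OF family, of e f] by auto

lemma S_mult_P:
  assumes "e \<in> arcs E" "v \<in> verts E"
  shows "S e \<otimes> P v = (if v = head E e then S e else \<zero>)"
proof -
  have "S e \<otimes> adj (S e) \<otimes> S e = S e"
    using ck_familyD(3)[OF family assms(1)] by (simp add: is_partial_isometry_def)
  then have head: "S e \<otimes> P (head E e) = S e"
    using assms adj_S_mult_S[of e e] by (simp add: mult_assoc)
  have "S e \<otimes> P v = S e \<otimes> (P (head E e) \<otimes> P v)"
    using assms head by (simp flip: mult_assoc)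
  then show ?thesis using assms head by (auto simp: P_mult_P)
qed

lemma P_eq_sum:
  assumes "v \<in> verts E"
  shows "P v = (\<Oplus>e\<in>out_arcs E v. S e \<otimes> adj (S e))"
proof -
  have "out_arcs E v \<noteq> {}" "finite (out_arcs E v)"
    using no_sink[OF assms] assms by (auto simp: is_sink_def out_arcs_def)
  then show ?thesis
    using ck_familyD(7)[OF family assms] by blast
qed

lemma P_mult_S:
  assumes "v \<in> verts E" "e \<in> arcs E"
  shows "P v \<otimes> S e = (if v = tail E e then S e else \<zero>)"
proof -
  have tail: "P (tail E e) \<otimes> S e = S e"
  proof -
    have "P (tail E e) \<otimes> S e = (\<Oplus>f\<in>out_arcs E (tail E e). S f \<otimes> adj (S f) \<otimes> S e)"
      using assms by (subst P_eq_sum) (auto intro!: finsum_mult_l simp: out_arcs_def)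
    also have "\<dots> = S e \<otimes> adj (S e) \<otimes> S e"
      using assms by (intro finsum_single) (auto simp: out_arcs_def mult_assoc adj_S_mult_S)
    finally show ?thesis using assms by (simp add: mult_assoc adj_S_mult_S S_mult_P)
  qed
  have "P v \<otimes> S e = (P v \<otimes> P (tail E e)) \<otimes> S e"
    using assms tail by (simp add: mult_assoc)
  then show ?thesis using assms tail by (auto simp: P_mult_P)
qed

lemma adj_S_mult_P:
  assumes "v \<in> verts E" "e \<in> arcs E"
  shows "adj (S e) \<otimes> P v = (if v = tail E e then adj (S e) else \<zero>)"
  using arg_cong[OF P_mult_S[OF assms], of "\<lambda>x. adj x"] assms by (simp add: adj_mult split: if_splits)

lemma P_mult_adj_S:
  assumes "v \<in> verts E" "e \<in> arcs E"
  shows "P v \<otimes> adj (S e) = (if v = head E e then adj (S e) else \<zero>)"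
  using arg_cong[OF S_mult_P[OF assms(2,1)], of "\<lambda>x. adj x"] assms by (simp add: adj_mult split: if_splits)

text \<open>The relations between neighbours of a right-nested product; with associativity they evaluate
  words in the generators.\<close>

lemma assoc_rules:
  assumes "x \<in> carrier A"
  shows "\<lbrakk>v \<in> verts E; w \<in> verts E\<rbrakk> \<Longrightarrow> P v \<otimes> (P w \<otimes> x) = (if v = w then P v \<otimes> x else \<zero>)"
    and "\<lbrakk>e \<in> arcs E; f \<in> arcs E\<rbrakk> \<Longrightarrow> adj (S e) \<otimes> (S f \<otimes> x) = (if e = f then P (head E e) \<otimes> x else \<zero>)"
    and "\<lbrakk>e \<in> arcs E; v \<in> verts E\<rbrakk> \<Longrightarrow> S e \<otimes> (P v \<otimes> x) = (if v = head E e then S e \<otimes> x else \<zero>)"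
    and "\<lbrakk>e \<in> arcs E; v \<in> verts E\<rbrakk> \<Longrightarrow> P v \<otimes> (S e \<otimes> x) = (if v = tail E e then S e \<otimes> x else \<zero>)"
    and "\<lbrakk>e \<in> arcs E; v \<in> verts E\<rbrakk> \<Longrightarrow> adj (S e) \<otimes> (P v \<otimes> x) = (if v = tail E e then adj (S e) \<otimes> x else \<zero>)"
    and "\<lbrakk>e \<in> arcs E; v \<in> verts E\<rbrakk> \<Longrightarrow> P v \<otimes> (adj (S e) \<otimes> x) = (if v = head E e then adj (S e) \<otimes> x else \<zero>)"
  using assms P_mult_P adj_S_mult_S S_mult_P P_mult_S adj_S_mult_P P_mult_adj_S
  by (simp_all flip: mult_assoc)

lemmas ck_rules = mult_assoc P_mult_P adj_S_mult_S S_mult_P P_mult_S adj_S_mult_P P_mult_adj_S assoc_rules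

text \<open>The elements on which \<open>q\<close> acts as a two-sided unit form a C*-subalgebra, and it contains the
  generators since \<open>P\<^bsub>tail e\<^esub> S\<^sub>e = S\<^sub>e = S\<^sub>e P\<^bsub>head e\<^esub>\<close>.\<close>

lemma unit_sum:
  defines "q \<equiv> (\<Oplus>v\<in>verts E. P v)"
  shows "q \<in> carrier A" "x \<in> carrier A \<Longrightarrow> q \<otimes> x = x \<and> x \<otimes> q = x"
proof -
  show q: "q \<in> carrier A" unfolding q_def by (rule finsum_in) auto
  have adj_q: "adj q = q" unfolding q_def by (subst adj_finsum) (auto intro: finsum_cong)
  have qP: "q \<otimes> P v = P v" "P v \<otimes> q = P v" if "v \<in> verts E" for v
  proof -
    have "q \<otimes> P v = (\<Oplus>w\<in>verts E. P w \<otimes> P v)"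
      unfolding q_def using that by (intro finsum_mult_l) auto
    also have "\<dots> = P v \<otimes> P v" using that by (intro finsum_single) (auto simp: P_mult_P)
    finally show "q \<otimes> P v = P v" using that by (simp add: P_idem)
    then have "adj (q \<otimes> P v) = adj (P v)" by simp
    then show "P v \<otimes> q = P v" using that q adj_q by (simp add: adj_mult)
  qed
  define B where "B = {x \<in> carrier A. q \<otimes> x = x \<and> x \<otimes> q = x}"
  have "cstar_subalgebra B A"
  proof (rule cstar_subalgebraI)
    show "submodule B complex_ring A"
      using q by (auto simp: submodule_iff B_def mult_l_distr mult_r_distr smult_mult_l smult_mult_r)
    show "x \<otimes> y \<in> B" if "x \<in> B" "y \<in> B" for x y
    proof -
      have xy: "x \<in> carrier A" "y \<in> carrier A" "q \<otimes> x = x" "y \<otimes> q = y"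
        using that by (auto simp: B_def)
      have "q \<otimes> (x \<otimes> y) = x \<otimes> y" "x \<otimes> y \<otimes> q = x \<otimes> y"
        unfolding mult_assoc[OF q xy(1,2), symmetric] mult_assoc[OF xy(1,2) q] xy(3,4) by (rule refl)+
      then show ?thesis using xy by (simp add: B_def)
    qed
    show "adj x \<in> B" if "x \<in> B" for x
    proof -
      have x: "x \<in> carrier A" "x \<otimes> q = x" "q \<otimes> x = x" using that by (auto simp: B_def)
      have "q \<otimes> adj x = adj (x \<otimes> q)" "adj x \<otimes> q = adj (q \<otimes> x)"
        by (simp_all add: adj_mult x(1) q adj_q)
      then show ?thesis using x by (simp add: B_def)
    qed
    fix \<sigma> x assume \<sigma>: "range \<sigma> \<subseteq> B" "conv \<sigma> x"
    have "q \<otimes> \<sigma> n = \<sigma> n" "\<sigma> n \<otimes> q = \<sigma> n" for n using \<sigma>(1) by (auto simp: B_def)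
    then have lim: "conv \<sigma> (q \<otimes> x)" "conv \<sigma> (x \<otimes> q)"
      using conv_mult[OF conv_const[OF q] \<sigma>(2)] conv_mult[OF \<sigma>(2) conv_const[OF q]] by simp_all
    have "q \<otimes> x = x" "x \<otimes> q = x"
      by (rule conv_unique[OF lim(1) \<sigma>(2)], rule conv_unique[OF lim(2) \<sigma>(2)])
    then show "x \<in> B"
      using convD(2)[OF \<sigma>(2)] by (simp add: B_def)
  qed
  moreover have "P ` verts E \<union> S ` arcs E \<subseteq> B"
  proof -
    have "S e \<in> B" if e: "e \<in> arcs E" for e
    proof -
      have "q \<otimes> S e = (q \<otimes> P (tail E e)) \<otimes> S e"
        using e q by (simp add: ck_rules)
      moreover have "S e \<otimes> q = S e \<otimes> (P (head E e) \<otimes> q)"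
        using e q by (simp add: ck_rules)
      ultimately show ?thesis using e q by (simp add: qP) (simp add: B_def ck_rules)
    qed
    then show ?thesis using q by (auto simp: B_def qP)
  qed
  ultimately have "carrier A \<subseteq> B" using generated cstar_gen_least by metis
  then show "x \<in> carrier A \<Longrightarrow> q \<otimes> x = x \<and> x \<otimes> q = x" by (auto simp: B_def)
qed

lemma one_eq_sum_P: "\<one> = (\<Oplus>v\<in>verts E. P v)"
  by (rule one_is_unit[OF unit_sum])

end

sublocale cuntz_krieger \<subseteq> unital_cstar_algebra A
proof
  show "\<one> \<in> carrier A" unfolding one_eq_sum_P by (rule unit_sum)
  show "\<one> \<otimes> x = x" "x \<otimes> \<one> = x" if "x \<in> carrier A" for x
    unfolding one_eq_sum_P using unit_sum(2)[OF that] by blast+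
qed

context cuntz_krieger
begin

lemma finite_arcs_E [simp]: "finite (arcs E)" and finite_verts_E [simp]: "finite (verts E)"
  by auto

lemma one_eq_sum_S: "(\<Oplus>e\<in>arcs E. S e \<otimes> adj (S e)) = \<one>"
proof -
  define r where "r = (\<Oplus>e\<in>arcs E. S e \<otimes> adj (S e))"
  have r: "r \<in> carrier A" unfolding r_def by (rule finsum_in) auto
  have rS: "r \<otimes> S f = S f" if f: "f \<in> arcs E" for f
  proof -
    have "r \<otimes> S f = (\<Oplus>e\<in>arcs E. S e \<otimes> adj (S e) \<otimes> S f)"
      unfolding r_def using f by (intro finsum_mult_l) auto
    also have "\<dots> = S f \<otimes> adj (S f) \<otimes> S f"
      using f by (intro finsum_single) (auto simp: ck_rules)
    finally show ?thesis using f by (simp add: ck_rules)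
  qed
  have rP: "r \<otimes> P v = P v" if v: "v \<in> verts E" for v
  proof -
    have "r \<otimes> P v = (\<Oplus>f\<in>out_arcs E v. r \<otimes> (S f \<otimes> adj (S f)))"
      unfolding P_eq_sum[OF v] using r by (intro finsum_mult_r) (auto simp: out_arcs_def)
    also have "\<dots> = (\<Oplus>f\<in>out_arcs E v. S f \<otimes> adj (S f))"
    proof (rule finsum_cong)
      fix f assume "f \<in> out_arcs E v"
      then have f: "f \<in> arcs E" by (simp add: out_arcs_def)
      show "r \<otimes> (S f \<otimes> adj (S f)) = S f \<otimes> adj (S f)"
        using mult_assoc[of r "S f" "adj (S f)"] f r rS[OF f] by simp
    qed (auto simp: out_arcs_def)
    finally show ?thesis unfolding P_eq_sum[OF v, symmetric] .
  qed
  have "r \<otimes> \<one> = (\<Oplus>v\<in>verts E. r \<otimes> P v)"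
    unfolding one_eq_sum_P using r by (rule finsum_mult_r) simp
  also have "\<dots> = \<one>"
    unfolding one_eq_sum_P by (rule finsum_cong) (simp_all add: rP)
  finally show ?thesis using r by (simp add: r_def)
qed

end

section \<open>Paths and their projections\<close>

context cstar_algebra
begin

text \<open>Two-sided multiplication is linear, so membership of \<open>a x b\<close> in a subspace may be tested on a spanning
  set.\<close>

lemma lspan_sandwich:
  assumes x: "x \<in> lspan A Y" and Y: "Y \<subseteq> carrier A" and V: "submodule V complex_ring A"
    and ab: "a \<in> carrier A" "b \<in> carrier A" and base: "\<And>y. y \<in> Y \<Longrightarrow> a \<otimes> y \<otimes> b \<in> V"
  shows "a \<otimes> x \<otimes> b \<in> V"
proof -
  have sub: "lspan A Y \<subseteq> carrier A"
    by (rule lspan_least[OF carrier_submodule Y])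
  from x Y show ?thesis
  proof (induction rule: lspan_induct)
    case zero
    then show ?case using ab submoduleD(2)[OF V] by simp
  next
    case (add x y)
    have xy: "x \<in> carrier A" "y \<in> carrier A" using add sub by auto
    have "a \<otimes> (x \<oplus> y) \<otimes> b = a \<otimes> x \<otimes> b \<oplus> a \<otimes> y \<otimes> b"
      using ab xy by (simp add: mult_l_distr mult_r_distr)
    then show ?case using submoduleD(3)[OF V] add by simp
  next
    case (smult c x)
    have x: "x \<in> carrier A" using smult sub by auto
    have "a \<otimes> (c \<odot> x) \<otimes> b = c \<odot> (a \<otimes> x \<otimes> b)"
      using ab x by (simp add: smult_mult_l smult_mult_r)
    then show ?case using submoduleD(4)[OF V] smult by simp
  qed (rule base)
qed

end

context cuntz_krieger
begin

abbreviation D :: "nat \<Rightarrow> 'a set" where "D \<equiv> D_level E A P S"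

abbreviation pathn :: "nat \<Rightarrow> ('v \<times> 'e list) set" where "pathn \<equiv> paths_of_length E"

abbreviation Sp :: "'v \<times> 'e list \<Rightarrow> 'a" where "Sp \<equiv> S_path A P S"

abbreviation Pp :: "'v \<times> 'e list \<Rightarrow> 'a" where "Pp \<equiv> P_path A P S"

lemma pathn_0: "pathn 0 = (\<lambda>v. (v, [])) ` verts E"
  by (auto simp: paths_of_length_def paths_def awalk_Nil_iff)

lemma pathn_Suc: "pathn (Suc m) = (\<lambda>(e, \<mu>). (tail E e, e # snd \<mu>)) ` {(e, \<mu>). e \<in> arcs E \<and> \<mu> \<in> pathn m \<and> fst \<mu> = head E e}"
  (is "_ = ?R")
proof
  show "pathn (Suc m) \<subseteq> ?R"
  proof
    fix \<mu> assume "\<mu> \<in> pathn (Suc m)"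
    then obtain v e p w where \<mu>: "\<mu> = (v, e # p)" "awalk v (e # p) w" "length p = m"
      by (auto simp: paths_of_length_def paths_def length_Suc_conv)
    then have "e \<in> arcs E" "v = tail E e" "(head E e, p) \<in> pathn m"
      by (auto simp: awalk_Cons_iff paths_of_length_def paths_def)
    then show "\<mu> \<in> ?R" using \<mu>(1) by (intro image_eqI[of _ _ "(e, (head E e, p))"]) auto
  qed
  show "?R \<subseteq> pathn (Suc m)"
    by (auto simp: paths_of_length_def paths_def awalk_Cons_iff)
qed

lemma path_cases [consumes 1, case_names Cons]:
  assumes "\<mu> \<in> pathn (Suc m)"
  obtains e p where "e \<in> arcs E" "(head E e, p) \<in> pathn m" "\<mu> = (tail E e, e # p)"
  using assms unfolding pathn_Suc by force

lemma path_Cons: "\<lbrakk>e \<in> arcs E; (head E e, p) \<in> pathn m\<rbrakk> \<Longrightarrow> (tail E e, e # p) \<in> pathn (Suc m)"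
  unfolding pathn_Suc by force

lemma path_fst_in [simp]: "\<mu> \<in> pathn m \<Longrightarrow> fst \<mu> \<in> verts E"
  by (auto simp: paths_of_length_def paths_def awalk_def)

lemma finite_pathn: "finite (pathn m)"
proof (induction m)
  case (Suc m)
  have "{(e, \<mu>). e \<in> arcs E \<and> \<mu> \<in> pathn m \<and> fst \<mu> = head E e} \<subseteq> arcs E \<times> pathn m" by auto
  then show ?case
    unfolding pathn_Suc using Suc by (intro finite_imageI) (auto intro: finite_subset)
qed (simp add: pathn_0)

lemma S_path_source: "Sp (v, e # p) = Sp (w, e # p)"
  by (induction p arbitrary: e) auto

text \<open>The last conjunct removes the special role of paths of length one in the definition of \<open>S_path\<close>; it
  and the action of the vertex projections have to be proved in one induction.\<close>

lemma path_operators: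
  assumes "\<mu> \<in> pathn m"
  shows "Sp \<mu> \<in> carrier A \<and> (\<forall>v\<in>verts E. P v \<otimes> Sp \<mu> = (if v = fst \<mu> then Sp \<mu> else \<zero>)) \<and>
    (\<forall>e\<in>arcs E. head E e = fst \<mu> \<longrightarrow> Sp (tail E e, e # snd \<mu>) = S e \<otimes> Sp \<mu>)"
  using assms
proof (induction m arbitrary: \<mu>)
  case 0
  then show ?case by (auto simp: pathn_0 P_mult_P S_mult_P)
next
  case (Suc m)
  from Suc.prems show ?case
  proof (cases rule: path_cases)
    case (Cons e p)
    have IH: "Sp (head E e, p) \<in> carrier A" "Sp (tail E e, e # p) = S e \<otimes> Sp (head E e, p)"
      using Suc.IH[OF Cons(2)] Cons(1) by auto
    have "Sp (tail E f, f # e # p) = S f \<otimes> Sp (tail E e, e # p)" for f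
      using S_path_source[of "tail E f" e p "tail E e"] by simp
    then show ?thesis
      unfolding Cons(3) snd_conv fst_conv using IH Cons(1) by (simp add: ck_rules)
  qed
qed

lemma Sp_in [simp]: "\<mu> \<in> pathn m \<Longrightarrow> Sp \<mu> \<in> carrier A"
  and P_mult_Sp: "\<lbrakk>\<mu> \<in> pathn m; v \<in> verts E\<rbrakk> \<Longrightarrow> P v \<otimes> Sp \<mu> = (if v = fst \<mu> then Sp \<mu> else \<zero>)"
  and Sp_Cons: "\<lbrakk>e \<in> arcs E; (head E e, p) \<in> pathn m\<rbrakk> \<Longrightarrow> Sp (tail E e, e # p) = S e \<otimes> Sp (head E e, p)"
  using path_operators[of \<mu> m] path_operators[of "(head E e, p)" m] by auto

lemma S_mult_Sp_zero:
  assumes "\<mu> \<in> pathn m" "e \<in> arcs E" "head E e \<noteq> fst \<mu>"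
  shows "S e \<otimes> Sp \<mu> = \<zero>"
proof -
  have "S e \<otimes> Sp \<mu> = S e \<otimes> (P (head E e) \<otimes> Sp \<mu>)"
    using assms by (simp add: assoc_rules)
  then show ?thesis using assms by (simp add: P_mult_Sp)
qed

lemma Pp_in [simp]: "\<mu> \<in> pathn m \<Longrightarrow> Pp \<mu> \<in> carrier A"
  by (simp add: P_path_def)

lemma Sp_orthogonal:
  assumes "\<mu> \<in> pathn m" "\<nu> \<in> pathn m"
  shows "(\<mu> \<noteq> \<nu> \<longrightarrow> adj (Sp \<mu>) \<otimes> Sp \<nu> = \<zero>) \<and> (\<exists>v\<in>verts E. adj (Sp \<mu>) \<otimes> Sp \<mu> = P v)"
  using assms
proof (induction m arbitrary: \<mu> \<nu>)
  case 0
  then show ?case by (auto simp: pathn_0 P_mult_P split: if_splits)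
next
  case (Suc m)
  from Suc.prems(1) obtain e p where \<mu>: "e \<in> arcs E" "(head E e, p) \<in> pathn m" "\<mu> = (tail E e, e # p)"
    by (rule path_cases)
  from Suc.prems(2) obtain f q where \<nu>: "f \<in> arcs E" "(head E f, q) \<in> pathn m" "\<nu> = (tail E f, f # q)"
    by (rule path_cases)
  have [simp]: "Sp \<mu> = S e \<otimes> Sp (head E e, p)" "Sp \<nu> = S f \<otimes> Sp (head E f, q)"
    "Sp (head E e, p) \<in> carrier A" "Sp (head E f, q) \<in> carrier A"
    using \<mu> \<nu> Sp_Cons by auto
  have prod: "adj (Sp \<mu>) \<otimes> Sp \<nu> = (if e = f then adj (Sp (head E e, p)) \<otimes> Sp (head E f, q) else \<zero>)"
    using \<mu>(1,2) \<nu>(1,2) by (simp add: adj_mult ck_rules P_mult_Sp[OF \<mu>(2)] P_mult_Sp[OF \<nu>(2)])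
  have prod': "adj (Sp \<mu>) \<otimes> Sp \<mu> = adj (Sp (head E e, p)) \<otimes> Sp (head E e, p)"
    using \<mu>(1,2) by (simp add: adj_mult ck_rules P_mult_Sp[OF \<mu>(2)])
  show ?case
    unfolding prod prod' using Suc.IH[OF \<mu>(2)] \<mu> \<nu> by auto
qed

lemma adj_Sp_mult_Sp_zero: "\<lbrakk>\<mu> \<in> pathn m; \<nu> \<in> pathn m; \<mu> \<noteq> \<nu>\<rbrakk> \<Longrightarrow> adj (Sp \<mu>) \<otimes> Sp \<nu> = \<zero>"
  using Sp_orthogonal by blast

text \<open>The vertex is the range of \<open>\<mu>\<close>, but its name does not matter. The last equation holds because
  \<open>y = S\<^sub>\<mu> P\<^sub>v - S\<^sub>\<mu>\<close> satisfies \<open>y\<^sup>* y = 0\<close>.\<close>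

lemma Sp_final:
  assumes "\<mu> \<in> pathn m"
  obtains v where "v \<in> verts E" "adj (Sp \<mu>) \<otimes> Sp \<mu> = P v" "Sp \<mu> \<otimes> P v = Sp \<mu>"
proof -
  obtain v where v: "v \<in> verts E" "adj (Sp \<mu>) \<otimes> Sp \<mu> = P v"
    using Sp_orthogonal[OF assms assms] by blast
  define y where "y = Sp \<mu> \<otimes> P v \<ominus> Sp \<mu>"
  have y: "y \<in> carrier A" using assms v by (simp add: y_def)
  have "adj y \<otimes> y = \<zero>"
    using assms v by (simp add: y_def adj_diff adj_mult mult_diff_l mult_diff_r mult_assoc P_mult_P)
      (simp flip: mult_assoc add: P_mult_P)
  then have "y = \<zero>" using nrm_cstar[OF y] nrm_eq_zero[OF y] by simp
  then show thesis using that[OF v] assms v by (simp add: y_def diff_eq_zero_iff)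
qed

text \<open>Peeling off one edge at a time reduces the claim to \<open>x = \<Sum> S\<^sub>e S\<^sub>e\<^sup>* x\<close>. This gives
  \<open>\<Sum> P\<^sub>\<mu> = 1\<close> below without reindexing a sum over paths.\<close>

lemma paths_separate:
  assumes "x \<in> carrier A" "\<And>\<mu>. \<mu> \<in> pathn m \<Longrightarrow> adj (Sp \<mu>) \<otimes> x = \<zero>"
  shows "x = \<zero>"
  using assms
proof (induction m arbitrary: x)
  case 0
  have "P v \<otimes> x = \<zero>" if "v \<in> verts E" for v
    using 0(2)[of "(v, [])"] that by (simp add: pathn_0)
  then have "(\<Oplus>v\<in>verts E. P v \<otimes> x) = (\<Oplus>v\<in>verts E. \<zero>)"
    by (intro finsum_cong) auto
  moreover have "(\<Oplus>v\<in>verts E. P v) \<otimes> x = (\<Oplus>v\<in>verts E. P v \<otimes> x)"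
    using 0(1) by (intro finsum_mult_l) auto
  ultimately show ?case using 0(1) by (simp add: one_eq_sum_P[symmetric])
next
  case (Suc m)
  note x = Suc.prems(1)
  have zero: "adj (S e) \<otimes> x = \<zero>" if e: "e \<in> arcs E" for e
  proof (rule Suc.IH)
    show "adj (S e) \<otimes> x \<in> carrier A" using e x by simp
    fix \<mu> assume \<mu>: "\<mu> \<in> pathn m"
    have *: "adj (Sp \<mu>) \<otimes> (adj (S e) \<otimes> x) = adj (S e \<otimes> Sp \<mu>) \<otimes> x"
      using e x \<mu> by (simp add: adj_mult mult_assoc)
    show "adj (Sp \<mu>) \<otimes> (adj (S e) \<otimes> x) = \<zero>"
    proof (cases "head E e = fst \<mu>")
      case True
      then have "(head E e, snd \<mu>) = \<mu>" by simp
      then show ?thesis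
        unfolding * using Suc.prems(2)[OF path_Cons[OF e, of "snd \<mu>"]] Sp_Cons[OF e, of "snd \<mu>"] \<mu> by simp
    next
      case False
      then show ?thesis unfolding * using S_mult_Sp_zero[OF \<mu> e] x by simp
    qed
  qed
  have "(\<Oplus>e\<in>arcs E. S e \<otimes> adj (S e)) \<otimes> x = (\<Oplus>e\<in>arcs E. S e \<otimes> adj (S e) \<otimes> x)"
    using x by (intro finsum_mult_l) auto
  also have "\<dots> = (\<Oplus>e\<in>arcs E. \<zero>)"
    using x by (intro finsum_cong) (auto simp: mult_assoc zero)
  finally show ?case using x by (simp add: one_eq_sum_S)
qed

lemma sum_Pp: "(\<Oplus>\<mu>\<in>pathn m. Sp \<mu> \<otimes> adj (Sp \<mu>)) = \<one>"
proof -
  define r where "r = (\<Oplus>\<mu>\<in>pathn m. Sp \<mu> \<otimes> adj (Sp \<mu>))"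
  have r: "r \<in> carrier A" unfolding r_def by (rule finsum_in) simp
  have "\<one> \<ominus> r = \<zero>"
  proof (rule paths_separate[of _ m])
    fix \<nu> assume \<nu>: "\<nu> \<in> pathn m"
    obtain v where v: "v \<in> verts E" "adj (Sp \<nu>) \<otimes> Sp \<nu> = P v" "Sp \<nu> \<otimes> P v = Sp \<nu>"
      using \<nu> by (rule Sp_final)
    have "adj (Sp \<nu> \<otimes> P v) = P v \<otimes> adj (Sp \<nu>)" using v(1) \<nu> by (simp add: adj_mult)
    then have *: "P v \<otimes> adj (Sp \<nu>) = adj (Sp \<nu>)" using v(3) by simp
    have "adj (Sp \<nu>) \<otimes> r = (\<Oplus>\<mu>\<in>pathn m. adj (Sp \<nu>) \<otimes> (Sp \<mu> \<otimes> adj (Sp \<mu>)))"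
      unfolding r_def using \<nu> by (intro finsum_mult_r) auto
    also have "\<dots> = adj (Sp \<nu>) \<otimes> (Sp \<nu> \<otimes> adj (Sp \<nu>))"
    proof (rule finsum_single)
      fix \<mu> assume \<mu>: "\<mu> \<in> pathn m" "\<mu> \<noteq> \<nu>"
      show "adj (Sp \<nu>) \<otimes> (Sp \<mu> \<otimes> adj (Sp \<mu>)) = \<zero>"
        using mult_assoc[of "adj (Sp \<nu>)" "Sp \<mu>" "adj (Sp \<mu>)"] adj_Sp_mult_Sp_zero[OF \<nu> \<mu>(1)] \<mu> \<nu> by simp
    qed (use \<nu> finite_pathn in auto)
    also have "\<dots> = P v \<otimes> adj (Sp \<nu>)"
      using mult_assoc[of "adj (Sp \<nu>)" "Sp \<nu>" "adj (Sp \<nu>)"] \<nu> v(2) by simp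
    finally show "adj (Sp \<nu>) \<otimes> (\<one> \<ominus> r) = \<zero>"
      using r \<nu> * by (simp add: mult_diff_r)
  qed (use r in simp)
  then show ?thesis using r by (simp add: diff_eq_zero_iff r_def)
qed

lemma sum_Pp': "(\<Oplus>\<mu>\<in>pathn m. Pp \<mu>) = \<one>"
  unfolding P_path_def by (rule sum_Pp)

lemma Pp_orthogonal:
  assumes "\<mu> \<in> pathn m" "\<nu> \<in> pathn m"
  shows "Pp \<mu> \<otimes> Pp \<nu> = (if \<mu> = \<nu> then Pp \<mu> else \<zero>)"
proof -
  obtain v where v: "v \<in> verts E" "adj (Sp \<mu>) \<otimes> Sp \<mu> = P v" "Sp \<mu> \<otimes> P v = Sp \<mu>"
    using assms(1) by (rule Sp_final)
  have "Pp \<mu> \<otimes> Pp \<nu> = Sp \<mu> \<otimes> (adj (Sp \<mu>) \<otimes> Sp \<nu>) \<otimes> adj (Sp \<nu>)"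
    using assms by (simp add: P_path_def mult_assoc)
  also have "\<dots> = (if \<mu> = \<nu> then Pp \<mu> else \<zero>)"
    using assms v adj_Sp_mult_Sp_zero[OF assms] by (auto simp: P_path_def)
  finally show ?thesis .
qed

lemma Pp_projection: "\<mu> \<in> pathn m \<Longrightarrow> is_projection A (Pp \<mu>)"
  using Pp_orthogonal[of \<mu> m \<mu>] by (simp add: is_projection_def) (simp add: P_path_def adj_mult)

section \<open>The levels of the diagonal\<close>

lemma Pp_image_in: "Pp ` pathn m \<subseteq> carrier A"
  by auto

lemma D_submodule: "submodule (D m) complex_ring A"
  unfolding D_level_def by (rule lspan_submodule[OF Pp_image_in])

lemmas D_in = submoduleD(1)[OF D_submodule]
  and D_zero = submoduleD(2)[OF D_submodule]
  and D_add = submoduleD(3)[OF D_submodule]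
  and D_smult = submoduleD(4)[OF D_submodule]
  and D_finsum = submodule_finsum[OF D_submodule]

lemma Pp_in_D: "\<mu> \<in> pathn m \<Longrightarrow> Pp \<mu> \<in> D m"
  unfolding D_level_def by (rule subsetD[OF lspan_incl imageI])

lemma D_least: "\<lbrakk>submodule V complex_ring A; \<And>\<mu>. \<mu> \<in> pathn m \<Longrightarrow> Pp \<mu> \<in> V\<rbrakk> \<Longrightarrow> D m \<subseteq> V"
  unfolding D_level_def by (rule lspan_least) auto

lemma D_sandwich:
  assumes "x \<in> D m" "submodule V complex_ring A" "a \<in> carrier A" "b \<in> carrier A"
    and "\<And>\<mu>. \<mu> \<in> pathn m \<Longrightarrow> a \<otimes> Pp \<mu> \<otimes> b \<in> V"
  shows "a \<otimes> x \<otimes> b \<in> V"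
  using assms(1) unfolding D_level_def
  by (rule lspan_sandwich[OF _ Pp_image_in assms(2-4)]) (auto simp: assms(5))

text \<open>The \<open>P\<^sub>\<mu>\<close> are the minimal projections of \<open>D\<^sup>m\<close>, and the scalars are the coordinates of \<open>x\<close>.\<close>

lemma D_scalar:
  assumes "x \<in> D m" "\<mu> \<in> pathn m"
  shows "\<exists>c. Pp \<mu> \<otimes> x = c \<odot> Pp \<mu> \<and> x \<otimes> Pp \<mu> = c \<odot> Pp \<mu>"
proof -
  define V where "V = {x \<in> carrier A. \<exists>c. Pp \<mu> \<otimes> x = c \<odot> Pp \<mu> \<and> x \<otimes> Pp \<mu> = c \<odot> Pp \<mu>}"
  have P: "Pp \<mu> \<in> carrier A" using assms(2) by simp
  have "submodule V complex_ring A"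
    unfolding submodule_iff
  proof (intro conjI ballI allI)
    show "\<zero> \<in> V" using P by (auto simp: V_def intro!: exI[of _ 0])
    fix x y c assume "x \<in> V"
    then obtain a where a: "x \<in> carrier A" "Pp \<mu> \<otimes> x = a \<odot> Pp \<mu>" "x \<otimes> Pp \<mu> = a \<odot> Pp \<mu>"
      by (auto simp: V_def)
    show "c \<odot> x \<in> V"
      using a P by (auto simp: V_def smult_mult_l smult_mult_r intro!: exI[of _ "c * a"])
    assume "y \<in> V"
    then obtain b where b: "y \<in> carrier A" "Pp \<mu> \<otimes> y = b \<odot> Pp \<mu>" "y \<otimes> Pp \<mu> = b \<odot> Pp \<mu>"
      by (auto simp: V_def)
    show "x \<oplus> y \<in> V"
      using a b P by (auto simp: V_def mult_l_distr mult_r_distr smult_add_l intro!: exI[of _ "a + b"])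
  qed (auto simp: V_def)
  moreover have "Pp \<nu> \<in> V" if \<nu>: "\<nu> \<in> pathn m" for \<nu>
    unfolding V_def using P \<nu> Pp_orthogonal[OF assms(2) \<nu>] Pp_orthogonal[OF \<nu> assms(2)]
    by (auto intro!: exI[of _ "if \<mu> = \<nu> then 1 else 0"])
  ultimately have "D m \<subseteq> V" by (rule D_least)
  then show ?thesis using assms(1) by (auto simp: V_def)
qed

lemma D_coordinates:
  assumes "x \<in> D m"
  obtains c where "\<forall>\<mu>\<in>pathn m. Pp \<mu> \<otimes> x = c \<mu> \<odot> Pp \<mu> \<and> x \<otimes> Pp \<mu> = c \<mu> \<odot> Pp \<mu>"
    "x = (\<Oplus>\<mu>\<in>pathn m. c \<mu> \<odot> Pp \<mu>)"
proof -
  have "\<forall>\<mu>\<in>pathn m. \<exists>c. Pp \<mu> \<otimes> x = c \<odot> Pp \<mu> \<and> x \<otimes> Pp \<mu> = c \<odot> Pp \<mu>"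
    using D_scalar[OF assms] by blast
  then obtain c where c: "\<forall>\<mu>\<in>pathn m. Pp \<mu> \<otimes> x = c \<mu> \<odot> Pp \<mu> \<and> x \<otimes> Pp \<mu> = c \<mu> \<odot> Pp \<mu>"
    by metis
  have "x \<otimes> \<one> = (\<Oplus>\<mu>\<in>pathn m. x \<otimes> Pp \<mu>)"
    unfolding sum_Pp'[of m, symmetric] using D_in[OF assms] by (intro finsum_mult_r) auto
  also have "\<dots> = (\<Oplus>\<mu>\<in>pathn m. c \<mu> \<odot> Pp \<mu>)"
    using c by (intro finsum_cong) auto
  finally have "x = (\<Oplus>\<mu>\<in>pathn m. c \<mu> \<odot> Pp \<mu>)" using D_in[OF assms] by simp
  with c show thesis by (rule that)
qed

lemma D_combination: "(\<Oplus>\<mu>\<in>pathn m. c \<mu> \<odot> Pp \<mu>) \<in> D m"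
  by (rule D_finsum) (rule D_smult[OF Pp_in_D])

lemma D_mult_comm:
  assumes "x \<in> D m" "y \<in> D m"
  shows "x \<otimes> y \<in> D m" "x \<otimes> y = y \<otimes> x"
proof -
  note xy = D_in[OF assms(1)] D_in[OF assms(2)]
  obtain c where c: "\<forall>\<mu>\<in>pathn m. Pp \<mu> \<otimes> x = c \<mu> \<odot> Pp \<mu> \<and> x \<otimes> Pp \<mu> = c \<mu> \<odot> Pp \<mu>"
    "x = (\<Oplus>\<mu>\<in>pathn m. c \<mu> \<odot> Pp \<mu>)"
    by (rule D_coordinates[OF assms(1)])
  obtain d where d: "\<forall>\<mu>\<in>pathn m. Pp \<mu> \<otimes> y = d \<mu> \<odot> Pp \<mu> \<and> y \<otimes> Pp \<mu> = d \<mu> \<odot> Pp \<mu>"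
    "y = (\<Oplus>\<mu>\<in>pathn m. d \<mu> \<odot> Pp \<mu>)"
    by (rule D_coordinates[OF assms(2)])
  have "x \<otimes> y = (\<Oplus>\<mu>\<in>pathn m. x \<otimes> (d \<mu> \<odot> Pp \<mu>))"
    using xy by (subst d(2)) (intro finsum_mult_r, auto)
  also have "\<dots> = (\<Oplus>\<mu>\<in>pathn m. (c \<mu> * d \<mu>) \<odot> Pp \<mu>)"
    by (intro finsum_cong) (auto simp: smult_mult_r[OF xy(1)] c(1) mult.commute)
  finally have prod: "x \<otimes> y = (\<Oplus>\<mu>\<in>pathn m. (c \<mu> * d \<mu>) \<odot> Pp \<mu>)" .
  show "x \<otimes> y \<in> D m" unfolding prod by (rule D_combination)
  have "y \<otimes> x = (\<Oplus>\<mu>\<in>pathn m. y \<otimes> (c \<mu> \<odot> Pp \<mu>))"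
    using xy by (subst c(2)) (intro finsum_mult_r, auto)
  also have "\<dots> = (\<Oplus>\<mu>\<in>pathn m. (c \<mu> * d \<mu>) \<odot> Pp \<mu>)"
    by (intro finsum_cong) (auto simp: smult_mult_r[OF xy(2)] d(1))
  finally show "x \<otimes> y = y \<otimes> x" using prod by simp
qed

lemma D_adj:
  assumes "x \<in> D m"
  shows "adj x \<in> D m"
proof -
  obtain c where c: "x = (\<Oplus>\<mu>\<in>pathn m. c \<mu> \<odot> Pp \<mu>)"
    by (rule D_coordinates[OF assms])
  have "adj x = (\<Oplus>\<mu>\<in>pathn m. adj (c \<mu> \<odot> Pp \<mu>))"
    unfolding c by (rule adj_finsum) simp
  also have "\<dots> = (\<Oplus>\<mu>\<in>pathn m. cnj (c \<mu>) \<odot> Pp \<mu>)"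
    using Pp_projection by (intro finsum_cong) (auto simp: adj_smult is_projection_def)
  finally show ?thesis using D_combination by simp
qed

lemma P_in_D0: "v \<in> verts E \<Longrightarrow> P v \<in> D 0"
  using Pp_in_D[of "(v, [])" 0] by (simp add: pathn_0 P_path_def P_idem)

lemma D0_least: "\<lbrakk>submodule V complex_ring A; \<And>v. v \<in> verts E \<Longrightarrow> P v \<in> V\<rbrakk> \<Longrightarrow> D 0 \<subseteq> V"
  by (rule D_least) (auto simp: pathn_0 P_path_def P_idem)

lemma Pp_Cons:
  "\<lbrakk>e \<in> arcs E; (head E e, p) \<in> pathn m\<rbrakk> \<Longrightarrow> Pp (tail E e, e # p) = S e \<otimes> Pp (head E e, p) \<otimes> adj (S e)"
  using Sp_Cons[of e p m] by (simp add: P_path_def adj_mult mult_assoc)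

text \<open>Together with \<open>D_Suc_least\<close> this says that \<open>D\<^sup>m\<^sup>+\<^sup>1\<close> is the span of the \<open>S\<^sub>e D\<^sup>m S\<^sub>e\<^sup>*\<close>, the recursive
  description on which the inductions over levels rest.\<close>

lemma D_extend:
  assumes "x \<in> D m" "e \<in> arcs E"
  shows "S e \<otimes> x \<otimes> adj (S e) \<in> D (Suc m)"
proof (rule D_sandwich[OF assms(1) D_submodule])
  fix \<mu> assume \<mu>: "\<mu> \<in> pathn m"
  show "S e \<otimes> Pp \<mu> \<otimes> adj (S e) \<in> D (Suc m)"
  proof (cases "head E e = fst \<mu>")
    case True
    then have "(head E e, snd \<mu>) = \<mu>" by simp
    then show ?thesis
      using Pp_Cons[OF assms(2), of "snd \<mu>" m] Pp_in_D[OF path_Cons[OF assms(2), of "snd \<mu>" m]] \<mu> by simp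
  next
    case False
    have "S e \<otimes> Pp \<mu> = S e \<otimes> Sp \<mu> \<otimes> adj (Sp \<mu>)"
      using assms(2) \<mu> by (simp add: P_path_def mult_assoc)
    then show ?thesis
      using S_mult_Sp_zero[OF \<mu> assms(2) False] assms(2) \<mu> D_zero by simp
  qed
qed (use assms in auto)

lemma D_Suc_least:
  assumes "submodule V complex_ring A"
    and "\<And>e x. \<lbrakk>e \<in> arcs E; x \<in> D m\<rbrakk> \<Longrightarrow> S e \<otimes> x \<otimes> adj (S e) \<in> V"
  shows "D (Suc m) \<subseteq> V"
proof (rule D_least[OF assms(1)])
  fix \<mu> assume "\<mu> \<in> pathn (Suc m)"
  then obtain e p where "e \<in> arcs E" "(head E e, p) \<in> pathn m" "\<mu> = (tail E e, e # p)"
    by (rule path_cases)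
  then show "Pp \<mu> \<in> V" using Pp_Cons assms(2) Pp_in_D by simp
qed

lemma D_Suc_mono: "D m \<subseteq> D (Suc m)"
proof (induction m)
  case 0
  show ?case
  proof (rule D0_least[OF D_submodule])
    fix v assume v: "v \<in> verts E"
    have "S e \<otimes> adj (S e) \<in> D (Suc 0)" if e: "e \<in> arcs E" for e
      using D_extend[OF P_in_D0[of "head E e"] e] e by (simp add: S_mult_P)
    then show "P v \<in> D (Suc 0)"
      unfolding P_eq_sum[OF v] by (intro D_finsum) (simp add: out_arcs_def)
  qed
next
  case (Suc m)
  show ?case
    by (rule D_Suc_least[OF D_submodule]) (rule D_extend[OF subsetD[OF Suc.IH]])
qed

lemma D_mono: "m \<le> n \<Longrightarrow> D m \<subseteq> D n"
  using D_Suc_mono by (rule lift_Suc_mono_le)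

lemma P_in_D: "v \<in> verts E \<Longrightarrow> P v \<in> D m"
  using P_in_D0 D_mono[of 0 m] by auto

lemma one_in_D: "\<one> \<in> D m"
  unfolding one_eq_sum_P by (rule D_finsum) (rule P_in_D)

text \<open>Inverse to \<open>D_extend\<close>: compressing by edges removes the first edge of each path.\<close>

lemma D_compress:
  assumes "x \<in> D (Suc m)" "e \<in> arcs E" "f \<in> arcs E"
  shows "adj (S e) \<otimes> x \<otimes> S f \<in> D m"
proof -
  define V where "V = {x \<in> carrier A. adj (S e) \<otimes> x \<otimes> S f \<in> D m}"
  have V: "submodule V complex_ring A"
    unfolding V_def submodule_iff using assms(2,3) D_zero D_add D_smult
    by (auto simp: mult_l_distr mult_r_distr smult_mult_l smult_mult_r)
  have "D (Suc m) \<subseteq> V"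
  proof (rule D_Suc_least[OF V])
    fix g x assume g: "g \<in> arcs E" and x: "x \<in> D m"
    have PxP: "P v \<otimes> (x \<otimes> P w) \<in> D m" if "v \<in> verts E" "w \<in> verts E" for v w
      using D_mult_comm(1)[OF P_in_D D_mult_comm(1)[OF x P_in_D]] that by simp
    have "adj (S e) \<otimes> (S g \<otimes> x \<otimes> adj (S g)) \<otimes> S f =
        (if e = g \<and> g = f then P (head E e) \<otimes> (x \<otimes> P (head E f)) else \<zero>)"
      using assms(2,3) g D_in[OF x] by (simp add: ck_rules)
    then show "S g \<otimes> x \<otimes> adj (S g) \<in> V"
      using g D_in[OF x] PxP[of "head E e" "head E f"] assms(2,3) D_zero[of m] by (auto simp: V_def)
  qed
  then show ?thesis using assms(1) by (auto simp: V_def)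
qed

lemma D0_compress:
  assumes "x \<in> D 0" "e \<in> arcs E" "f \<in> arcs E"
  shows "adj (S e) \<otimes> x \<otimes> S f \<in> D 0"
proof (rule D_sandwich[OF assms(1) D_submodule])
  fix \<mu> assume "\<mu> \<in> pathn 0"
  then obtain v where v: "v \<in> verts E" "\<mu> = (v, [])" by (auto simp: pathn_0)
  then show "adj (S e) \<otimes> Pp \<mu> \<otimes> S f \<in> D 0"
    using assms(2,3) D_zero[of 0] P_in_D0[of "head E e"] by (auto simp: P_path_def ck_rules)
qed (use assms in auto)

lemma D_path_extend:
  assumes "x \<in> D j" "\<mu> \<in> pathn m"
  shows "Sp \<mu> \<otimes> x \<otimes> adj (Sp \<mu>) \<in> D (m + j)"
  using assms(2)
proof (induction m arbitrary: \<mu>)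
  case 0
  then show ?case
    using D_mult_comm(1)[OF D_mult_comm(1)[OF P_in_D assms(1)] P_in_D] by (auto simp: pathn_0)
next
  case (Suc m)
  from Suc.prems obtain e p where \<mu>: "e \<in> arcs E" "(head E e, p) \<in> pathn m" "\<mu> = (tail E e, e # p)"
    by (rule path_cases)
  have "Sp \<mu> \<otimes> x \<otimes> adj (Sp \<mu>) = S e \<otimes> (Sp (head E e, p) \<otimes> x \<otimes> adj (Sp (head E e, p))) \<otimes> adj (S e)"
    using \<mu> D_in[OF assms(1)] Sp_Cons[OF \<mu>(1,2)] Sp_in[OF \<mu>(2)] by (simp add: adj_mult mult_assoc del: S_path.simps)
  then show ?case using D_extend[OF Suc.IH[OF \<mu>(2)] \<mu>(1)] by simp
qed

text \<open>The recursive description of the levels with a whole initial path of length \<open>m\<close> split off, so that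
  elements of \<open>F\<^sup>m\<close> can act on that initial part.\<close>

lemma D_add_least:
  assumes "submodule V complex_ring A"
    and "\<And>\<mu> x. \<lbrakk>\<mu> \<in> pathn m; x \<in> D j\<rbrakk> \<Longrightarrow> Sp \<mu> \<otimes> x \<otimes> adj (Sp \<mu>) \<in> V"
  shows "D (m + j) \<subseteq> V"
  using assms
proof (induction m arbitrary: V)
  case 0
  have "x \<in> V" if x: "x \<in> D j" for x
  proof -
    have "P v \<otimes> x \<in> V" if v: "v \<in> verts E" for v
    proof -
      have "P v \<otimes> x \<otimes> P v \<in> V"
        using 0(2)[of "(v, [])" x] v x by (simp add: pathn_0)
      moreover have "P v \<otimes> x \<otimes> P v = P v \<otimes> x"
        using D_mult_comm(2)[OF x P_in_D[OF v]] v D_in[OF x] by (simp add: mult_assoc assoc_rules)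
      ultimately show ?thesis by simp
    qed
    then have "(\<Oplus>v\<in>verts E. P v \<otimes> x) \<in> V" by (intro submodule_finsum[OF 0(1)])
    moreover have "\<one> \<otimes> x = (\<Oplus>v\<in>verts E. P v \<otimes> x)"
      unfolding one_eq_sum_P using D_in[OF x] by (intro finsum_mult_l) auto
    ultimately show ?thesis using D_in[OF x] by simp
  qed
  then show ?case by auto
next
  case (Suc m)
  have "D (Suc (m + j)) \<subseteq> V"
  proof (rule D_Suc_least[OF Suc.prems(1)])
    fix e y assume e: "e \<in> arcs E" and y: "y \<in> D (m + j)"
    define W where "W = {y \<in> carrier A. S e \<otimes> y \<otimes> adj (S e) \<in> V}"
    have "submodule W complex_ring A"
      unfolding W_def submodule_iff using e submoduleD[OF Suc.prems(1)]
      by (auto simp: mult_l_distr mult_r_distr smult_mult_l smult_mult_r)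
    then have "D (m + j) \<subseteq> W"
    proof (rule Suc.IH)
      fix \<mu> x assume \<mu>: "\<mu> \<in> pathn m" and x: "x \<in> D j"
      have xA: "x \<in> carrier A" using x D_in by simp
      have eq: "S e \<otimes> (Sp \<mu> \<otimes> x \<otimes> adj (Sp \<mu>)) \<otimes> adj (S e) = (S e \<otimes> Sp \<mu>) \<otimes> x \<otimes> adj (S e \<otimes> Sp \<mu>)"
        using e \<mu> xA by (simp add: adj_mult mult_assoc)
      have "(S e \<otimes> Sp \<mu>) \<otimes> x \<otimes> adj (S e \<otimes> Sp \<mu>) \<in> V"
      proof (cases "head E e = fst \<mu>")
        case True
        then have "(head E e, snd \<mu>) = \<mu>" by simp
        then show ?thesis
          using Sp_Cons[OF e, of "snd \<mu>" m] Suc.prems(2)[OF path_Cons[OF e, of "snd \<mu>" m] x] \<mu> by simp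
      next
        case False
        then show ?thesis using S_mult_Sp_zero[OF \<mu> e] xA submoduleD(2)[OF Suc.prems(1)] by simp
      qed
      then show "Sp \<mu> \<otimes> x \<otimes> adj (Sp \<mu>) \<in> W"
        unfolding W_def eq[symmetric] using \<mu> xA by simp
    qed
    then show "S e \<otimes> y \<otimes> adj (S e) \<in> V" using y by (auto simp: W_def)
  qed
  then show ?case by simp
qed

end

section \<open>The diagonal algebra\<close>

text \<open>It turns a bound on the coefficients of \<open>\<Sum> c\<^sub>\<mu> P\<^sub>\<mu>\<close> into a bound on the norm, since combinations with
  unimodular coefficients are unitary.\<close>

lemma disc_midpoint_of_unimodular:
  fixes c :: complex
  assumes "cmod c \<le> 1"
  shows "\<exists>a b. cmod a = 1 \<and> cmod b = 1 \<and> c = (a + b) / 2"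
proof -
  define r where "r = cmod c"
  define w where "w = (if c = 0 then 1 else sgn c)"
  define s where "s = sqrt (1 - r\<^sup>2)"
  have w: "cmod w = 1" "c = of_real r * w"
    by (auto simp: w_def r_def sgn_eq norm_divide)
  have "r\<^sup>2 + s\<^sup>2 = 1"
    using assms by (simp add: r_def s_def abs_square_le_1)
  then have "cmod (Complex r s) = 1" "cmod (Complex r (- s)) = 1"
    by (simp_all add: cmod_def)
  moreover have "c = (w * Complex r s + w * Complex r (- s)) / 2"
    unfolding w(2) by (simp add: complex_eq_iff)
  ultimately show ?thesis
    using w(1) by (intro exI[of _ "w * Complex r s"] exI[of _ "w * Complex r (- s)"]) (simp add: norm_mult)
qed

context cuntz_krieger
begin

abbreviation DE :: "'a set" where "DE \<equiv> D_alg E A P S"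

text \<open>The algebraic part of the diagonal algebra, of which the latter is the closure
  (\<open>D_alg_eq_closure\<close>).\<close>

definition Dfin :: "'a set" where "Dfin = (\<Union>m. D m)"

lemma Dfin_common:
  assumes "x \<in> Dfin" "y \<in> Dfin"
  obtains m where "x \<in> D m" "y \<in> D m"
proof -
  obtain i j where "x \<in> D i" "y \<in> D j" using assms by (auto simp: Dfin_def)
  then show thesis using that[of "max i j"] D_mono[of i "max i j"] D_mono[of j "max i j"] by auto
qed

lemma DfinI: "x \<in> D m \<Longrightarrow> x \<in> Dfin"
  by (auto simp: Dfin_def)

lemma Dfin_in: "Dfin \<subseteq> carrier A"
  using D_in by (auto simp: Dfin_def)

lemma Dfin_submodule: "submodule Dfin complex_ring A"
  unfolding submodule_iff
proof (intro conjI ballI allI)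
  show "\<zero> \<in> Dfin" using DfinI[OF D_zero] .
  fix x y c assume x: "x \<in> Dfin"
  show "c \<odot> x \<in> Dfin" using x by (rule Dfin_common[OF x]) (rule DfinI[OF D_smult])
  assume "y \<in> Dfin"
  with x obtain m where "x \<in> D m" "y \<in> D m" by (rule Dfin_common)
  then show "x \<oplus> y \<in> Dfin" by (rule DfinI[OF D_add])
qed (rule Dfin_in)

lemma Dfin_mult_comm:
  assumes "x \<in> Dfin" "y \<in> Dfin"
  shows "x \<otimes> y \<in> Dfin" "x \<otimes> y = y \<otimes> x"
proof -
  obtain m where "x \<in> D m" "y \<in> D m" using assms by (rule Dfin_common)
  then show "x \<otimes> y \<in> Dfin" "x \<otimes> y = y \<otimes> x" by (auto intro: DfinI[OF D_mult_comm(1)] D_mult_comm(2))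
qed

lemma paths_UN: "paths E = (\<Union>m. pathn m)"
  by (auto simp: paths_of_length_def)

lemma D_alg_subalgebra: "cstar_subalgebra (DE) A"
  unfolding D_alg_def by (rule cstar_gen_subalgebra) (auto simp: paths_UN)

lemma D_alg_in: "x \<in> DE \<Longrightarrow> x \<in> carrier A"
  by (rule submoduleD(1)[OF cstar_subalgebraD(1)[OF D_alg_subalgebra]])

lemma D_subset_D_alg: "D m \<subseteq> DE"
proof (rule D_least[OF cstar_subalgebraD(1)[OF D_alg_subalgebra]])
  fix \<mu> assume "\<mu> \<in> pathn m"
  then have "Pp \<mu> \<in> Pp ` paths E" by (auto simp: paths_UN)
  then show "Pp \<mu> \<in> DE"
    unfolding D_alg_def by (rule subsetD[OF cstar_gen_incl])
qed

lemma Dfin_subset_D_alg: "Dfin \<subseteq> DE"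
  using D_subset_D_alg by (auto simp: Dfin_def)

lemma D_alg_eq_closure: "DE = seq_closure Dfin"
proof
  have "cstar_subalgebra (seq_closure Dfin) A"
  proof (rule seq_closure_subalgebra[OF Dfin_submodule Dfin_mult_comm(1)])
    fix x assume "x \<in> Dfin"
    then show "adj x \<in> Dfin" using D_adj by (auto simp: Dfin_def)
  qed
  moreover have "Pp ` paths E \<subseteq> seq_closure Dfin"
    by (auto simp: paths_UN intro!: subsetD[OF subset_seq_closure[OF Dfin_in]] elim!: DfinI[OF Pp_in_D])
  ultimately show "DE \<subseteq> seq_closure Dfin"
    unfolding D_alg_def by (rule cstar_gen_least)
  show "seq_closure Dfin \<subseteq> DE"
  proof
    fix x assume "x \<in> seq_closure Dfin"
    then obtain \<sigma> where \<sigma>: "\<forall>n. \<sigma> n \<in> Dfin" "conv \<sigma> x" by (rule seq_closureE)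
    then have "range \<sigma> \<subseteq> DE" using Dfin_subset_D_alg by auto
    then show "x \<in> DE" using \<sigma>(2) by (rule cstar_subalgebraD(4)[OF D_alg_subalgebra])
  qed
qed

lemma D_alg_approx:
  assumes "x \<in> DE"
  obtains \<sigma> where "\<forall>n. \<sigma> n \<in> Dfin" "conv \<sigma> x"
  using assms unfolding D_alg_eq_closure by (rule seq_closureE)

lemma nrm_lt_approx:
  assumes "x \<in> DE" "\<epsilon> > 0"
  obtains y where "y \<in> Dfin" "nrm (y \<ominus> x) < \<epsilon>"
proof -
  obtain \<sigma> where \<sigma>: "\<forall>n. \<sigma> n \<in> Dfin" "conv \<sigma> x" using assms(1) by (rule D_alg_approx)
  have "\<forall>\<^sub>F n in sequentially. nrm (\<sigma> n \<ominus> x) < \<epsilon>"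
    using convD(3)[OF \<sigma>(2)] assms(2) by (rule order_tendstoD)
  then obtain n where "nrm (\<sigma> n \<ominus> x) < \<epsilon>" using eventually_sequentially by auto
  then show thesis using that \<sigma>(1) by auto
qed

lemma D_alg_comm_Dfin:
  assumes "x \<in> DE" "y \<in> Dfin"
  shows "x \<otimes> y = y \<otimes> x"
proof -
  obtain \<sigma> where \<sigma>: "\<forall>n. \<sigma> n \<in> Dfin" "conv \<sigma> x" using assms(1) by (rule D_alg_approx)
  have y: "y \<in> carrier A" using assms(2) Dfin_in by auto
  have "(\<lambda>n. \<sigma> n \<otimes> y) = (\<lambda>n. y \<otimes> \<sigma> n)"
    using Dfin_mult_comm(2)[OF \<sigma>(1)[rule_format] assms(2)] by auto
  then show ?thesis
    using conv_mult[OF \<sigma>(2) conv_const[OF y]] conv_mult[OF conv_const[OF y] \<sigma>(2)] conv_unique by simp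
qed

text \<open>Choose \<open>y \<in> D\<^sup>m\<close> within distance \<open>1/2\<close> of \<open>q\<close>, and let \<open>y P\<^sub>\<mu> = c P\<^sub>\<mu>\<close>. Both
  \<open>(c - 1) q P\<^sub>\<mu>\<close> and \<open>c (1 - q) P\<^sub>\<mu>\<close> have norm less than \<open>1/2\<close>, and one of the two scalars has modulus at least
  \<open>1/2\<close>; so one of the projections \<open>q P\<^sub>\<mu>\<close> and \<open>(1 - q) P\<^sub>\<mu>\<close> has norm less than 1 and is zero. Hence
  \<open>q P\<^sub>\<mu>\<close> is \<open>0\<close> or \<open>P\<^sub>\<mu>\<close>, and \<open>q\<close> is a sum of some of the \<open>P\<^sub>\<mu>\<close>.\<close>

lemma projection_in_some_D:
  assumes q: "is_projection A q" "q \<in> DE"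
  shows "q \<in> Dfin"
proof -
  have q': "q \<in> carrier A" "q \<otimes> q = q" "adj q = q" using q(1) by (auto simp: is_projection_def)
  obtain y where y: "y \<in> Dfin" "nrm (y \<ominus> q) < 1/2" using nrm_lt_approx[OF q(2), of "1/2"] by auto
  then obtain m where m: "y \<in> D m" by (auto simp: Dfin_def)
  note yA = D_in[OF m]
  have half: "nrm (a \<otimes> ((y \<ominus> q) \<otimes> p)) < 1/2"
    if "is_projection A a" "is_projection A p" for a p
  proof -
    have ap: "a \<in> carrier A" "p \<in> carrier A" "nrm a \<le> 1" "nrm p \<le> 1"
      using that nrm_projection_le by (auto simp: is_projection_def)
    have d: "y \<ominus> q \<in> carrier A" using yA q' by simp
    have "nrm (a \<otimes> ((y \<ominus> q) \<otimes> p)) \<le> nrm a * nrm ((y \<ominus> q) \<otimes> p)"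
      using ap d by (intro nrm_mult) auto
    also have "\<dots> \<le> nrm a * (nrm (y \<ominus> q) * nrm p)"
      using ap d by (intro mult_left_mono nrm_mult nrm_nonneg) auto
    also have "\<dots> \<le> 1 * (nrm (y \<ominus> q) * 1)"
      using ap d by (intro mult_mono) (auto intro!: nrm_nonneg mult_nonneg_nonneg)
    finally show ?thesis using y(2) by simp
  qed
  have "q \<otimes> Pp \<mu> \<in> D m" if \<mu>: "\<mu> \<in> pathn m" for \<mu>
  proof -
    define p where "p = Pp \<mu>"
    have p: "p \<in> carrier A" "is_projection A p" "p \<otimes> p = p" "adj p = p" "p \<in> D m"
      using Pp_projection[OF \<mu>] Pp_in_D[OF \<mu>] \<mu> by (auto simp: p_def is_projection_def)
    obtain c where c: "y \<otimes> p = c \<odot> p"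
      using D_scalar[OF m \<mu>] by (auto simp: p_def)
    have comm: "q \<otimes> p = p \<otimes> q" using D_alg_comm_Dfin[OF q(2)] p(5) DfinI by auto
    have q_qp: "q \<otimes> (q \<otimes> p) = q \<otimes> p" using q' p by (simp flip: mult_assoc)
    have p_qp: "p \<otimes> (q \<otimes> p) = q \<otimes> p"
      unfolding comm using q' p by (simp flip: mult_assoc)
    have qp_p: "q \<otimes> p \<otimes> p = q \<otimes> p" using q' p by (simp add: mult_assoc)
    have proj: "is_projection A (q \<otimes> p)"
      unfolding is_projection_def
    proof (intro conjI)
      show "q \<otimes> p \<otimes> (q \<otimes> p) = q \<otimes> p"
        using mult_assoc[OF q'(1) p(1), of "q \<otimes> p"] q' p p_qp q_qp by simp
      show "adj (q \<otimes> p) = q \<otimes> p" using q' p comm by (simp add: adj_mult)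
    qed (use q' p in simp)
    have proj': "is_projection A (p \<ominus> q \<otimes> p)"
      unfolding is_projection_def
    proof (intro conjI)
      show "adj (p \<ominus> q \<otimes> p) = p \<ominus> q \<otimes> p" using q' p proj by (simp add: adj_diff is_projection_def)
      have "(p \<ominus> q \<otimes> p) \<otimes> (p \<ominus> q \<otimes> p) = (p \<ominus> q \<otimes> p) \<ominus> (q \<otimes> p \<ominus> q \<otimes> p)"
        using q' p proj p_qp qp_p by (simp add: mult_diff_l mult_diff_r is_projection_def)
      then show "(p \<ominus> q \<otimes> p) \<otimes> (p \<ominus> q \<otimes> p) = p \<ominus> q \<otimes> p"
        using q' p by (simp add: diff_eq_smult)
    qed (use q' p in simp)
    have proj1: "is_projection A (\<one> \<ominus> q)"
      using q' by (simp add: is_projection_def adj_diff mult_diff_l mult_diff_r) (simp add: diff_eq_smult)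
    have "(y \<ominus> q) \<otimes> p = c \<odot> p \<ominus> q \<otimes> p" using yA q' p c by (simp add: mult_diff_l)
    then have "q \<otimes> ((y \<ominus> q) \<otimes> p) = (c - 1) \<odot> (q \<otimes> p)"
      using q' p q_qp smult_add_l[of "q \<otimes> p" c "-1"]
      by (simp add: mult_diff_r smult_mult_r) (simp add: diff_eq_smult)
    then have lt1: "cmod (c - 1) * nrm (q \<otimes> p) < 1/2"
      using half[OF q(1) p(2)] q' p by (simp add: nrm_smult)
    have "(\<one> \<ominus> q) \<otimes> ((y \<ominus> q) \<otimes> p) = c \<odot> (p \<ominus> q \<otimes> p) \<ominus> (q \<otimes> p \<ominus> q \<otimes> p)"
      using \<open>(y \<ominus> q) \<otimes> p = c \<odot> p \<ominus> q \<otimes> p\<close> q' p q_qp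
      by (simp add: mult_diff_l mult_diff_r smult_mult_r smult_diff)
    then have lt2: "cmod c * nrm (p \<ominus> q \<otimes> p) < 1/2"
      using half[OF proj1 p(2)] q' p by (simp add: nrm_smult diff_eq_smult)
    have "q \<otimes> p = \<zero> \<or> q \<otimes> p = p"
    proof (cases "cmod c \<ge> 1/2")
      case True
      have "nrm (p \<ominus> q \<otimes> p) < 1"
        using lt2 mult_right_mono[OF True, of "nrm (p \<ominus> q \<otimes> p)"] nrm_nonneg[of "p \<ominus> q \<otimes> p"] q' p by simp
      then have "p \<ominus> q \<otimes> p = \<zero>" by (rule projection_zero[OF proj'])
      then show ?thesis using q' p by (simp add: diff_eq_zero_iff)
    next
      case False
      have "cmod (c - 1) \<ge> 1/2"
        using False norm_triangle_ineq3[of c 1] by simp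
      then have "nrm (q \<otimes> p) < 1"
        using lt1 mult_right_mono[of "1/2" "cmod (c - 1)" "nrm (q \<otimes> p)"] nrm_nonneg[of "q \<otimes> p"] q' p by simp
      then show ?thesis using projection_zero[OF proj] by simp
    qed
    then show ?thesis using p(5) D_zero by (auto simp: p_def)
  qed
  then have "(\<Oplus>\<mu>\<in>pathn m. q \<otimes> Pp \<mu>) \<in> D m" by (rule D_finsum)
  moreover have "q \<otimes> \<one> = (\<Oplus>\<mu>\<in>pathn m. q \<otimes> Pp \<mu>)"
    unfolding sum_Pp'[of m, symmetric] using q'(1) by (intro finsum_mult_r) auto
  ultimately show ?thesis using q'(1) by (auto intro: DfinI)
qed

lemma combination_mult_Pp:
  assumes "\<nu> \<in> pathn m"
  shows "(\<Oplus>\<mu>\<in>pathn m. c \<mu> \<odot> Pp \<mu>) \<otimes> Pp \<nu> = c \<nu> \<odot> Pp \<nu>"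
proof -
  have "(\<Oplus>\<mu>\<in>pathn m. c \<mu> \<odot> Pp \<mu>) \<otimes> Pp \<nu> = (\<Oplus>\<mu>\<in>pathn m. c \<mu> \<odot> Pp \<mu> \<otimes> Pp \<nu>)"
    using assms by (intro finsum_mult_l) auto
  also have "\<dots> = c \<nu> \<odot> Pp \<nu> \<otimes> Pp \<nu>"
    using assms finite_pathn by (intro finsum_single) (auto simp: smult_mult_l Pp_orthogonal)
  finally show ?thesis using assms by (simp add: smult_mult_l Pp_orthogonal)
qed

lemma nrm_unimodular_combination:
  assumes c: "\<And>\<mu>. \<mu> \<in> pathn m \<Longrightarrow> cmod (c \<mu>) = 1"
  shows "nrm (\<Oplus>\<mu>\<in>pathn m. c \<mu> \<odot> Pp \<mu>) \<le> 1"
proof (rule nrm_le_one_of_isometry)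
  define v where "v = (\<Oplus>\<mu>\<in>pathn m. c \<mu> \<odot> Pp \<mu>)"
  have v: "v \<in> carrier A" unfolding v_def by (rule D_in[OF D_combination])
  then show "(\<Oplus>\<mu>\<in>pathn m. c \<mu> \<odot> Pp \<mu>) \<in> carrier A" by (simp add: v_def)
  have adj_v: "adj v = (\<Oplus>\<mu>\<in>pathn m. cnj (c \<mu>) \<odot> Pp \<mu>)"
  proof -
    have "adj v = (\<Oplus>\<mu>\<in>pathn m. adj (c \<mu> \<odot> Pp \<mu>))" unfolding v_def by (rule adj_finsum) simp
    also have "\<dots> = (\<Oplus>\<mu>\<in>pathn m. cnj (c \<mu>) \<odot> Pp \<mu>)"
      using Pp_projection by (intro finsum_cong) (auto simp: adj_smult is_projection_def)
    finally show ?thesis .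
  qed
  have "adj v \<otimes> v = (\<Oplus>\<mu>\<in>pathn m. adj v \<otimes> (c \<mu> \<odot> Pp \<mu>))"
    using v by (subst (2) v_def) (intro finsum_mult_r, auto)
  also have "\<dots> = (\<Oplus>\<mu>\<in>pathn m. Pp \<mu>)"
  proof (rule finsum_cong)
    fix \<mu> assume \<mu>: "\<mu> \<in> pathn m"
    have "adj v \<otimes> (c \<mu> \<odot> Pp \<mu>) = c \<mu> \<odot> (cnj (c \<mu>) \<odot> Pp \<mu>)"
      using combination_mult_Pp[OF \<mu>, of "\<lambda>\<mu>. cnj (c \<mu>)"] \<mu> v by (simp add: smult_mult_r adj_v[symmetric])
    also have "\<dots> = Pp \<mu>"
      using c[OF \<mu>] \<mu> complex_norm_square[of "c \<mu>"] by simp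
    finally show "adj v \<otimes> (c \<mu> \<odot> Pp \<mu>) = Pp \<mu>" .
  qed simp
  also have "\<dots> = \<one>" by (rule sum_Pp')
  finally show "is_projection A (adj (\<Oplus>\<mu>\<in>pathn m. c \<mu> \<odot> Pp \<mu>) \<otimes> (\<Oplus>\<mu>\<in>pathn m. c \<mu> \<odot> Pp \<mu>))"
    using one_projection by (simp add: v_def)
qed

text \<open>After division by \<open>M\<close> every coefficient is the midpoint of two unimodular numbers, and the combination
  the midpoint of two unitaries.\<close>

lemma nrm_combination_le:
  assumes M: "0 \<le> M" and c: "\<And>\<mu>. \<mu> \<in> pathn m \<Longrightarrow> cmod (c \<mu>) \<le> M"
  shows "nrm (\<Oplus>\<mu>\<in>pathn m. c \<mu> \<odot> Pp \<mu>) \<le> M"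
proof (cases "M = 0")
  case True
  then have "(\<Oplus>\<mu>\<in>pathn m. c \<mu> \<odot> Pp \<mu>) = (\<Oplus>\<mu>\<in>pathn m. \<zero>)"
    using c by (intro finsum_cong) auto
  then show ?thesis using True by simp
next
  case False
  have "\<exists>a b. cmod a = 1 \<and> cmod b = 1 \<and> c \<mu> / of_real M = (a + b) / 2" if "\<mu> \<in> pathn m" for \<mu>
    using c[OF that] False M by (intro disc_midpoint_of_unimodular) (simp add: norm_divide)
  then obtain a b where ab: "\<And>\<mu>. \<mu> \<in> pathn m \<Longrightarrow>
      cmod (a \<mu>) = 1 \<and> cmod (b \<mu>) = 1 \<and> c \<mu> / of_real M = (a \<mu> + b \<mu>) / 2"
    by metis
  let ?x = "\<Oplus>\<mu>\<in>pathn m. c \<mu> \<odot> Pp \<mu>" and ?a = "\<Oplus>\<mu>\<in>pathn m. a \<mu> \<odot> Pp \<mu>" and ?b = "\<Oplus>\<mu>\<in>pathn m. b \<mu> \<odot> Pp \<mu>"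
  have in_A: "?x \<in> carrier A" "?a \<in> carrier A" "?b \<in> carrier A"
    by (rule D_in[OF D_combination])+
  have eq: "?x = complex_of_real (M/2) \<odot> (?a \<oplus> ?b)"
  proof -
    have "(complex_of_real (M/2) \<odot> \<one>) \<otimes> (?a \<oplus> ?b) = (complex_of_real (M/2) \<odot> \<one>) \<otimes> (\<Oplus>\<mu>\<in>pathn m. a \<mu> \<odot> Pp \<mu> \<oplus> b \<mu> \<odot> Pp \<mu>)"
      by (subst M.finsum_addf) auto
    also have "\<dots> = (\<Oplus>\<mu>\<in>pathn m. (complex_of_real (M/2) \<odot> \<one>) \<otimes> (a \<mu> \<odot> Pp \<mu> \<oplus> b \<mu> \<odot> Pp \<mu>))"
      by (rule finsum_mult_r) auto
    also have "\<dots> = ?x"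
    proof (rule finsum_cong)
      fix \<mu> assume \<mu>: "\<mu> \<in> pathn m"
      have "c \<mu> = complex_of_real (M/2) * (a \<mu> + b \<mu>)"
        using ab[OF \<mu>] False by (simp add: field_simps)
      then have "c \<mu> = complex_of_real M * (a \<mu> + b \<mu>) / 2" by simp
      then show "(complex_of_real (M/2) \<odot> \<one>) \<otimes> (a \<mu> \<odot> Pp \<mu> \<oplus> b \<mu> \<odot> Pp \<mu>) = c \<mu> \<odot> Pp \<mu>"
        using \<mu> by (simp only:) (simp add: smult_mult_l flip: smult_add_l)
    qed auto
    finally show ?thesis using in_A by (simp add: smult_mult_l)
  qed
  have "nrm ?x = M / 2 * nrm (?a \<oplus> ?b)"
    unfolding eq using in_A M by (subst nrm_smult) auto
  also have "\<dots> \<le> M / 2 * (nrm ?a + nrm ?b)"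
    using in_A M by (intro mult_left_mono nrm_add) auto
  also have "\<dots> \<le> M / 2 * (1 + 1)"
    using M ab by (intro mult_left_mono add_mono nrm_unimodular_combination) auto
  finally show ?thesis by simp
qed

text \<open>The coefficient \<open>c\<^sub>\<mu>\<close> of \<open>x\<close> is also determined by \<open>\<psi>(P\<^sub>\<mu>) \<psi>(x) = c\<^sub>\<mu> \<psi>(P\<^sub>\<mu>)\<close>, where \<open>\<psi>(P\<^sub>\<mu>)\<close> has norm 1
  unless \<open>P\<^sub>\<mu> = 0\<close>.\<close>

lemma star_hom_bounded_below_D:
  assumes \<psi>: "star_hom A A \<psi>" and inj: "\<And>\<mu>. \<lbrakk>\<mu> \<in> pathn m; \<psi> (Pp \<mu>) = \<zero>\<rbrakk> \<Longrightarrow> Pp \<mu> = \<zero>"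
    and x: "x \<in> D m"
  shows "nrm x \<le> nrm (\<psi> x)"
proof -
  note h = star_homD[OF \<psi>]
  note xA = D_in[OF x]
  obtain c where c: "\<forall>\<mu>\<in>pathn m. Pp \<mu> \<otimes> x = c \<mu> \<odot> Pp \<mu> \<and> x \<otimes> Pp \<mu> = c \<mu> \<odot> Pp \<mu>"
    "x = (\<Oplus>\<mu>\<in>pathn m. c \<mu> \<odot> Pp \<mu>)"
    by (rule D_coordinates[OF x])
  \<comment> \<open>Coefficients of vanishing \<open>P\<^sub>\<mu>\<close> are arbitrary and must be discarded before they are estimated.\<close>
  define d where "d \<mu> = (if Pp \<mu> = \<zero> then 0 else c \<mu>)" for \<mu>
  have "x = (\<Oplus>\<mu>\<in>pathn m. d \<mu> \<odot> Pp \<mu>)"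
    by (subst c(2)) (rule finsum_cong, auto simp: d_def)
  moreover have "cmod (d \<mu>) \<le> nrm (\<psi> x)" if \<mu>: "\<mu> \<in> pathn m" for \<mu>
  proof (cases "Pp \<mu> = \<zero>")
    case False
    have p: "Pp \<mu> \<in> carrier A" "Pp \<mu> \<otimes> Pp \<mu> = Pp \<mu>" "adj (Pp \<mu>) = Pp \<mu>"
      using Pp_projection[OF \<mu>] by (auto simp: is_projection_def)
    have proj: "is_projection A (\<psi> (Pp \<mu>))"
      using h(1)[OF p(1)] h(4)[OF p(1) p(1)] h(5)[OF p(1)] p by (simp add: is_projection_def)
    have "\<psi> (Pp \<mu>) \<noteq> \<zero>" using inj[OF \<mu>] False by auto
    then have one: "nrm (\<psi> (Pp \<mu>)) = 1"
      using nrm_projection[OF proj] nrm_eq_zero[OF h(1)[OF p(1)]] by auto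
    have "\<psi> (Pp \<mu>) \<otimes> \<psi> x = c \<mu> \<odot> \<psi> (Pp \<mu>)"
      using h(4)[OF p(1) xA] h(3)[OF p(1), of "c \<mu>"] c(1) \<mu> by simp
    then have "cmod (c \<mu>) = nrm (\<psi> (Pp \<mu>) \<otimes> \<psi> x)"
      using nrm_smult[OF h(1)[OF p(1)], of "c \<mu>"] one by simp
    also have "\<dots> \<le> nrm (\<psi> x)"
      using nrm_mult[OF h(1)[OF p(1)] h(1)[OF xA]] one by simp
    finally show ?thesis using False by (simp add: d_def)
  qed (simp add: d_def nrm_nonneg h(1) xA)
  ultimately show ?thesis
    using nrm_combination_le[of "nrm (\<psi> x)" m d] nrm_nonneg[OF h(1)[OF xA]] by simp
qed

lemma star_hom_bounded_below_D_alg: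
  assumes \<psi>: "star_hom A A \<psi>" and inj: "\<And>\<mu>. \<lbrakk>\<mu> \<in> paths E; \<psi> (Pp \<mu>) = \<zero>\<rbrakk> \<Longrightarrow> Pp \<mu> = \<zero>"
    and x: "x \<in> DE"
  shows "nrm x \<le> nrm (\<psi> x)"
proof (rule field_le_epsilon)
  fix \<epsilon> :: real assume "\<epsilon> > 0"
  then obtain y where y: "y \<in> Dfin" "nrm (y \<ominus> x) < \<epsilon> / 2" using nrm_lt_approx[OF x, of "\<epsilon> / 2"] by auto
  note h = star_homD[OF \<psi>]
  have in_A: "x \<in> carrier A" "y \<in> carrier A" using D_alg_in[OF x] y Dfin_in by auto
  obtain m where m: "y \<in> D m" using y by (auto simp: Dfin_def)
  have "nrm y \<le> nrm (\<psi> y)"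
    using star_hom_bounded_below_D[OF \<psi> _ m] inj by (auto simp: paths_UN)
  moreover have "nrm (\<psi> y) \<le> nrm (\<psi> y \<ominus> \<psi> x) + nrm (\<psi> x)"
    using nrm_triangle[of "\<psi> y" "\<psi> x" \<zero>] h(1)[OF in_A(1)] h(1)[OF in_A(2)] by (simp add: diff_eq_smult)
  moreover have "\<psi> y \<ominus> \<psi> x = \<psi> (y \<ominus> x)"
    using in_A by (simp add: diff_eq_smult h)
  moreover have "nrm (\<psi> (y \<ominus> x)) \<le> nrm (y \<ominus> x)"
    using in_A by (intro star_hom_contractive[OF cstar_algebra_axioms \<psi>]) simp
  moreover have "nrm x \<le> nrm (y \<ominus> x) + nrm y"
    using nrm_triangle[of x y \<zero>] nrm_swap[OF in_A] in_A by (simp add: diff_eq_smult)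
  ultimately show "nrm x \<le> nrm (\<psi> x) + \<epsilon>" using y(2) by simp
qed

end

section \<open>Descending chains of finite-dimensional subspaces\<close>

context cstar_algebra
begin

lemma lspan_insert:
  assumes "p \<in> carrier A" "G \<subseteq> carrier A" "x \<in> lspan A (insert p G)"
  obtains c g where "g \<in> lspan A G" "x = c \<odot> p \<oplus> g"
proof -
  note G = lspan_submodule[OF assms(2)]
  define V where "V = {x. \<exists>c. \<exists>g\<in>lspan A G. x = c \<odot> p \<oplus> g}"
  have "submodule V complex_ring A"
    unfolding submodule_iff
  proof (intro conjI ballI allI)
    show "V \<subseteq> carrier A" using submoduleD(1)[OF G] assms(1) by (auto simp: V_def)
    show "\<zero> \<in> V"
      unfolding V_def using submoduleD(2)[OF G] assms(1) by (intro CollectI exI[of _ 0] bexI[of _ \<zero>]) auto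
    fix x y d assume "x \<in> V"
    then obtain a g where x: "g \<in> lspan A G" "x = a \<odot> p \<oplus> g" by (auto simp: V_def)
    note gA = submoduleD(1)[OF G x(1)]
    have "d \<odot> x = (d * a) \<odot> p \<oplus> d \<odot> g" using x(2) gA assms(1) by (simp add: smult_add_r)
    then show "d \<odot> x \<in> V" using submoduleD(4)[OF G x(1)] unfolding V_def by blast
    assume "y \<in> V"
    then obtain b h where y: "h \<in> lspan A G" "y = b \<odot> p \<oplus> h" by (auto simp: V_def)
    note hA = submoduleD(1)[OF G y(1)]
    have "x \<oplus> y = (a + b) \<odot> p \<oplus> (g \<oplus> h)"
      using x(2) y(2) gA hA assms(1) by (simp add: smult_add_l M.add.m_ac)
    then show "x \<oplus> y \<in> V" using submoduleD(3)[OF G x(1) y(1)] unfolding V_def by blast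
  qed
  moreover have "insert p G \<subseteq> V"
  proof
    fix y assume "y \<in> insert p G"
    then show "y \<in> V"
    proof
      assume "y = p"
      then have "y = 1 \<odot> p \<oplus> \<zero>" using assms(1) by simp
      then show ?thesis using submoduleD(2)[OF G] unfolding V_def by blast
    next
      assume y: "y \<in> G"
      then have "y = 0 \<odot> p \<oplus> y" using assms(1,2) by auto
      then show ?thesis using subsetD[OF lspan_incl y] unfolding V_def by blast
    qed
  qed
  ultimately have "lspan A (insert p G) \<subseteq> V" by (rule lspan_least)
  then show thesis using assms(3) that by (auto simp: V_def)
qed

lemma antitone_bool_stabilizes:
  assumes "\<And>r s. \<lbrakk>r \<le> s; Q s\<rbrakk> \<Longrightarrow> Q r"
  shows "\<exists>N. \<forall>r\<ge>N. Q r = Q (N::nat)"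
proof (cases "\<forall>r. Q r")
  case False
  then obtain N where "\<not> Q N" by blast
  then show ?thesis using assms by (intro exI[of _ N]) blast
qed auto

text \<open>Induction on the spanning set, in place of a dimension count. Given a new vector \<open>p\<close>, the traces of
  \<open>W r\<close> on the old span stabilize by induction, and whether \<open>W r\<close> contains some \<open>p + g\<close> with
  \<open>g\<close> in the old span can change only once. Where both are constant, so is \<open>W r\<close>: subtract a multiple of
  such an element.\<close>

lemma submodule_chain_stabilizes:
  assumes "finite G" "G \<subseteq> carrier A" "\<And>r. submodule (W r) complex_ring A"
    "\<And>r. W r \<subseteq> lspan A G" "\<And>r s. r \<le> s \<Longrightarrow> W s \<subseteq> W r"
  shows "\<exists>N. \<forall>r\<ge>N. W r = W (N::nat)"
  using assms
proof (induction G arbitrary: W rule: finite_induct)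
  case empty
  have "lspan A {} \<subseteq> {\<zero>}"
    by (rule lspan_least) (auto simp: submodule_iff)
  moreover have "\<zero> \<in> W r" for r by (rule submoduleD(2)[OF empty.prems(2)])
  ultimately have "W r = {\<zero>}" for r using empty.prems(3)[of r] by blast
  then show ?case by blast
next
  case (insert p G)
  have p: "p \<in> carrier A" and G: "G \<subseteq> carrier A" using insert.prems(1) by auto
  note sG = lspan_submodule[OF G]
  note W = insert.prems(2)
  have "\<exists>N. \<forall>r\<ge>N. W r \<inter> lspan A G = W N \<inter> lspan A G"
  proof (rule insert.IH[OF G])
    show "submodule (W r \<inter> lspan A G) complex_ring A" for r
      using submodule_Inter[of "{W r, lspan A G}"] W sG by auto
    show "W s \<inter> lspan A G \<subseteq> W r \<inter> lspan A G" if "r \<le> s" for r s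
      using insert.prems(4)[OF that] by blast
  qed simp
  then obtain N1 where N1: "\<And>r. N1 \<le> r \<Longrightarrow> W r \<inter> lspan A G = W N1 \<inter> lspan A G" by blast
  define Q where "Q r \<longleftrightarrow> (\<exists>g\<in>lspan A G. p \<oplus> g \<in> W r)" for r
  have "\<exists>N. \<forall>r\<ge>N. Q r = Q N"
    by (rule antitone_bool_stabilizes) (use insert.prems(4) in \<open>unfold Q_def, blast\<close>)
  then obtain N2 where N2: "\<And>r. N2 \<le> r \<Longrightarrow> Q r = Q N2" by blast
  define N where "N = max N1 N2"
  have "W N \<subseteq> W r" if r: "N \<le> r" for r
  proof
    fix w assume w: "w \<in> W N"
    then obtain c g where cg: "g \<in> lspan A G" "w = c \<odot> p \<oplus> g"
      using lspan_insert[OF p G] insert.prems(3) by blast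
    note gA = submoduleD(1)[OF sG cg(1)]
    have wA: "w \<in> carrier A" using submoduleD(1)[OF W w] .
    have both: "W N \<inter> lspan A G = W r \<inter> lspan A G"
      using N1[of N] N1[of r] r by (simp add: N_def)
    show "w \<in> W r"
    proof (cases "c = 0")
      case True
      then have "w = g" using cg(2) p gA by simp
      then show ?thesis using both w cg(1) by blast
    next
      case False
      have "(1/c) \<odot> w = p \<oplus> (1/c) \<odot> g"
        using cg(2) p gA False by (simp add: smult_add_r)
      then have "Q N"
        unfolding Q_def using submoduleD(4)[OF W w, of "1/c"] submoduleD(4)[OF sG cg(1), of "1/c"] by metis
      then have "Q r" using N2[of N] N2[of r] r by (simp add: N_def)
      then obtain h where h: "h \<in> lspan A G" "p \<oplus> h \<in> W r" by (auto simp: Q_def)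
      note hA = submoduleD(1)[OF sG h(1)]
      have "p \<oplus> h \<in> W N" using h(2) insert.prems(4)[OF r] by blast
      then have d1: "w \<oplus> (- c) \<odot> (p \<oplus> h) \<in> W N"
        by (intro submoduleD(3)[OF W w] submoduleD(4)[OF W])
      have "w \<oplus> (- c) \<odot> (p \<oplus> h) = (c \<odot> p \<oplus> (- c) \<odot> p) \<oplus> (g \<oplus> (- c) \<odot> h)"
        using cg(2) p gA hA by (simp add: smult_add_r M.add.m_ac)
      also have "\<dots> = g \<oplus> (- c) \<odot> h" using p gA hA smult_add_l[OF p, of c "- c"] by simp
      finally have "w \<oplus> (- c) \<odot> (p \<oplus> h) \<in> lspan A G"
        using submoduleD(3)[OF sG cg(1) submoduleD(4)[OF sG h(1)]] by simp
      with d1 both have "w \<oplus> (- c) \<odot> (p \<oplus> h) \<in> W r" by blast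
      then have "(w \<oplus> (- c) \<odot> (p \<oplus> h)) \<oplus> c \<odot> (p \<oplus> h) \<in> W r"
        by (rule submoduleD(3)[OF W _ submoduleD(4)[OF W h(2)]])
      moreover have "(w \<oplus> (- c) \<odot> (p \<oplus> h)) \<oplus> c \<odot> (p \<oplus> h) = w"
        using wA p hA smult_add_l[of "p \<oplus> h" "- c" c] by (simp add: M.add.m_assoc)
      ultimately show ?thesis by simp
    qed
  qed
  then have "\<forall>r\<ge>N. W r = W N" using insert.prems(4) by blast
  then show ?case by blast
qed

end

section \<open>Elements that normalize a level\<close>

context cuntz_krieger
begin

abbreviation F :: "nat \<Rightarrow> 'a set" where "F \<equiv> F_level E A P S"

lemma F_gen_in: "{Sp \<mu> \<otimes> adj (Sp \<nu>) | \<mu> \<nu>. \<mu> \<in> pathn m \<and> \<nu> \<in> pathn m} \<subseteq> carrier A"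
  by auto

lemma F_in: "w \<in> F m \<Longrightarrow> w \<in> carrier A"
  unfolding F_level_def using submoduleD(1)[OF lspan_submodule[OF F_gen_in]] .

lemma F_least:
  assumes "submodule V complex_ring A"
    and "\<And>\<mu> \<nu>. \<lbrakk>\<mu> \<in> pathn m; \<nu> \<in> pathn m\<rbrakk> \<Longrightarrow> Sp \<mu> \<otimes> adj (Sp \<nu>) \<in> V"
  shows "F m \<subseteq> V"
  unfolding F_level_def by (rule lspan_least[OF assms(1)]) (auto simp: assms(2))

lemma F_adj:
  assumes "w \<in> F m"
  shows "adj w \<in> F m"
proof -
  note F = lspan_submodule[OF F_gen_in[of m], folded F_level_def]
  have "submodule {w \<in> carrier A. adj w \<in> F m} complex_ring A"
    unfolding submodule_iff using submoduleD(2,3,4)[OF F] by (auto simp: adj_add adj_smult)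
  then have "F m \<subseteq> {w \<in> carrier A. adj w \<in> F m}"
  proof (rule F_least)
    fix \<mu> \<nu> assume *: "\<mu> \<in> pathn m" "\<nu> \<in> pathn m"
    have "Sp \<nu> \<otimes> adj (Sp \<mu>) \<in> F m"
      unfolding F_level_def by (rule subsetD[OF lspan_incl]) (use * in blast)
    then show "Sp \<mu> \<otimes> adj (Sp \<nu>) \<in> {w \<in> carrier A. adj w \<in> F m}"
      using * by (simp add: adj_mult)
  qed
  then show ?thesis using assms by auto
qed

text \<open>The entries of the matrix of \<open>w \<in> F\<^sup>m\<close> with respect to the paths of length \<open>m\<close> are scalars, up to the
  final projection of the column.\<close>

lemma F_matrix_entry:
  assumes "w \<in> F m" "\<mu> \<in> pathn m" "\<nu> \<in> pathn m"
  shows "\<exists>c. adj (Sp \<mu>) \<otimes> w \<otimes> Sp \<nu> = c \<odot> (adj (Sp \<nu>) \<otimes> Sp \<nu>)"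
proof -
  let ?p = "adj (Sp \<nu>) \<otimes> Sp \<nu>"
  define V where "V = {w \<in> carrier A. \<exists>c. adj (Sp \<mu>) \<otimes> w \<otimes> Sp \<nu> = c \<odot> ?p}"
  have p: "?p \<in> carrier A" "Sp \<mu> \<in> carrier A" "Sp \<nu> \<in> carrier A" using assms(2,3) by auto
  have "submodule V complex_ring A"
    unfolding submodule_iff
  proof (intro conjI ballI allI)
    show "\<zero> \<in> V" using p by (auto simp: V_def intro!: exI[of _ 0])
    fix x y c assume "x \<in> V"
    then obtain a where a: "x \<in> carrier A" "adj (Sp \<mu>) \<otimes> x \<otimes> Sp \<nu> = a \<odot> ?p" by (auto simp: V_def)
    show "c \<odot> x \<in> V"
      using a p by (auto simp: V_def smult_mult_l smult_mult_r intro!: exI[of _ "c * a"])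
    assume "y \<in> V"
    then obtain b where b: "y \<in> carrier A" "adj (Sp \<mu>) \<otimes> y \<otimes> Sp \<nu> = b \<odot> ?p" by (auto simp: V_def)
    show "x \<oplus> y \<in> V"
      using a b p by (auto simp: V_def mult_l_distr mult_r_distr smult_add_l intro!: exI[of _ "a + b"])
  qed (auto simp: V_def)
  then have "F m \<subseteq> V"
  proof (rule F_least)
    fix \<alpha> \<beta> assume \<alpha>\<beta>: "\<alpha> \<in> pathn m" "\<beta> \<in> pathn m"
    obtain v where v: "v \<in> verts E" "adj (Sp \<mu>) \<otimes> Sp \<mu> = P v" by (rule Sp_final[OF assms(2)])
    obtain v' where v': "v' \<in> verts E" "?p = P v'" by (rule Sp_final[OF assms(3)])
    have prod: "adj (Sp \<mu>) \<otimes> (Sp \<alpha> \<otimes> adj (Sp \<beta>)) \<otimes> Sp \<nu> = (adj (Sp \<mu>) \<otimes> Sp \<alpha>) \<otimes> (adj (Sp \<beta>) \<otimes> Sp \<nu>)"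
      using p \<alpha>\<beta> by (simp add: mult_assoc)
    have "\<exists>c. adj (Sp \<mu>) \<otimes> (Sp \<alpha> \<otimes> adj (Sp \<beta>)) \<otimes> Sp \<nu> = c \<odot> P v'"
    proof (cases "\<alpha> = \<mu> \<and> \<beta> = \<nu>")
      case True
      then have "adj (Sp \<mu>) \<otimes> (Sp \<alpha> \<otimes> adj (Sp \<beta>)) \<otimes> Sp \<nu> = (if v = v' then 1 else 0) \<odot> P v'"
        unfolding prod using v v' by (simp add: P_mult_P)
      then show ?thesis by blast
    next
      case False
      then have "adj (Sp \<mu>) \<otimes> (Sp \<alpha> \<otimes> adj (Sp \<beta>)) \<otimes> Sp \<nu> = 0 \<odot> P v'"
        unfolding prod using adj_Sp_mult_Sp_zero[OF assms(2) \<alpha>\<beta>(1)] adj_Sp_mult_Sp_zero[OF \<alpha>\<beta>(2) assms(3)]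
          p \<alpha>\<beta> v'(1) by auto
      then show ?thesis by blast
    qed
    then show "Sp \<alpha> \<otimes> adj (Sp \<beta>) \<in> V"
      unfolding V_def v'(2) using \<alpha>\<beta> by simp
  qed
  then show ?thesis using assms(1) by (auto simp: V_def)
qed

lemma D_off_diagonal:
  assumes "x \<in> D m" "\<mu> \<in> pathn m" "\<nu> \<in> pathn m" "\<mu> \<noteq> \<nu>"
  shows "adj (Sp \<mu>) \<otimes> x \<otimes> Sp \<nu> = \<zero>"
proof -
  have "adj (Sp \<mu>) \<otimes> x \<otimes> Sp \<nu> \<in> {\<zero>}"
  proof (rule D_sandwich[OF assms(1)])
    fix \<alpha> assume \<alpha>: "\<alpha> \<in> pathn m"
    have "adj (Sp \<mu>) \<otimes> Pp \<alpha> \<otimes> Sp \<nu> = (adj (Sp \<mu>) \<otimes> Sp \<alpha>) \<otimes> (adj (Sp \<alpha>) \<otimes> Sp \<nu>)"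
      using assms \<alpha> by (simp add: P_path_def mult_assoc)
    also have "\<dots> = \<zero>"
      using adj_Sp_mult_Sp_zero[OF assms(2) \<alpha>] adj_Sp_mult_Sp_zero[OF \<alpha> assms(3)] assms \<alpha>
      by (cases "\<alpha> = \<mu>") auto
    finally show "adj (Sp \<mu>) \<otimes> Pp \<alpha> \<otimes> Sp \<nu> \<in> {\<zero>}" by simp
  qed (use assms in \<open>auto simp: submodule_iff\<close>)
  then show ?thesis by simp
qed

text \<open>Only paths \<open>\<beta>\<close> of length \<open>m\<close> followed by some \<open>x \<in> D\<^sup>j\<close> have to be considered. The blocks of
  \<open>y = w S\<^sub>\<beta> x S\<^sub>\<beta>\<^sup>* w\<^sup>*\<close> are \<open>a\<^sub>\<alpha> cnj(a\<^sub>\<gamma>) P\<^sub>v x P\<^sub>v\<close>, with the scalars \<open>a\<^sub>\<alpha>\<close> of the column of \<open>w\<close> at \<open>\<beta>\<close>. Those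
  of \<open>w P\<^sub>\<beta> w\<^sup>* \<in> D\<^sup>m\<close> are \<open>a\<^sub>\<alpha> cnj(a\<^sub>\<gamma>) P\<^sub>v\<close> and vanish off the diagonal; hence so do those of \<open>y\<close>.\<close>

lemma conjugation_preserves_D:
  assumes w: "w \<in> F m" and norm: "\<And>x. x \<in> D m \<Longrightarrow> w \<otimes> x \<otimes> adj w \<in> D m"
    and x: "x \<in> D (m + j)"
  shows "w \<otimes> x \<otimes> adj w \<in> D (m + j)"
proof -
  have wA: "w \<in> carrier A" using F_in[OF w] .
  define V where "V = {x \<in> carrier A. w \<otimes> x \<otimes> adj w \<in> D (m + j)}"
  have "submodule V complex_ring A"
    unfolding V_def submodule_iff using wA D_zero D_add D_smult
    by (auto simp: mult_l_distr mult_r_distr smult_mult_l smult_mult_r)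
  then have "D (m + j) \<subseteq> V"
  proof (rule D_add_least)
    fix \<beta> x assume \<beta>: "\<beta> \<in> pathn m" and x: "x \<in> D j"
    have xA: "x \<in> carrier A" using D_in[OF x] .
    obtain v where v: "v \<in> verts E" "adj (Sp \<beta>) \<otimes> Sp \<beta> = P v" by (rule Sp_final[OF \<beta>])
    define y where "y = w \<otimes> (Sp \<beta> \<otimes> x \<otimes> adj (Sp \<beta>)) \<otimes> adj w"
    have yA: "y \<in> carrier A" using wA xA \<beta> by (simp add: y_def)
    have entry: "\<exists>a. adj (Sp \<alpha>) \<otimes> w \<otimes> Sp \<beta> = a \<odot> P v" if "\<alpha> \<in> pathn m" for \<alpha>
      using F_matrix_entry[OF w that \<beta>] v(2) by simp
    then obtain a where a: "\<And>\<alpha>. \<alpha> \<in> pathn m \<Longrightarrow> adj (Sp \<alpha>) \<otimes> w \<otimes> Sp \<beta> = a \<alpha> \<odot> P v"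
      by metis
    have a': "adj (Sp \<beta>) \<otimes> adj w \<otimes> Sp \<alpha> = cnj (a \<alpha>) \<odot> P v" if \<alpha>: "\<alpha> \<in> pathn m" for \<alpha>
    proof -
      have "adj (Sp \<beta>) \<otimes> adj w \<otimes> Sp \<alpha> = adj (adj (Sp \<alpha>) \<otimes> w \<otimes> Sp \<beta>)"
        using \<alpha> \<beta> wA by (simp add: adj_mult mult_assoc)
      then show ?thesis using a[OF \<alpha>] v(1) by (simp add: adj_smult)
    qed
    have block: "adj (Sp \<alpha>) \<otimes> (w \<otimes> (Sp \<beta> \<otimes> z \<otimes> adj (Sp \<beta>)) \<otimes> adj w) \<otimes> Sp \<gamma> = (a \<alpha> * cnj (a \<gamma>)) \<odot> (P v \<otimes> z \<otimes> P v)"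
      if "\<alpha> \<in> pathn m" "\<gamma> \<in> pathn m" "z \<in> carrier A" for \<alpha> \<gamma> z
    proof -
      have "adj (Sp \<alpha>) \<otimes> (w \<otimes> (Sp \<beta> \<otimes> z \<otimes> adj (Sp \<beta>)) \<otimes> adj w) \<otimes> Sp \<gamma> =
          (adj (Sp \<alpha>) \<otimes> w \<otimes> Sp \<beta>) \<otimes> z \<otimes> (adj (Sp \<beta>) \<otimes> adj w \<otimes> Sp \<gamma>)"
        using that \<beta> wA by (simp add: mult_assoc)
      also have "\<dots> = (a \<alpha> * cnj (a \<gamma>)) \<odot> (P v \<otimes> z \<otimes> P v)"
        unfolding a[OF that(1)] a'[OF that(2)]
        using that(3) v(1) by (simp add: smult_mult_l smult_mult_r mult.commute)
      finally show ?thesis .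
    qed
    have PxP: "P v \<otimes> x \<otimes> P v \<in> D j"
      using D_mult_comm(1)[OF D_mult_comm(1)[OF P_in_D[OF v(1)] x] P_in_D[OF v(1)]] .
    have off: "adj (Sp \<alpha>) \<otimes> y \<otimes> Sp \<gamma> = \<zero>" if ag: "\<alpha> \<in> pathn m" "\<gamma> \<in> pathn m" "\<alpha> \<noteq> \<gamma>" for \<alpha> \<gamma>
    proof -
      have "(a \<alpha> * cnj (a \<gamma>)) \<odot> (P v \<otimes> \<one> \<otimes> P v) = adj (Sp \<alpha>) \<otimes> (w \<otimes> Pp \<beta> \<otimes> adj w) \<otimes> Sp \<gamma>"
        using block[OF ag(1,2) one_in] \<beta> by (simp add: P_path_def)
      also have "\<dots> = \<zero>" by (rule D_off_diagonal[OF norm[OF Pp_in_D[OF \<beta>]] ag])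
      finally have zero: "(a \<alpha> * cnj (a \<gamma>)) \<odot> P v = \<zero>" using v(1) by (simp add: P_idem)
      have "adj (Sp \<alpha>) \<otimes> y \<otimes> Sp \<gamma> = (a \<alpha> * cnj (a \<gamma>)) \<odot> (P v \<otimes> x \<otimes> P v)"
        unfolding y_def by (rule block[OF ag(1,2) xA])
      also have "\<dots> = ((a \<alpha> * cnj (a \<gamma>)) \<odot> P v) \<otimes> x \<otimes> P v"
        using v(1) xA by (simp add: smult_mult_l)
      finally show ?thesis unfolding zero using v(1) xA by simp
    qed
    have "y = (\<Oplus>\<alpha>\<in>pathn m. Sp \<alpha> \<otimes> (adj (Sp \<alpha>) \<otimes> y \<otimes> Sp \<alpha>) \<otimes> adj (Sp \<alpha>))"
      by (rule block_diagonal[OF finite_pathn _ sum_Pp yA off]) auto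
    also have "\<dots> \<in> D (m + j)"
    proof (rule D_finsum)
      fix \<alpha> assume \<alpha>: "\<alpha> \<in> pathn m"
      have "adj (Sp \<alpha>) \<otimes> y \<otimes> Sp \<alpha> \<in> D j"
        unfolding y_def block[OF \<alpha> \<alpha> xA] by (rule D_smult[OF PxP])
      then show "Sp \<alpha> \<otimes> (adj (Sp \<alpha>) \<otimes> y \<otimes> Sp \<alpha>) \<otimes> adj (Sp \<alpha>) \<in> D (m + j)"
        using \<alpha> by (rule D_path_extend)
    qed
    finally show "Sp \<beta> \<otimes> x \<otimes> adj (Sp \<beta>) \<in> V"
      using \<beta> xA by (simp add: V_def y_def)
  qed
  then show ?thesis using x by (auto simp: V_def)
qed

text \<open>Fed to the universal property, this family yields \<open>\<lambda>\<^sub>u\<close>.\<close>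

lemma ck_family_twist:
  assumes u: "u \<in> carrier A" "adj u \<otimes> u = \<one>" "u \<otimes> adj u = \<one>"
    and comm: "\<And>v. v \<in> verts E \<Longrightarrow> u \<otimes> P v = P v \<otimes> u"
  shows "ck_family E A P (\<lambda>e. u \<otimes> S e)"
  unfolding ck_family_def
proof (intro conjI ballI impI)
  have cancel: "adj u \<otimes> (u \<otimes> x) = x" "u \<otimes> (adj u \<otimes> x) = x" if "x \<in> carrier A" for x
    using that u mult_assoc[of "adj u" u x] mult_assoc[of u "adj u" x] by simp_all
  have conj_P: "u \<otimes> P v \<otimes> adj u = P v" if "v \<in> verts E" for v
    using that u comm[OF that] by (simp add: mult_assoc)
  have conj_q: "u \<otimes> S e \<otimes> adj (u \<otimes> S e) = u \<otimes> (S e \<otimes> adj (S e)) \<otimes> adj u" if "e \<in> arcs E" for e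
    using that u by (simp add: adj_mult mult_assoc)
  show "is_projection A (P v)" if "v \<in> verts E" for v by (rule P_projection[OF that])
  show "P v \<otimes> P w = \<zero>" if "v \<in> verts E" "w \<in> verts E" "v \<noteq> w" for v w
    using that by (simp add: P_mult_P)
  show "is_partial_isometry A (u \<otimes> S e)" if "e \<in> arcs E" for e
    using that u(1) by (simp add: is_partial_isometry_def adj_mult mult_assoc cancel adj_S_mult_S S_mult_P)
  show "adj (u \<otimes> S e) \<otimes> (u \<otimes> S e) = P (head E e)" if "e \<in> arcs E" for e
    using that u(1) by (simp add: adj_mult mult_assoc cancel adj_S_mult_S)
  show "adj (u \<otimes> S e) \<otimes> (u \<otimes> S f) = \<zero>" if "e \<in> arcs E" "f \<in> arcs E" "e \<noteq> f" for e f
    using that u(1) by (simp add: adj_mult mult_assoc cancel adj_S_mult_S)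
  show "cle A (u \<otimes> S e \<otimes> adj (u \<otimes> S e)) (P (tail E e))" if e: "e \<in> arcs E" for e
  proof -
    have "cle A (S e \<otimes> adj (S e)) (P (tail E e))" by (rule ck_familyD(6)[OF family e])
    then obtain y where y: "y \<in> carrier A" "P (tail E e) \<ominus> S e \<otimes> adj (S e) = adj y \<otimes> y"
      unfolding cle_def by blast
    have "P (tail E e) \<ominus> u \<otimes> S e \<otimes> adj (u \<otimes> S e) = u \<otimes> P (tail E e) \<otimes> adj u \<ominus> u \<otimes> (S e \<otimes> adj (S e)) \<otimes> adj u"
      using conj_P[of "tail E e"] conj_q[OF e] e by simp
    also have "\<dots> = u \<otimes> (P (tail E e) \<ominus> S e \<otimes> adj (S e)) \<otimes> adj u"
      using e u(1) by (simp add: mult_diff_r mult_diff_l)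
    also have "\<dots> = adj (y \<otimes> adj u) \<otimes> (y \<otimes> adj u)"
      unfolding y(2) using y(1) u(1) by (simp add: adj_mult mult_assoc)
    finally have "\<exists>x\<in>carrier A. P (tail E e) \<ominus> u \<otimes> S e \<otimes> adj (u \<otimes> S e) = adj x \<otimes> x"
      using y(1) u(1) by (intro bexI[of _ "y \<otimes> adj u"]) auto
    then show ?thesis
      using e u(1) by (simp add: cle_def adj_mult mult_assoc)
  qed
  show "P v = (\<Oplus>e\<in>out_arcs E v. u \<otimes> S e \<otimes> adj (u \<otimes> S e))" if v: "v \<in> verts E" for v
  proof -
    have in_A: "S e \<otimes> adj (S e) \<in> carrier A" if "e \<in> out_arcs E v" for e
      using that by (simp add: out_arcs_def)
    have "P v = u \<otimes> (\<Oplus>e\<in>out_arcs E v. S e \<otimes> adj (S e)) \<otimes> adj u"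
      using conj_P[OF v] by (simp add: P_eq_sum[OF v, symmetric])
    also have "\<dots> = (\<Oplus>e\<in>out_arcs E v. u \<otimes> (S e \<otimes> adj (S e))) \<otimes> adj u"
      by (rule arg_cong[of _ _ "\<lambda>z. z \<otimes> adj u"], rule finsum_mult_r[OF u(1) in_A])
    also have "\<dots> = (\<Oplus>e\<in>out_arcs E v. u \<otimes> (S e \<otimes> adj (S e)) \<otimes> adj u)"
      using u(1) in_A by (intro finsum_mult_l) auto
    also have "\<dots> = (\<Oplus>e\<in>out_arcs E v. u \<otimes> S e \<otimes> adj (u \<otimes> S e))"
      using u(1) by (intro finsum_cong) (auto simp: out_arcs_def conj_q)
    finally show ?thesis .
  qed
qed

lemma star_hom_fixes_D0:
  assumes \<psi>: "star_hom A A \<psi>" and P: "\<And>v. v \<in> verts E \<Longrightarrow> \<psi> (P v) = P v" and x: "x \<in> D 0"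
  shows "\<psi> x = x"
proof -
  note h = star_homD[OF \<psi>]
  have "submodule {x \<in> carrier A. \<psi> x = x} complex_ring A"
    unfolding submodule_iff using h(3)[of \<zero> 0] h(1)[of \<zero>] by (auto simp: h(2,3))
  then have "D 0 \<subseteq> {x \<in> carrier A. \<psi> x = x}"
    by (rule D0_least) (simp add: P)
  then show ?thesis using x by auto
qed

lemma star_hom_fixes_one:
  "\<lbrakk>star_hom A A \<psi>; \<forall>v\<in>verts E. \<psi> (P v) = P v\<rbrakk> \<Longrightarrow> \<psi> \<one> = \<one>"
  by (rule star_hom_fixes_D0[OF _ _ one_in_D]) auto

end

section \<open>The endomorphism on the diagonal\<close>

locale localized_endomorphism = cuntz_krieger A E P S
  for A :: "'a cstar" (structure) and E :: "('v, 'e) pre_digraph" and P :: "'v \<Rightarrow> 'a" and S :: "'e \<Rightarrow> 'a" +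
  fixes u :: 'a and k :: nat
  assumes k: "k \<ge> 1" and u_F: "u \<in> F_level E A P S k"
    and u_unitary: "adj u \<otimes> u = \<one>" "u \<otimes> adj u = \<one>"
    and u_P: "v \<in> verts E \<Longrightarrow> u \<otimes> P v = P v \<otimes> u"
    and u_normalizes: "(\<lambda>x. u \<otimes> x \<otimes> adj u) ` D_level E A P S k = D_level E A P S k"
    and endo_hom: "star_hom A A (graph_endo E A P S u)"
    and endo_S: "e \<in> arcs E \<Longrightarrow> graph_endo E A P S u (S e) = u \<otimes> S e"
    and endo_P: "v \<in> verts E \<Longrightarrow> graph_endo E A P S u (P v) = P v"
begin

abbreviation \<phi> :: "'a \<Rightarrow> 'a" where "\<phi> \<equiv> graph_endo E A P S u"

abbreviation X :: "nat \<Rightarrow> 'a set" where "X \<equiv> Xi_seq E A P S k u"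

lemmas \<phi>_in [simp] = star_homD(1)[OF endo_hom]
  and \<phi>_add = star_homD(2)[OF endo_hom]
  and \<phi>_smult = star_homD(3)[OF endo_hom]
  and \<phi>_mult = star_homD(4)[OF endo_hom]
  and \<phi>_adj = star_homD(5)[OF endo_hom]

lemma u_in [simp, intro]: "u \<in> carrier A"
  by (rule F_in[OF u_F])

lemma unitary_cancel: "x \<in> carrier A \<Longrightarrow> adj u \<otimes> (u \<otimes> x) = x" "x \<in> carrier A \<Longrightarrow> u \<otimes> (adj u \<otimes> x) = x"
  by (simp_all add: u_unitary flip: mult_assoc)

lemma conj_D:
  assumes "x \<in> D m" "k \<le> m"
  shows "u \<otimes> x \<otimes> adj u \<in> D m"
  using conjugation_preserves_D[OF u_F, of x "m - k"] u_normalizes assms by auto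

lemma conj_adj_D:
  assumes "x \<in> D m" "k \<le> m"
  shows "adj u \<otimes> x \<otimes> u \<in> D m"
proof -
  have norm: "adj u \<otimes> x \<otimes> adj (adj u) \<in> D k" if x: "x \<in> D k" for x
  proof -
    obtain y where y: "y \<in> D k" "x = u \<otimes> y \<otimes> adj u"
      using x u_normalizes by blast
    have yA: "y \<in> carrier A" using D_in[OF y(1)] .
    have "adj u \<otimes> x \<otimes> adj (adj u) = y"
      unfolding y(2) using yA by (simp add: mult_assoc unitary_cancel u_unitary)
    then show ?thesis using y(1) by simp
  qed
  have "adj u \<otimes> x \<otimes> adj (adj u) \<in> D (k + (m - k))"
    by (rule conjugation_preserves_D[OF F_adj[OF u_F] norm]) (use assms in simp_all)
  then show ?thesis using assms by simp
qed

lemma D0_comm_u: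
  assumes "x \<in> D 0"
  shows "u \<otimes> x = x \<otimes> u"
proof -
  have "submodule {x \<in> carrier A. u \<otimes> x = x \<otimes> u} complex_ring A"
    unfolding submodule_iff
    by (auto simp: mult_l_distr mult_r_distr smult_mult_l smult_mult_r)
  then have "D 0 \<subseteq> {x \<in> carrier A. u \<otimes> x = x \<otimes> u}"
    by (rule D0_least) (simp add: u_P)
  then show ?thesis using assms by auto
qed

lemma \<phi>_D0: "x \<in> D 0 \<Longrightarrow> \<phi> x = x"
  by (rule star_hom_fixes_D0[OF endo_hom endo_P])

lemma \<phi>_zero: "\<phi> \<zero> = \<zero>"
  by (rule \<phi>_D0[OF D_zero])

lemma \<phi>_extend:
  assumes "e \<in> arcs E" "x \<in> carrier A"
  shows "\<phi> (S e \<otimes> x \<otimes> adj (S e)) = u \<otimes> (S e \<otimes> \<phi> x \<otimes> adj (S e)) \<otimes> adj u"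
  using assms by (simp add: \<phi>_mult \<phi>_adj endo_S adj_mult mult_assoc)

lemma \<phi>_preimage_submodule:
  assumes "submodule V complex_ring A"
  shows "submodule {x \<in> carrier A. \<phi> x \<in> V} complex_ring A"
  unfolding submodule_iff using submoduleD(2-4)[OF assms] by (auto simp: \<phi>_add \<phi>_smult \<phi>_zero)

lemma \<phi>_image_submodule:
  assumes V: "submodule V complex_ring A"
  shows "submodule (\<phi> ` V) complex_ring A"
  unfolding submodule_iff
proof (intro conjI ballI allI)
  show "\<phi> ` V \<subseteq> carrier A" using submoduleD(1)[OF V] by auto
  show "\<zero> \<in> \<phi> ` V" using submoduleD(2)[OF V] \<phi>_zero by (metis imageI)
  fix x y c assume "x \<in> \<phi> ` V"
  then obtain a where a: "a \<in> V" "x = \<phi> a" by auto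
  have "c \<odot> x = \<phi> (c \<odot> a)" using a submoduleD(1)[OF V] by (simp add: \<phi>_smult)
  then show "c \<odot> x \<in> \<phi> ` V" using submoduleD(4)[OF V a(1)] by auto
  assume "y \<in> \<phi> ` V"
  then obtain b where b: "b \<in> V" "y = \<phi> b" by auto
  have "x \<oplus> y = \<phi> (a \<oplus> b)" using a b submoduleD(1)[OF V] by (simp add: \<phi>_add)
  then show "x \<oplus> y \<in> \<phi> ` V" using submoduleD(3)[OF V a(1) b(1)] by auto
qed

text \<open>In \<open>\<phi>(S\<^sub>e x S\<^sub>e\<^sup>*) = u (S\<^sub>e \<phi>(x) S\<^sub>e\<^sup>*) u\<^sup>*\<close> the inner term has level at least \<open>k\<close>, and conjugation by \<open>u\<close>
  preserves such levels; the summand \<open>k\<close> makes this true from the first step on.\<close>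

lemma \<phi>_D: "x \<in> D m \<Longrightarrow> \<phi> x \<in> D (m + k)"
proof (induction m arbitrary: x)
  case 0
  then show ?case using \<phi>_D0[OF 0] D_mono[of 0 k] by auto
next
  case (Suc m)
  have "D (Suc m) \<subseteq> {x \<in> carrier A. \<phi> x \<in> D (Suc m + k)}"
  proof (rule D_Suc_least[OF \<phi>_preimage_submodule[OF D_submodule]])
    fix e x assume e: "e \<in> arcs E" and x: "x \<in> D m"
    have "u \<otimes> (S e \<otimes> \<phi> x \<otimes> adj (S e)) \<otimes> adj u \<in> D (Suc (m + k))"
      by (rule conj_D[OF D_extend[OF Suc.IH[OF x] e]]) simp
    then show "S e \<otimes> x \<otimes> adj (S e) \<in> {x \<in> carrier A. \<phi> x \<in> D (Suc m + k)}"
      using e D_in[OF x] by (simp add: \<phi>_extend)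
  qed
  then show ?case using Suc.prems by auto
qed

lemma \<phi>_Dfin: "x \<in> Dfin \<Longrightarrow> \<phi> x \<in> Dfin"
  by (auto simp: Dfin_def intro: \<phi>_D)

lemma \<phi>_conv:
  assumes "conv \<sigma> x"
  shows "conv (\<lambda>n. \<phi> (\<sigma> n)) (\<phi> x)"
proof (rule conv_sandwich)
  note [simp] = convD(1,2)[OF assms]
  show "nrm (\<phi> (\<sigma> n) \<ominus> \<phi> x) \<le> nrm (\<sigma> n \<ominus> x)" for n
  proof -
    have "\<phi> (\<sigma> n) \<ominus> \<phi> x = \<phi> (\<sigma> n \<ominus> x)" by (simp add: diff_eq_smult \<phi>_add \<phi>_smult)
    then show ?thesis using star_hom_contractive[OF cstar_algebra_axioms endo_hom, of "\<sigma> n \<ominus> x"] by simp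
  qed
  show "(\<lambda>n. nrm (\<sigma> n \<ominus> x)) \<longlonglongrightarrow> 0" by (rule convD(3)[OF assms])
qed (auto simp: convD[OF assms])

lemma \<phi>_D_alg:
  assumes "x \<in> DE"
  shows "\<phi> x \<in> DE"
proof -
  obtain \<sigma> where \<sigma>: "\<forall>n. \<sigma> n \<in> Dfin" "conv \<sigma> x" using assms by (rule D_alg_approx)
  show ?thesis
    unfolding D_alg_eq_closure
    by (rule seq_closureI[OF \<phi>_Dfin[OF \<sigma>(1)[rule_format]] \<phi>_conv[OF \<sigma>(2)]])
qed

text \<open>The projection \<open>P\<^sub>v = S\<^sub>\<mu>\<^sup>* P\<^sub>\<mu> S\<^sub>\<mu>\<close> is fixed by \<open>\<phi>\<close>, so it vanishes if \<open>\<phi>(P\<^sub>\<mu>)\<close> does, and with it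
  \<open>S\<^sub>\<mu> = S\<^sub>\<mu> P\<^sub>v\<close>.\<close>

lemma \<phi>_faithful_on_paths:
  assumes "\<mu> \<in> paths E" "\<phi> (Pp \<mu>) = \<zero>"
  shows "Pp \<mu> = \<zero>"
proof -
  obtain m where \<mu>: "\<mu> \<in> pathn m" using assms(1) by (auto simp: paths_UN)
  obtain v where v: "v \<in> verts E" "adj (Sp \<mu>) \<otimes> Sp \<mu> = P v" "Sp \<mu> \<otimes> P v = Sp \<mu>"
    by (rule Sp_final[OF \<mu>])
  have sA: "Sp \<mu> \<in> carrier A" using \<mu> by simp
  have "P v = P v \<otimes> P v" using v(1) by (simp add: P_idem)
  also have "\<dots> = (adj (Sp \<mu>) \<otimes> Sp \<mu>) \<otimes> (adj (Sp \<mu>) \<otimes> Sp \<mu>)" by (simp add: v(2))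
  also have "\<dots> = adj (Sp \<mu>) \<otimes> Pp \<mu> \<otimes> Sp \<mu>" using sA by (simp add: P_path_def mult_assoc)
  finally have "\<phi> (P v) = \<phi> (adj (Sp \<mu>) \<otimes> Pp \<mu> \<otimes> Sp \<mu>)" by simp
  also have "\<dots> = \<phi> (adj (Sp \<mu>)) \<otimes> \<phi> (Pp \<mu>) \<otimes> \<phi> (Sp \<mu>)" using \<mu> sA by (simp add: \<phi>_mult)
  also have "\<dots> = \<zero>" using assms(2) sA by simp
  finally have "P v = \<zero>" using endo_P[OF v(1)] by simp
  then have "Sp \<mu> = \<zero>" using v(3) sA by simp
  then show ?thesis by (simp add: P_path_def)
qed

lemma \<phi>_isometric:
  assumes "x \<in> DE"
  shows "nrm x \<le> nrm (\<phi> x)"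
  using star_hom_bounded_below_D_alg[OF endo_hom \<phi>_faithful_on_paths assms] by auto

lemma \<phi>_inj_on: "inj_on \<phi> (DE)"
proof (rule inj_onI)
  fix x y assume xy: "x \<in> DE" "y \<in> DE" "\<phi> x = \<phi> y"
  note sub = cstar_subalgebraD(1)[OF D_alg_subalgebra]
  note in_A = D_alg_in[OF xy(1)] D_alg_in[OF xy(2)]
  have "x \<ominus> y \<in> DE"
    using submoduleD(3)[OF sub xy(1) submoduleD(4)[OF sub xy(2)]] in_A by (simp add: diff_eq_smult)
  then have "nrm (x \<ominus> y) \<le> nrm (\<phi> (x \<ominus> y))" by (rule \<phi>_isometric)
  also have "\<phi> (x \<ominus> y) = \<phi> x \<ominus> \<phi> y" using in_A by (simp add: diff_eq_smult \<phi>_add \<phi>_smult)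
  also have "\<dots> = \<zero>" using xy(3) in_A by simp
  finally have "nrm (x \<ominus> y) = 0" using nrm_nonneg[of "x \<ominus> y"] in_A by simp
  then show "x = y" using nrm_eq_zero[of "x \<ominus> y"] in_A by (simp add: diff_eq_zero_iff)
qed

section \<open>The one-step maps and the sequence of subspaces\<close>

text \<open>The maps \<open>b\<^sup>u\<^sub>e\<^sub>,\<^sub>f\<close> without the restriction to \<open>D\<^sup>k\<^sup>-\<^sup>1\<close>, so that linearity holds on the whole algebra.\<close>

definition b :: "'e \<Rightarrow> 'e \<Rightarrow> 'a \<Rightarrow> 'a" where
  "b e f x = adj (S e) \<otimes> adj u \<otimes> x \<otimes> u \<otimes> S f"

lemma b_eq_compress: "\<lbrakk>e \<in> arcs E; f \<in> arcs E; x \<in> carrier A\<rbrakk> \<Longrightarrow> b e f x = adj (S e) \<otimes> (adj u \<otimes> x \<otimes> u) \<otimes> S f"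
  by (simp add: b_def mult_assoc)

lemma b_eq_\<phi>: "\<lbrakk>e \<in> arcs E; f \<in> arcs E; x \<in> carrier A\<rbrakk> \<Longrightarrow> b e f x = adj (\<phi> (S e)) \<otimes> x \<otimes> \<phi> (S f)"
  by (simp add: b_def mult_assoc adj_mult endo_S)

text \<open>On the range of \<open>\<phi>\<close> the one-step maps are conjugate to compression by edges, which lowers the level of
  a preimage.\<close>

lemma b_\<phi>:
  "\<lbrakk>e \<in> arcs E; f \<in> arcs E; z \<in> carrier A\<rbrakk> \<Longrightarrow> b e f (\<phi> z) = \<phi> (adj (S e) \<otimes> z \<otimes> S f)"
  by (simp add: b_eq_\<phi> \<phi>_mult \<phi>_adj)

lemma b_in [simp]: "\<lbrakk>e \<in> arcs E; f \<in> arcs E; x \<in> carrier A\<rbrakk> \<Longrightarrow> b e f x \<in> carrier A"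
  by (simp add: b_def)

lemma b_add: "\<lbrakk>e \<in> arcs E; f \<in> arcs E; x \<in> carrier A; y \<in> carrier A\<rbrakk> \<Longrightarrow> b e f (x \<oplus> y) = b e f x \<oplus> b e f y"
  by (simp add: b_def mult_l_distr mult_r_distr)

lemma b_smult: "\<lbrakk>e \<in> arcs E; f \<in> arcs E; x \<in> carrier A\<rbrakk> \<Longrightarrow> b e f (c \<odot> x) = c \<odot> b e f x"
  by (simp add: b_def smult_mult_l smult_mult_r)

lemma conj_adj_top:
  assumes "x \<in> D (k - 1)"
  shows "adj u \<otimes> x \<otimes> u \<in> D (Suc (k - 1))"
  using conj_adj_D[of x k] D_Suc_mono[of "k - 1"] assms k by auto

lemma b_D: "\<lbrakk>e \<in> arcs E; f \<in> arcs E; x \<in> D (k - 1)\<rbrakk> \<Longrightarrow> b e f x \<in> D (k - 1)"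
  using D_compress[OF conj_adj_top] D_in by (simp add: b_eq_compress)

lemma b_D0:
  assumes "e \<in> arcs E" "f \<in> arcs E" "x \<in> D 0"
  shows "b e f x \<in> D 0"
proof -
  have "adj u \<otimes> x \<otimes> u = x"
    using D_in[OF assms(3)] by (simp add: mult_assoc unitary_cancel flip: D0_comm_u[OF assms(3)])
  then show ?thesis using D0_compress[OF assms(3,1,2)] assms D_in[OF assms(3)] by (simp add: b_eq_compress)
qed

text \<open>The element \<open>u\<^sup>* x u\<close> lies in the commutative algebra \<open>D\<^sup>k\<close>, hence commutes with \<open>S\<^sub>e S\<^sub>e\<^sup>*\<close>, and
  \<open>S\<^sub>e\<^sup>* S\<^sub>f = 0\<close>.\<close>

lemma b_off_diagonal:
  assumes "e \<in> arcs E" "f \<in> arcs E" "e \<noteq> f" "x \<in> D (k - 1)"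
  shows "b e f x = \<zero>"
proof -
  define y where "y = adj u \<otimes> x \<otimes> u"
  have y: "y \<in> D (Suc (k - 1))" unfolding y_def by (rule conj_adj_top[OF assms(4)])
  note yA = D_in[OF y]
  define q where "q = S e \<otimes> adj (S e)"
  have "q \<in> D (Suc 0)"
    using D_extend[OF P_in_D0[of "head E e"] assms(1)] assms(1) by (simp add: q_def S_mult_P)
  then have q: "q \<in> D (Suc (k - 1))" using D_mono[of "Suc 0" "Suc (k - 1)"] by auto
  have "adj (S e) \<otimes> y = (adj (S e) \<otimes> q) \<otimes> y"
    using assms(1) by (simp add: q_def ck_rules)
  also have "\<dots> = adj (S e) \<otimes> (y \<otimes> q)"
    using D_mult_comm(2)[OF q y] D_in[OF q] yA assms(1) by (simp add: mult_assoc)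
  finally have "adj (S e) \<otimes> y \<otimes> S f = adj (S e) \<otimes> (y \<otimes> q) \<otimes> S f" by simp
  also have "\<dots> = \<zero>"
    using yA assms(1-3) by (simp add: q_def ck_rules)
  finally show ?thesis using b_eq_compress[OF assms(1,2) D_in[OF assms(4)]] by (simp add: y_def)
qed

abbreviation H :: "'a set" where "H \<equiv> lspan A (S ` arcs E)"

lemma H_in: "H \<subseteq> carrier A"
  by (rule lspan_least[OF carrier_submodule]) auto

text \<open>By bilinearity, elements of \<open>\<phi>(H)\<close> may be replaced by the \<open>\<phi>(S\<^sub>e)\<close>: \<open>X (r + 1)\<close> is the span of the
  values of the one-step maps on \<open>X r\<close>.\<close>

lemma X_Suc_least:
  assumes V: "submodule V complex_ring A" and sub: "X r \<subseteq> carrier A"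
    and step: "\<And>e f x. \<lbrakk>e \<in> arcs E; f \<in> arcs E; x \<in> X r\<rbrakk> \<Longrightarrow> b e f x \<in> V"
  shows "X (Suc r) \<subseteq> V"
proof -
  have right: "adj (\<phi> (S e)) \<otimes> x \<otimes> \<phi> h \<in> V"
    if e: "e \<in> arcs E" and x: "x \<in> X r" and h: "h \<in> H" for e x h
  proof -
    have xA: "x \<in> carrier A" "S e \<in> carrier A" using x e sub by auto
    have "S ` arcs E \<subseteq> carrier A" by auto
    with h show ?thesis
    proof (induction rule: lspan_induct)
      case zero
      then show ?case using xA submoduleD(2)[OF V] by (simp add: \<phi>_zero)
    next
      case (base y)
      then show ?case using step[OF e _ x] e xA by (auto simp flip: b_eq_\<phi>)
    next
      case (add y z)
      have "y \<in> carrier A" "z \<in> carrier A" using add H_in by auto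
      then show ?case using submoduleD(3)[OF V add(3,4)] xA by (simp add: \<phi>_add mult_r_distr)
    next
      case (smult c y)
      have "y \<in> carrier A" using smult H_in by auto
      then show ?case using submoduleD(4)[OF V smult(2), of c] xA by (simp add: \<phi>_smult smult_mult_r)
    qed
  qed
  have both: "adj (\<phi> g) \<otimes> x \<otimes> \<phi> h \<in> V"
    if g: "g \<in> H" and x: "x \<in> X r" and h: "h \<in> H" for g x h
  proof -
    have xA: "x \<in> carrier A" "h \<in> carrier A" using x h sub H_in by auto
    have "S ` arcs E \<subseteq> carrier A" by auto
    with g show ?thesis
    proof (induction rule: lspan_induct)
      case zero
      then show ?case using xA submoduleD(2)[OF V] by (simp add: \<phi>_zero)
    next
      case (base y)
      then show ?case using right[OF _ x h] by auto
    next
      case (add y z)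
      have "y \<in> carrier A" "z \<in> carrier A" using add H_in by auto
      then show ?case using submoduleD(3)[OF V add(3,4)] xA by (simp add: \<phi>_add adj_add mult_l_distr)
    next
      case (smult c y)
      have "y \<in> carrier A" using smult H_in by auto
      then show ?case using submoduleD(4)[OF V smult(2), of "cnj c"] xA by (simp add: \<phi>_smult adj_smult smult_mult_l)
    qed
  qed
  show ?thesis
    unfolding Xi_seq.simps
  proof (rule lspan_least[OF V], rule subsetI)
    fix y assume "y \<in> {adj a \<otimes> x \<otimes> b | a x b. a \<in> \<phi> ` H \<and> x \<in> X r \<and> b \<in> \<phi> ` H}"
    then obtain g x h where "g \<in> H" "x \<in> X r" "h \<in> H"
      "y = adj (\<phi> g) \<otimes> x \<otimes> \<phi> h" by blast
    then show "y \<in> V" using both by simp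
  qed
qed

lemma b_X:
  assumes "e \<in> arcs E" "f \<in> arcs E" "x \<in> X r" "x \<in> carrier A"
  shows "b e f x \<in> X (Suc r)"
proof -
  have S: "S e \<in> H" "S f \<in> H"
    using assms(1,2) by (auto intro!: subsetD[OF lspan_incl])
  have "adj (\<phi> (S e)) \<otimes> x \<otimes> \<phi> (S f) \<in> X (Suc r)"
    unfolding Xi_seq.simps by (rule subsetD[OF lspan_incl]) (use S assms(3) in blast)
  then show ?thesis using assms by (simp add: b_eq_\<phi>)
qed

lemma X_subset: "X r \<subseteq> D (k - 1)"
proof (induction r)
  case (Suc r)
  show ?case
  proof (rule X_Suc_least[OF D_submodule])
    show "X r \<subseteq> carrier A" using Suc D_in by blast
  qed (rule b_D[OF _ _ subsetD[OF Suc]])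
qed simp

lemma X_in: "x \<in> X r \<Longrightarrow> x \<in> carrier A"
  using X_subset D_in by blast

lemma X_submodule: "submodule (X r) complex_ring A"
proof (cases r)
  case (Suc s)
  have "{adj a \<otimes> x \<otimes> b | a x b. a \<in> \<phi> ` H \<and> x \<in> X s \<and> b \<in> \<phi> ` H} \<subseteq> carrier A"
    using H_in X_in by (auto simp: subset_iff)
  then show ?thesis unfolding Suc Xi_seq.simps by (rule lspan_submodule)
qed (simp add: D_submodule)

lemma X_Suc_subset: "X (Suc r) \<subseteq> X r"
proof (induction r)
  case 0
  then show ?case using X_subset[of "Suc 0"] by simp
next
  case (Suc r)
  show ?case
  proof (rule X_Suc_least[OF X_submodule])
    show "X (Suc r) \<subseteq> carrier A" using X_in by blast
    show "b e f x \<in> X (Suc r)" if "e \<in> arcs E" "f \<in> arcs E" "x \<in> X (Suc r)" for e f x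
      by (rule b_X[OF that(1,2) subsetD[OF Suc that(3)] X_in[OF that(3)]])
  qed
qed

lemma X_antimono: "r \<le> s \<Longrightarrow> X s \<subseteq> X r"
  by (rule lift_Suc_antimono_le[of X]) (rule X_Suc_subset)

text \<open>A decreasing sequence of subspaces of a finite-dimensional space attains its intersection.\<close>

lemma Xi_subset_D0_iff: "Xi E A P S k u \<subseteq> D 0 \<longleftrightarrow> (\<exists>r. X r \<subseteq> D 0)"
proof
  assume *: "Xi E A P S k u \<subseteq> D 0"
  have "\<exists>N. \<forall>r\<ge>N. X r = X N"
  proof (rule submodule_chain_stabilizes[OF _ Pp_image_in X_submodule _ X_antimono])
    show "finite (Pp ` pathn (k - 1))" by (rule finite_imageI[OF finite_pathn])
    show "X r \<subseteq> lspan A (Pp ` pathn (k - 1))" for r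
      using X_subset unfolding D_level_def .
  qed
  then obtain N where N: "\<forall>r\<ge>N. X r = X N" by (rule exE)
  have "X N \<subseteq> X r" for r
  proof (cases "N \<le> r")
    case True
    then show ?thesis using N[rule_format, of r] by (simp del: Xi_seq.simps)
  next
    case False
    then show ?thesis by (intro X_antimono) simp
  qed
  then have "X N \<subseteq> Xi E A P S k u" by (auto simp: Xi_def)
  then show "\<exists>r. X r \<subseteq> D 0" using * by blast
next
  assume "\<exists>r. X r \<subseteq> D 0"
  then show "Xi E A P S k u \<subseteq> D 0" unfolding Xi_def by blast
qed

section \<open>Surjectivity on the diagonal\<close>

text \<open>By induction \<open>X j \<subseteq> \<phi>(D\<^sup>r\<^sup>-\<^sup>j)\<close>, as each one-step map lowers the level of a preimage by one.\<close>

lemma X_vanishes_if_range: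
  assumes "D (k - 1) \<subseteq> \<phi> ` D r"
  shows "X r \<subseteq> D 0"
proof -
  have "X j \<subseteq> \<phi> ` D (r - j)" if "j \<le> r" for j
    using that
  proof (induction j)
    case (Suc j)
    show ?case
    proof (rule X_Suc_least[OF \<phi>_image_submodule[OF D_submodule]])
      show "X j \<subseteq> carrier A" using X_in by auto
      fix e f x assume ef: "e \<in> arcs E" "f \<in> arcs E" and "x \<in> X j"
      then obtain z where z: "z \<in> D (r - j)" "x = \<phi> z" using Suc by force
      have "r - j = Suc (r - Suc j)" using Suc.prems by simp
      then have "adj (S e) \<otimes> z \<otimes> S f \<in> D (r - Suc j)" using D_compress[of z "r - Suc j" e f] z(1) ef by simp
      then show "b e f x \<in> \<phi> ` D (r - Suc j)"
        unfolding z(2) b_\<phi>[OF ef D_in[OF z(1)]] by (rule imageI)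
    qed
  qed (use assms in simp)
  from this[of r] show ?thesis using \<phi>_D0 by force
qed

text \<open>Downward induction on the index: if the \<open>b\<^sub>e\<^sub>,\<^sub>e(x)\<close> have preimages \<open>z\<^sub>e\<close> in \<open>D\<^sup>j\<close>, then
  \<open>x = \<Sum> \<phi>(S\<^sub>e) b\<^sub>e\<^sub>,\<^sub>e(x) \<phi>(S\<^sub>e)\<^sup>*\<close> has the preimage \<open>\<Sum> S\<^sub>e z\<^sub>e S\<^sub>e\<^sup>*\<close> in \<open>D\<^sup>j\<^sup>+\<^sup>1\<close>.\<close>

lemma range_if_X_vanishes:
  assumes "X r \<subseteq> D 0"
  shows "D (k - 1) \<subseteq> \<phi> ` D r"
proof -
  have "j \<le> r \<Longrightarrow> X (r - j) \<subseteq> \<phi> ` D j" for j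
  proof (induction j)
    case 0
    have "\<phi> ` D 0 = D 0" using \<phi>_D0 by auto
    then show ?case using assms by simp
  next
    case (Suc j)
    have IH: "X (r - j) \<subseteq> \<phi> ` D j" and r: "Suc (r - Suc j) = r - j" using Suc by auto
    show ?case
    proof
      fix x assume x: "x \<in> X (r - Suc j)"
      have xD: "x \<in> D (k - 1)" using x X_subset by auto
      note xA = D_in[OF xD]
      have T: "adj (u \<otimes> S e) \<otimes> x \<otimes> (u \<otimes> S f) = b e f x" if "e \<in> arcs E" "f \<in> arcs E" for e f
        using that xA by (simp add: b_def adj_mult mult_assoc)
      have sum: "(\<Oplus>e\<in>arcs E. u \<otimes> S e \<otimes> adj (u \<otimes> S e)) = \<one>"
      proof -
        have "(\<Oplus>e\<in>arcs E. u \<otimes> S e \<otimes> adj (u \<otimes> S e)) = (\<Oplus>e\<in>arcs E. \<phi> (S e \<otimes> adj (S e)))"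
          by (rule finsum_cong) (auto simp: \<phi>_mult \<phi>_adj endo_S)
        also have "\<dots> = (\<Oplus>e\<in>arcs E. u \<otimes> (S e \<otimes> adj (S e)) \<otimes> adj u)"
          by (rule finsum_cong) (auto simp: \<phi>_mult \<phi>_adj endo_S adj_mult mult_assoc)
        also have "\<dots> = (\<Oplus>e\<in>arcs E. u \<otimes> (S e \<otimes> adj (S e))) \<otimes> adj u"
          by (rule finsum_mult_l[symmetric]) auto
        also have "(\<Oplus>e\<in>arcs E. u \<otimes> (S e \<otimes> adj (S e))) = u \<otimes> (\<Oplus>e\<in>arcs E. S e \<otimes> adj (S e))"
          by (rule finsum_mult_r[symmetric]) auto
        finally show ?thesis by (simp add: one_eq_sum_S u_unitary)
      qed
      have "x = (\<Oplus>e\<in>arcs E. u \<otimes> S e \<otimes> (adj (u \<otimes> S e) \<otimes> x \<otimes> (u \<otimes> S e)) \<otimes> adj (u \<otimes> S e))"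
        by (rule block_diagonal[OF _ _ sum xA]) (auto simp: T b_off_diagonal[OF _ _ _ xD])
      also have "\<dots> \<in> \<phi> ` D (Suc j)"
      proof (rule submodule_finsum[OF \<phi>_image_submodule[OF D_submodule]])
        fix e assume e: "e \<in> arcs E"
        have "b e e x \<in> \<phi> ` D j" using b_X[OF e e x xA] IH r by auto
        then obtain z where z: "z \<in> D j" "b e e x = \<phi> z" by auto
        have "u \<otimes> S e \<otimes> (adj (u \<otimes> S e) \<otimes> x \<otimes> (u \<otimes> S e)) \<otimes> adj (u \<otimes> S e) = \<phi> (S e \<otimes> z \<otimes> adj (S e))"
          unfolding T[OF e e] z(2) \<phi>_extend[OF e D_in[OF z(1)]]
          using e D_in[OF z(1)] by (simp add: adj_mult mult_assoc)
        then show "u \<otimes> S e \<otimes> (adj (u \<otimes> S e) \<otimes> x \<otimes> (u \<otimes> S e)) \<otimes> adj (u \<otimes> S e) \<in> \<phi> ` D (Suc j)"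
          using D_extend[OF z(1) e] by simp
      qed
      finally show "x \<in> \<phi> ` D (Suc j)" .
    qed
  qed
  from this[of r] show ?thesis by simp
qed

text \<open>Preimages of the finitely many projections \<open>P\<^sub>\<mu>\<close> with \<open>|\<mu>| = k - 1\<close> are projections by injectivity, and
  therefore lie in a common level.\<close>

lemma range_if_automorphism:
  assumes "\<phi> ` DE = DE"
  obtains r where "D (k - 1) \<subseteq> \<phi> ` D r"
proof -
  have "\<exists>m. \<exists>q\<in>D m. \<phi> q = Pp \<mu>" if \<mu>: "\<mu> \<in> pathn (k - 1)" for \<mu>
  proof -
    have "Pp \<mu> \<in> \<phi> ` DE"
      unfolding assms using Pp_in_D[OF \<mu>] D_subset_D_alg by blast
    then obtain q where q: "q \<in> DE" "\<phi> q = Pp \<mu>" by auto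
    note alg = cstar_subalgebraD[OF D_alg_subalgebra]
    note qA = D_alg_in[OF q(1)]
    have proj: "Pp \<mu> \<otimes> Pp \<mu> = Pp \<mu>" "adj (Pp \<mu>) = Pp \<mu>"
      using Pp_projection[OF \<mu>] by (auto simp: is_projection_def)
    have "q \<otimes> q = q"
      by (rule inj_onD[OF \<phi>_inj_on _ alg(2)[OF q(1) q(1)] q(1)]) (use qA q(2) proj in \<open>simp add: \<phi>_mult\<close>)
    moreover have "adj q = q"
      by (rule inj_onD[OF \<phi>_inj_on _ alg(3)[OF q(1)] q(1)]) (use qA q(2) proj in \<open>simp add: \<phi>_adj\<close>)
    ultimately have "is_projection A q" using qA by (simp add: is_projection_def)
    then have "q \<in> Dfin" using q(1) by (rule projection_in_some_D)
    then show ?thesis using q(2) by (auto simp: Dfin_def)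
  qed
  then obtain m where m: "\<And>\<mu>. \<mu> \<in> pathn (k - 1) \<Longrightarrow> \<exists>q\<in>D (m \<mu>). \<phi> q = Pp \<mu>" by metis
  define r where "r = Max (insert 0 (m ` pathn (k - 1)))"
  have "D (k - 1) \<subseteq> \<phi> ` D r"
  proof (rule D_least[OF \<phi>_image_submodule[OF D_submodule]])
    fix \<mu> assume \<mu>: "\<mu> \<in> pathn (k - 1)"
    obtain q where q: "q \<in> D (m \<mu>)" "\<phi> q = Pp \<mu>" using m[OF \<mu>] by blast
    have "m \<mu> \<le> r" unfolding r_def using \<mu> finite_pathn by (intro Max_ge) auto
    then have "q \<in> D r" using q(1) D_mono by blast
    then show "Pp \<mu> \<in> \<phi> ` D r" using q(2) by (metis imageI)
  qed
  then show thesis by (rule that)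
qed

text \<open>If \<open>D\<^sup>m\<close> is in the range, so is \<open>u S\<^sub>e D\<^sup>m S\<^sub>e\<^sup>* u\<^sup>*\<close>, hence \<open>u D\<^sup>m\<^sup>+\<^sup>1 u\<^sup>*\<close>, which is \<open>D\<^sup>m\<^sup>+\<^sup>1\<close> as soon as
  \<open>m + 1 \<ge> k\<close>.\<close>

lemma Dfin_range:
  assumes "D (k - 1) \<subseteq> \<phi> ` Dfin"
  shows "Dfin \<subseteq> \<phi> ` Dfin"
proof -
  have step: "D (k - 1 + j) \<subseteq> \<phi> ` Dfin" for j
  proof (induction j)
    case (Suc j)
    show ?case
    proof
      fix y assume y: "y \<in> D (k - 1 + Suc j)"
      define x where "x = adj u \<otimes> y \<otimes> u"
      have x: "x \<in> D (Suc (k - 1 + j))"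
        unfolding x_def using conj_adj_D[OF y] k by simp
      have y_eq: "y = u \<otimes> x \<otimes> adj u"
        using D_in[OF y] by (simp add: x_def mult_assoc unitary_cancel u_unitary)
      define V where "V = {x \<in> carrier A. u \<otimes> x \<otimes> adj u \<in> \<phi> ` Dfin}"
      note im = \<phi>_image_submodule[OF Dfin_submodule]
      have V: "submodule V complex_ring A"
        unfolding V_def submodule_iff using submoduleD(2-4)[OF im]
        by (auto simp: mult_l_distr mult_r_distr smult_mult_l smult_mult_r)
      have "D (Suc (k - 1 + j)) \<subseteq> V"
      proof (rule D_Suc_least[OF V])
        fix e x assume e: "e \<in> arcs E" and x: "x \<in> D (k - 1 + j)"
        have "x \<in> \<phi> ` Dfin" by (rule subsetD[OF Suc x])
        then obtain z where z: "z \<in> Dfin" "x = \<phi> z" by (rule imageE)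
        obtain m where m: "z \<in> D m" using z(1) by (auto simp: Dfin_def)
        have "u \<otimes> (S e \<otimes> x \<otimes> adj (S e)) \<otimes> adj u = \<phi> (S e \<otimes> z \<otimes> adj (S e))"
          unfolding z(2) using \<phi>_extend[OF e D_in[OF m]] by simp
        also have "\<dots> \<in> \<phi> ` Dfin" using DfinI[OF D_extend[OF m e]] by (rule imageI)
        finally show "S e \<otimes> x \<otimes> adj (S e) \<in> V" using e D_in[OF x] by (simp add: V_def)
      qed
      then show "y \<in> \<phi> ` Dfin" using x y_eq by (auto simp: V_def)
    qed
  qed (use assms in simp)
  show ?thesis
  proof
    fix x assume "x \<in> Dfin"
    then obtain m where "x \<in> D m" by (auto simp: Dfin_def)
    then have "x \<in> D (k - 1 + m)" using D_mono[of m "k - 1 + m"] by auto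
    then show "x \<in> \<phi> ` Dfin" using step by auto
  qed
qed

text \<open>Preimages of a convergent sequence form a Cauchy sequence because \<open>\<phi>\<close> does not decrease norms on the
  diagonal.\<close>

lemma D_alg_range:
  assumes "Dfin \<subseteq> \<phi> ` Dfin"
  shows "DE \<subseteq> \<phi> ` DE"
proof
  fix x assume "x \<in> DE"
  then obtain \<sigma> where \<sigma>: "\<forall>n. \<sigma> n \<in> Dfin" "conv \<sigma> x" by (rule D_alg_approx)
  have "\<exists>y. y \<in> Dfin \<and> \<phi> y = \<sigma> n" for n
    using subsetD[OF assms \<sigma>(1)[rule_format, of n]] by auto
  then have "\<exists>\<tau>. \<forall>n. \<tau> n \<in> Dfin \<and> \<phi> (\<tau> n) = \<sigma> n" by (intro choice allI)
  then obtain \<tau> where \<tau>': "\<forall>n. \<tau> n \<in> Dfin \<and> \<phi> (\<tau> n) = \<sigma> n" by (rule exE)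
  have \<tau>: "\<tau> n \<in> Dfin" "\<phi> (\<tau> n) = \<sigma> n" for n using \<tau>' by simp_all
  have \<tau>A [simp]: "\<tau> n \<in> carrier A" for n using \<tau>(1) Dfin_in by auto
  note [simp] = convD(1,2)[OF \<sigma>(2)]
  note fin = submoduleD[OF Dfin_submodule]
  have dist: "nrm (\<tau> m \<ominus> \<tau> n) \<le> nrm (\<sigma> m \<ominus> x) + nrm (\<sigma> n \<ominus> x)" for m n
  proof -
    have "\<tau> m \<ominus> \<tau> n \<in> Dfin"
      using fin(3)[OF \<tau>(1) fin(4)[OF \<tau>(1)]] by (simp add: diff_eq_smult)
    then have "nrm (\<tau> m \<ominus> \<tau> n) \<le> nrm (\<phi> (\<tau> m \<ominus> \<tau> n))"
      using Dfin_subset_D_alg by (intro \<phi>_isometric) auto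
    also have "\<phi> (\<tau> m \<ominus> \<tau> n) = \<sigma> m \<ominus> \<sigma> n"
      by (simp add: diff_eq_smult \<phi>_add \<phi>_smult flip: \<tau>(2))
    also have "nrm \<dots> \<le> nrm (\<sigma> m \<ominus> x) + nrm (x \<ominus> \<sigma> n)" by (rule nrm_triangle) simp_all
    finally show ?thesis using nrm_swap[of x "\<sigma> n"] by simp
  qed
  have "\<exists>y. conv \<tau> y"
  proof (rule Cauchy_conv)
    fix \<epsilon> :: real assume "\<epsilon> > 0"
    then have "\<forall>\<^sub>F n in sequentially. nrm (\<sigma> n \<ominus> x) < \<epsilon> / 2"
      by (intro order_tendstoD[OF convD(3)[OF \<sigma>(2)]]) simp
    then obtain N where N: "\<And>n. N \<le> n \<Longrightarrow> nrm (\<sigma> n \<ominus> x) < \<epsilon> / 2" by (auto simp: eventually_sequentially)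
    have "nrm (\<tau> m \<ominus> \<tau> n) < \<epsilon>" if "N \<le> m" "N \<le> n" for m n
      using dist[of m n] N[OF that(1)] N[OF that(2)] by simp
    then show "\<exists>N. \<forall>m\<ge>N. \<forall>n\<ge>N. nrm (\<tau> m \<ominus> \<tau> n) < \<epsilon>" by blast
  qed auto
  then obtain y where y: "conv \<tau> y" by blast
  have "y \<in> DE"
    unfolding D_alg_eq_closure using \<tau>(1) y by (rule seq_closureI)
  moreover have "conv \<sigma> (\<phi> y)" using \<phi>_conv[OF y] by (simp add: \<tau>(2))
  then have "x = \<phi> y" using conv_unique[OF \<sigma>(2)] by simp
  ultimately show "x \<in> \<phi> ` DE" by simp
qed

theorem automorphism_iff: "star_aut (A\<lparr>carrier := DE\<rparr>) \<phi> \<longleftrightarrow> (\<exists>r. X r \<subseteq> D 0)"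
proof
  assume "star_aut (A\<lparr>carrier := DE\<rparr>) \<phi>"
  then have "\<phi> ` DE = DE" by (simp add: star_aut_def bij_betw_def)
  then obtain r where "D (k - 1) \<subseteq> \<phi> ` D r" by (rule range_if_automorphism)
  then show "\<exists>r. X r \<subseteq> D 0" using X_vanishes_if_range by blast
next
  assume "\<exists>r. X r \<subseteq> D 0"
  then obtain r where "D (k - 1) \<subseteq> \<phi> ` D r" using range_if_X_vanishes by blast
  then have "D (k - 1) \<subseteq> \<phi> ` Dfin" using DfinI by blast
  then have "DE \<subseteq> \<phi> ` DE" by (intro D_alg_range Dfin_range)
  then have "bij_betw \<phi> (DE) (DE)"
    using \<phi>_inj_on \<phi>_D_alg by (auto simp: bij_betw_def)
  moreover have "star_hom (A\<lparr>carrier := DE\<rparr>) (A\<lparr>carrier := DE\<rparr>) \<phi>"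
    using D_alg_in \<phi>_D_alg by (auto simp: star_hom_def \<phi>_add \<phi>_smult \<phi>_mult \<phi>_adj)
  ultimately show "star_aut (A\<lparr>carrier := DE\<rparr>) \<phi>" by (simp add: star_aut_def)
qed

end

section \<open>Nilpotency of the ring\<close>

lemma linear_map_ring_simps:
  "f \<in> carrier (linear_map_ring M) \<longleftrightarrow> f \<in> carrier M \<rightarrow>\<^sub>E carrier M \<and>
    (\<forall>x\<in>carrier M. \<forall>y\<in>carrier M. f (x \<oplus>\<^bsub>M\<^esub> y) = f x \<oplus>\<^bsub>M\<^esub> f y) \<and>
    (\<forall>c. \<forall>x\<in>carrier M. f (c \<odot>\<^bsub>M\<^esub> x) = c \<odot>\<^bsub>M\<^esub> f x)"
  "f \<otimes>\<^bsub>linear_map_ring M\<^esub> g = compose (carrier M) f g"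
  "\<zero>\<^bsub>linear_map_ring M\<^esub> = (\<lambda>x\<in>carrier M. \<zero>\<^bsub>M\<^esub>)"
  "f \<oplus>\<^bsub>linear_map_ring M\<^esub> g = (\<lambda>x\<in>carrier M. f x \<oplus>\<^bsub>M\<^esub> g x)"
  by (simp_all add: linear_map_ring_def)

text \<open>The explicit form of additive inverses is what subgroups of the ring of linear maps have to be checked
  against.\<close>

lemma linear_map_ring_abelian_group:
  fixes M (structure)
  assumes "Module.module complex_ring M"
  shows "abelian_group (linear_map_ring M)"
    and "f \<in> carrier (linear_map_ring M) \<Longrightarrow> \<ominus>\<^bsub>linear_map_ring M\<^esub> f = (\<lambda>x\<in>carrier M. \<ominus> f x)"
proof -
  interpret Module.module complex_ring M by fact
  let ?L = "linear_map_ring M"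
  have smult_in: "c \<odot> x \<in> carrier M" if "x \<in> carrier M" for c x
    using smult_closed[of c x] that by simp
  have smult_add: "c \<odot> (x \<oplus> y) = c \<odot> x \<oplus> c \<odot> y" if "x \<in> carrier M" "y \<in> carrier M" for c x y
    using smult_r_distr[of c x y] that by simp
  have smult_minus: "c \<odot> (\<ominus> x) = \<ominus> (c \<odot> x)" if "x \<in> carrier M" for c x
    using smult_r_minus[of c x] that by simp
  have smult_0: "c \<odot> \<zero> = \<zero>" for c
    using smult_r_null[of c] by simp
  have neg: "(\<lambda>x\<in>carrier M. \<ominus> f x) \<in> carrier ?L \<and> (\<lambda>x\<in>carrier M. \<ominus> f x) \<oplus>\<^bsub>?L\<^esub> f = \<zero>\<^bsub>?L\<^esub>"
    if f: "f \<in> carrier ?L" for f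
  proof
    have f': "f x \<in> carrier M" if "x \<in> carrier M" for x
      using f that by (auto simp: linear_map_ring_simps)
    show "(\<lambda>x\<in>carrier M. \<ominus> f x) \<in> carrier ?L"
      using f f' by (auto simp: linear_map_ring_simps smult_in smult_minus M.minus_add)
    show "(\<lambda>x\<in>carrier M. \<ominus> f x) \<oplus>\<^bsub>?L\<^esub> f = \<zero>\<^bsub>?L\<^esub>"
      unfolding linear_map_ring_simps using f' by (intro restrict_ext) (simp add: M.l_neg)
  qed
  show group: "abelian_group ?L"
  proof (rule abelian_groupI)
    fix f g assume f: "f \<in> carrier ?L" and g: "g \<in> carrier ?L"
    have f': "f x \<in> carrier M" "g x \<in> carrier M" if "x \<in> carrier M" for x
      using f g that by (auto simp: linear_map_ring_simps)
    show "f \<oplus>\<^bsub>?L\<^esub> g \<in> carrier ?L"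
      using f g f' by (auto simp: linear_map_ring_simps smult_in smult_add M.add.m_ac)
    show "f \<oplus>\<^bsub>?L\<^esub> g = g \<oplus>\<^bsub>?L\<^esub> f"
      unfolding linear_map_ring_simps using f' by (intro restrict_ext) (simp add: M.add.m_comm)
    fix h assume h: "h \<in> carrier ?L"
    have h': "h x \<in> carrier M" if "x \<in> carrier M" for x
      using h that by (auto simp: linear_map_ring_simps)
    show "f \<oplus>\<^bsub>?L\<^esub> g \<oplus>\<^bsub>?L\<^esub> h = f \<oplus>\<^bsub>?L\<^esub> (g \<oplus>\<^bsub>?L\<^esub> h)"
      unfolding linear_map_ring_simps using f' h' by (intro restrict_ext) (simp add: M.add.m_assoc)
  next
    show "\<zero>\<^bsub>?L\<^esub> \<in> carrier ?L" by (auto simp: linear_map_ring_simps smult_in smult_0)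
  next
    fix f assume f: "f \<in> carrier ?L"
    have f': "f \<in> carrier M \<rightarrow>\<^sub>E carrier M" using f unfolding linear_map_ring_simps by (rule conjunct1)
    have "(\<lambda>x\<in>carrier M. \<zero>\<^bsub>?L\<^esub> x \<oplus> f x) = (\<lambda>x\<in>carrier M. f x)"
      using PiE_mem[OF f'] by (intro restrict_ext) (simp add: linear_map_ring_simps(3))
    then show "\<zero>\<^bsub>?L\<^esub> \<oplus>\<^bsub>?L\<^esub> f = f"
      unfolding linear_map_ring_simps(4) using PiE_restrict[OF f'] by simp
    show "\<exists>g\<in>carrier ?L. g \<oplus>\<^bsub>?L\<^esub> f = \<zero>\<^bsub>?L\<^esub>" using neg[OF f] by blast
  qed
  show "\<ominus>\<^bsub>?L\<^esub> f = (\<lambda>x\<in>carrier M. \<ominus> f x)" if f: "f \<in> carrier ?L"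
    using neg[OF f] f by (intro abelian_group.minus_equality[OF group]) auto
qed

lemma generate_rng_least:
  "\<lbrakk>additive_subgroup B R; \<And>x y. \<lbrakk>x \<in> B; y \<in> B\<rbrakk> \<Longrightarrow> x \<otimes>\<^bsub>R\<^esub> y \<in> B; Y \<subseteq> B\<rbrakk> \<Longrightarrow> generate_rng R Y \<subseteq> B"
  by (auto simp: generate_rng_def)

lemma generate_rng_incl: "Y \<subseteq> generate_rng R Y"
  by (auto simp: generate_rng_def)

lemma zero_in_generate_rng: "\<zero>\<^bsub>R\<^esub> \<in> generate_rng R Y"
  by (auto simp: generate_rng_def additive_subgroup.zero_closed)

lemma rng_power_nonempty: "B \<noteq> {} \<Longrightarrow> rng_power R B n \<noteq> {}"
proof (induction n)
  case (Suc n)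
  then obtain x y where "x \<in> rng_power R B n" "y \<in> B" by blast
  then have "x \<otimes>\<^bsub>R\<^esub> y \<in> rng_power R B (Suc n)" by (simp add: ideal_prod.prod)
  then show ?case by blast
qed simp

context localized_endomorphism
begin

abbreviation V :: "(complex, 'a set) module" where "V \<equiv> V_space E A P S k"

abbreviation L :: "('a set \<Rightarrow> 'a set) ring" where "L \<equiv> linear_map_ring V"

abbreviation AR :: "('a set \<Rightarrow> 'a set) set" where "AR \<equiv> A_ring E A P S k u"

text \<open>The elements of the quotient space \<open>D\<^sup>k\<^sup>-\<^sup>1 / D\<^sup>0\<close> are the cosets of the \<open>x \<in> D\<^sup>k\<^sup>-\<^sup>1\<close> (\<open>V_carrier\<close>); the
  definition makes sense for all \<open>x\<close>.\<close>

definition coset :: "'a \<Rightarrow> 'a set" where "coset x = (\<lambda>w. w \<oplus> x) ` D 0"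

abbreviation bq :: "'e \<Rightarrow> 'e \<Rightarrow> 'a set \<Rightarrow> 'a set" where "bq \<equiv> b_quot E A P S k u"

lemma D0_subset: "D 0 \<subseteq> D (k - 1)"
  by (rule D_mono) simp

lemma coset_eq_iff:
  assumes x: "x \<in> carrier A" and y: "y \<in> carrier A"
  shows "coset x = coset y \<longleftrightarrow> x \<ominus> y \<in> D 0"
proof
  assume "coset x = coset y"
  moreover have "x \<in> coset x" unfolding coset_def using D_zero[of 0] x by (intro image_eqI[of _ _ \<zero>]) auto
  ultimately obtain w where w: "w \<in> D 0" "x = w \<oplus> y" by (auto simp: coset_def)
  then have "x \<ominus> y = w" using D_in[OF w(1)] y by (simp add: a_minus_def M.add.m_assoc M.r_neg)
  then show "x \<ominus> y \<in> D 0" using w by simp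
next
  assume d: "x \<ominus> y \<in> D 0"
  have *: "coset x \<subseteq> coset y" if d: "x \<ominus> y \<in> D 0" and x: "x \<in> carrier A" and y: "y \<in> carrier A" for x y
  proof
    fix z assume "z \<in> coset x"
    then obtain w where w: "w \<in> D 0" "z = w \<oplus> x" by (auto simp: coset_def)
    have "x \<ominus> y \<oplus> y = x" using x y by (simp add: a_minus_def M.add.m_assoc M.l_neg)
    then have "z = (w \<oplus> (x \<ominus> y)) \<oplus> y" using w D_in[OF w(1)] x y by (simp add: M.add.m_assoc)
    then show "z \<in> coset y" unfolding coset_def using D_add[OF w(1) d] by (rule image_eqI)
  qed
  have "y \<ominus> x = (- 1) \<odot> (x \<ominus> y)" using x y by (simp add: diff_eq_smult smult_add_r M.add.m_comm)
  then have "y \<ominus> x \<in> D 0" using D_smult[OF d] by simp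
  then show "coset x = coset y" using *[OF d x y] *[OF _ y x] by blast
qed

lemma coset_zero: "coset \<zero> = D 0"
  using D_in by (force simp: coset_def)

lemma coset_eq_D0_iff: "x \<in> carrier A \<Longrightarrow> coset x = D 0 \<longleftrightarrow> x \<in> D 0"
  using coset_eq_iff[of x \<zero>] by (simp add: coset_zero diff_eq_smult)

lemma a_r_coset_D_space: "D 0 +>\<^bsub>D_space E A P S m\<^esub> x = coset x"
  by (auto simp: a_r_coset_def r_coset_def coset_def D_space_def)

lemma V_carrier: "carrier V = coset ` D (k - 1)"
  by (auto simp: V_space_def quot_space_def A_RCOSETS_def RCOSETS_def D_space_def coset_def r_coset_def)

lemma V_zero: "\<zero>\<^bsub>V\<^esub> = coset \<zero>"
  by (simp add: V_space_def quot_space_def coset_zero)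

lemma V_add:
  assumes x: "x \<in> carrier A" and y: "y \<in> carrier A"
  shows "coset x \<oplus>\<^bsub>V\<^esub> coset y = coset (x \<oplus> y)"
proof -
  have "coset x \<oplus>\<^bsub>V\<^esub> coset y = {a \<oplus> b | a b. a \<in> coset x \<and> b \<in> coset y}"
    by (auto simp: V_space_def quot_space_def set_add_def set_mult_def D_space_def)
  also have "\<dots> = coset (x \<oplus> y)"
  proof (intro equalityI subsetI)
    fix z assume "z \<in> {a \<oplus> b | a b. a \<in> coset x \<and> b \<in> coset y}"
    then obtain v w where vw: "v \<in> D 0" "w \<in> D 0" "z = (v \<oplus> x) \<oplus> (w \<oplus> y)" by (auto simp: coset_def)
    then have "z = (v \<oplus> w) \<oplus> (x \<oplus> y)" using D_in x y by (simp add: M.add.m_ac)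
    then show "z \<in> coset (x \<oplus> y)" unfolding coset_def using D_add[OF vw(1,2)] by (rule image_eqI)
  next
    fix z assume "z \<in> coset (x \<oplus> y)"
    then obtain w where w: "w \<in> D 0" "z = w \<oplus> (x \<oplus> y)" by (auto simp: coset_def)
    then have "z = (w \<oplus> x) \<oplus> (\<zero> \<oplus> y)" using D_in[OF w(1)] x y by (simp add: M.add.m_assoc)
    moreover have "w \<oplus> x \<in> coset x" "\<zero> \<oplus> y \<in> coset y" using w(1) D_zero by (auto simp: coset_def)
    ultimately show "z \<in> {a \<oplus> b | a b. a \<in> coset x \<and> b \<in> coset y}" by blast
  qed
  finally show ?thesis .
qed

text \<open>Scalar multiplication and induced maps on the quotient take the unique element of the set of all cosets
  obtained from representatives; this set is a singleton if \<open>g\<close> respects cosets.\<close>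

lemma induced_map_value:
  assumes x: "x \<in> carrier A" and g_in: "\<And>y. y \<in> coset x \<Longrightarrow> g y \<in> carrier A"
    and g: "\<And>w. w \<in> D 0 \<Longrightarrow> g (w \<oplus> x) \<ominus> g x \<in> D 0"
  shows "the_elem ((\<lambda>y. coset (g y)) ` coset x) = coset (g x)"
proof -
  have "x \<in> coset x" unfolding coset_def using D_zero[of 0] x by (intro image_eqI[of _ _ \<zero>]) auto
  moreover have "coset (g y) = coset (g x)" if y: "y \<in> coset x" for y
  proof -
    obtain w where w: "w \<in> D 0" "y = w \<oplus> x" using y by (auto simp: coset_def)
    show ?thesis
      using coset_eq_iff[OF g_in[OF y] g_in[OF \<open>x \<in> coset x\<close>]] g[OF w(1)] w(2) by simp
  qed
  ultimately have "(\<lambda>y. coset (g y)) ` coset x = {coset (g x)}" by blast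
  then show ?thesis by simp
qed

lemma coset_subset: "x \<in> D (k - 1) \<Longrightarrow> coset x \<subseteq> D (k - 1)"
  using D0_subset D_add by (auto simp: coset_def)

lemma V_smult:
  assumes x: "x \<in> carrier A"
  shows "c \<odot>\<^bsub>V\<^esub> coset x = coset (c \<odot> x)"
proof -
  have "c \<odot>\<^bsub>V\<^esub> coset x = the_elem ((\<lambda>y. coset (c \<odot> y)) ` coset x)"
    by (simp add: V_space_def quot_space_def a_r_coset_D_space) (simp add: D_space_def)
  also have "\<dots> = coset (c \<odot> x)"
  proof (rule induced_map_value[OF x])
    show "c \<odot> y \<in> carrier A" if "y \<in> coset x" for y using that D_in x by (auto simp: coset_def)
    show "c \<odot> (w \<oplus> x) \<ominus> c \<odot> x \<in> D 0" if w: "w \<in> D 0" for w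
    proof -
      have "c \<odot> (w \<oplus> x) \<ominus> c \<odot> x = c \<odot> w"
        using D_in[OF w] x by (simp add: smult_add_r a_minus_def M.add.m_assoc M.r_neg)
      then show ?thesis using D_smult[OF w] by simp
    qed
  qed
  finally show ?thesis .
qed

lemma b_quot_coset:
  assumes ef: "e \<in> arcs E" "f \<in> arcs E" and x: "x \<in> D (k - 1)"
  shows "bq e f (coset x) = coset (b e f x)"
proof -
  have "coset x \<in> a_rcosets\<^bsub>D_space E A P S (k - 1)\<^esub> (D 0)"
    using x V_carrier by (auto simp: V_space_def quot_space_def)
  then have "bq e f (coset x) = the_elem ((\<lambda>y. coset (b_map E A P S k u e f y)) ` coset x)"
    by (simp add: b_quot_def quot_map_def a_r_coset_D_space)
  also have "(\<lambda>y. coset (b_map E A P S k u e f y)) ` coset x = (\<lambda>y. coset (b e f y)) ` coset x"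
    using coset_subset[OF x] by (intro image_cong) (auto simp: b_map_def b_def)
  also have "the_elem \<dots> = coset (b e f x)"
  proof (rule induced_map_value[OF D_in[OF x]])
    show "b e f y \<in> carrier A" if "y \<in> coset x" for y
      using that ef D_in coset_subset[OF x] by (intro b_in) auto
    show "b e f (w \<oplus> x) \<ominus> b e f x \<in> D 0" if w: "w \<in> D 0" for w
    proof -
      have "b e f (w \<oplus> x) \<ominus> b e f x = b e f w"
        using D_in[OF w] D_in[OF x] ef by (simp add: b_add a_minus_def M.add.m_assoc M.r_neg)
      then show ?thesis using b_D0[OF ef w] by simp
    qed
  qed
  finally show ?thesis .
qed

lemma V_module: "Module.module complex_ring V"
proof (rule moduleI)
  show "cring complex_ring" by (rule R.is_cring)
  show "abelian_group V"
  proof (rule abelian_groupI)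
    show "\<exists>y\<in>carrier V. y \<oplus>\<^bsub>V\<^esub> x = \<zero>\<^bsub>V\<^esub>" if x: "x \<in> carrier V" for x
    proof -
      obtain a where a: "a \<in> D (k - 1)" "x = coset a" using x by (auto simp: V_carrier)
      have "coset ((- 1) \<odot> a) \<oplus>\<^bsub>V\<^esub> coset a = \<zero>\<^bsub>V\<^esub>"
        using D_in[OF a(1)] by (simp add: V_add V_zero neg_one_add)
      then show ?thesis using D_smult[OF a(1)] a(2) by (auto simp: V_carrier)
    qed
  qed (auto simp: V_carrier V_add V_zero D_in D_add D_zero M.add.m_ac)
qed (auto simp: V_carrier V_add V_smult D_in D_add D_smult smult_add_l smult_add_r)

lemmas L_abelian_group = linear_map_ring_abelian_group(1)[OF V_module]
  and L_minus = linear_map_ring_abelian_group(2)[OF V_module]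

lemma L_closed: "\<lbrakk>f \<in> carrier L; x \<in> D (k - 1)\<rbrakk> \<Longrightarrow> f (coset x) \<in> carrier V"
  by (auto simp: linear_map_ring_simps V_carrier)

lemma L_eqI:
  assumes "f \<in> carrier L" "g \<in> carrier L" "\<And>x. x \<in> D (k - 1) \<Longrightarrow> f (coset x) = g (coset x)"
  shows "f = g"
proof (rule PiE_ext)
  show "f \<in> carrier V \<rightarrow>\<^sub>E carrier V" "g \<in> carrier V \<rightarrow>\<^sub>E carrier V"
    using assms(1,2) by (simp_all only: linear_map_ring_simps(1))
  show "f x = g x" if "x \<in> carrier V" for x
    using that assms(3) unfolding V_carrier by blast
qed

lemma coset_in_V: "x \<in> D (k - 1) \<Longrightarrow> coset x \<in> carrier V"
  by (simp add: V_carrier)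

lemma b_quot_in_L:
  assumes ef: "e \<in> arcs E" "f \<in> arcs E"
  shows "bq e f \<in> carrier L"
  unfolding linear_map_ring_simps
proof (intro conjI ballI allI PiE_I)
  fix X Y c assume "X \<in> carrier V"
  then obtain x where x: "x \<in> D (k - 1)" "X = coset x" by (auto simp: V_carrier)
  note xA = D_in[OF x(1)]
  show "bq e f X \<in> carrier V"
    unfolding x(2) b_quot_coset[OF ef x(1)] by (rule coset_in_V[OF b_D[OF ef x(1)]])
  show "bq e f (c \<odot>\<^bsub>V\<^esub> X) = c \<odot>\<^bsub>V\<^esub> bq e f X"
    using x xA ef D_smult[OF x(1), of c] by (simp add: V_smult b_quot_coset b_smult)
  assume "Y \<in> carrier V"
  then obtain y where y: "y \<in> D (k - 1)" "Y = coset y" by (auto simp: V_carrier)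
  show "bq e f (X \<oplus>\<^bsub>V\<^esub> Y) = bq e f X \<oplus>\<^bsub>V\<^esub> bq e f Y"
    using x y xA D_in[OF y(1)] ef D_add[OF x(1) y(1)] by (simp add: V_add b_quot_coset b_add)
next
  fix X assume "X \<notin> carrier V"
  then show "bq e f X = undefined"
    by (simp add: b_quot_def quot_map_def V_space_def quot_space_def)
qed

text \<open>The linear maps on the quotient that lower the filtration by the images of the \<open>X j\<close> by \<open>n\<close> steps. Unlike
  products of generators, these sets are visibly closed under addition, so the ring and its powers
  are contained in them without a normal form for their elements.\<close>

definition shifting :: "nat \<Rightarrow> ('a set \<Rightarrow> 'a set) set" where
  "shifting n = {f \<in> carrier L. \<forall>j. \<forall>x\<in>X j. f (coset x) \<in> coset ` X (j + n)}"

lemma shiftingD: "\<lbrakk>f \<in> shifting n; x \<in> X j\<rbrakk> \<Longrightarrow> f (coset x) \<in> coset ` X (j + n)"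
  by (auto simp: shifting_def)

lemma shifting_add:
  assumes "f \<in> shifting n" "g \<in> shifting n"
  shows "f \<oplus>\<^bsub>L\<^esub> g \<in> shifting n"
proof -
  have "f \<oplus>\<^bsub>L\<^esub> g \<in> carrier L"
    using assms abelian_groupE(1)[OF L_abelian_group] by (simp add: shifting_def del: Xi_seq.simps)
  moreover have "(f \<oplus>\<^bsub>L\<^esub> g) (coset x) \<in> coset ` X (j + n)" if x: "x \<in> X j" for x j
  proof -
    obtain y z where yz: "y \<in> X (j + n)" "f (coset x) = coset y" "z \<in> X (j + n)" "g (coset x) = coset z"
      using shiftingD[OF assms(1) x] shiftingD[OF assms(2) x] by auto
    have "coset x \<in> carrier V" using x X_subset coset_in_V by blast
    then have "(f \<oplus>\<^bsub>L\<^esub> g) (coset x) = coset (y \<oplus> z)"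
      using yz(2,4) V_add[OF X_in[OF yz(1)] X_in[OF yz(3)]] by (simp add: linear_map_ring_simps)
    then show ?thesis using submoduleD(3)[OF X_submodule yz(1,3)] by simp
  qed
  ultimately show ?thesis by (simp add: shifting_def del: Xi_seq.simps)
qed

lemma shifting_mult:
  assumes f: "f \<in> shifting n" and g: "g \<in> shifting m"
  shows "f \<otimes>\<^bsub>L\<^esub> g \<in> shifting (m + n)"
proof -
  have fL: "f \<in> carrier L" and gL: "g \<in> carrier L" using f g by (auto simp: shifting_def)
  have gV: "g x \<in> carrier V" if "x \<in> carrier V" for x
    using gL that unfolding linear_map_ring_simps by blast
  have fV: "f x \<in> carrier V" if "x \<in> carrier V" for x
    using fL that unfolding linear_map_ring_simps by blast
  have "f \<otimes>\<^bsub>L\<^esub> g \<in> carrier L"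
    using fL gL abelian_groupE(1)[OF module.axioms(2)[OF V_module]] module.smult_closed[OF V_module]
    unfolding linear_map_ring_simps by (simp add: compose_def fV gV Pi_iff)
  moreover have "(f \<otimes>\<^bsub>L\<^esub> g) (coset x) \<in> coset ` X (j + (m + n))" if x: "x \<in> X j" for x j
  proof -
    obtain y where y: "y \<in> X (j + m)" "g (coset x) = coset y" using shiftingD[OF g x] by auto
    have "coset x \<in> carrier V" using x X_subset coset_in_V by blast
    then have "(f \<otimes>\<^bsub>L\<^esub> g) (coset x) = f (coset y)" using y(2) by (simp add: linear_map_ring_simps compose_def)
    then show ?thesis using shiftingD[OF f y(1)] by (simp add: add.assoc)
  qed
  ultimately show ?thesis by (simp add: shifting_def del: Xi_seq.simps)
qed

lemma shifting_antimono: "m \<le> n \<Longrightarrow> shifting n \<subseteq> shifting m"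
proof
  fix f assume mn: "m \<le> n" and f: "f \<in> shifting n"
  have "f (coset x) \<in> coset ` X (j + m)" if "x \<in> X j" for x j
    using shiftingD[OF f that] X_antimono[of "j + m" "j + n"] mn by auto
  then show "f \<in> shifting m" using f by (simp add: shifting_def del: Xi_seq.simps)
qed

lemma shifting_subgroup: "additive_subgroup (shifting n) L"
proof (intro additive_subgroup.intro subgroup.intro)
  show "shifting n \<subseteq> carrier (add_monoid L)" by (auto simp: shifting_def)
  show "f \<otimes>\<^bsub>add_monoid L\<^esub> g \<in> shifting n" if "f \<in> shifting n" "g \<in> shifting n" for f g
    using shifting_add[OF that] by simp
  have "\<zero>\<^bsub>L\<^esub> \<in> carrier L" using abelian_groupE(2)[OF L_abelian_group] .
  moreover have "\<zero>\<^bsub>L\<^esub> (coset x) \<in> coset ` X (j + n)" if x: "x \<in> X j" for x j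
  proof -
    have "coset x \<in> carrier V" using x X_subset coset_in_V by blast
    then have "\<zero>\<^bsub>L\<^esub> (coset x) = coset \<zero>" by (simp add: linear_map_ring_simps V_zero)
    then show ?thesis using submoduleD(2)[OF X_submodule] by simp
  qed
  ultimately show "\<one>\<^bsub>add_monoid L\<^esub> \<in> shifting n" by (simp add: shifting_def del: Xi_seq.simps)
  show "inv\<^bsub>add_monoid L\<^esub> f \<in> shifting n" if f: "f \<in> shifting n" for f
  proof -
    have fL: "f \<in> carrier L" using f by (simp add: shifting_def)
    have "\<ominus>\<^bsub>L\<^esub> f \<in> carrier L" using abelian_group.a_inv_closed[OF L_abelian_group fL] .
    moreover have "(\<ominus>\<^bsub>L\<^esub> f) (coset x) \<in> coset ` X (j + n)" if x: "x \<in> X j" for x j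
    proof -
      obtain y where y: "y \<in> X (j + n)" "f (coset x) = coset y" using shiftingD[OF f x] by auto
      have V: "coset x \<in> carrier V" using x X_subset coset_in_V by blast
      have yD: "y \<in> D (k - 1)" using y(1) X_subset by blast
      have "coset ((- 1) \<odot> y) \<oplus>\<^bsub>V\<^esub> coset y = \<zero>\<^bsub>V\<^esub>"
        using D_in[OF yD] by (simp add: V_add V_zero neg_one_add)
      then have "\<ominus>\<^bsub>V\<^esub> coset y = coset ((- 1) \<odot> y)"
        by (rule abelian_group.minus_equality[OF module.axioms(2)[OF V_module]])
          (rule coset_in_V[OF yD], rule coset_in_V[OF D_smult[OF yD]])
      then have "(\<ominus>\<^bsub>L\<^esub> f) (coset x) = coset ((- 1) \<odot> y)" using V y(2) by (simp add: L_minus[OF fL])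
      then show ?thesis using submoduleD(4)[OF X_submodule y(1)] by simp
    qed
    ultimately show ?thesis by (simp add: shifting_def a_inv_def del: Xi_seq.simps)
  qed
qed

lemma A_ring_shifting: "AR \<subseteq> shifting 1"
  unfolding A_ring_def
proof (rule generate_rng_least[OF shifting_subgroup])
  show "f \<otimes>\<^bsub>L\<^esub> g \<in> shifting 1" if "f \<in> shifting 1" "g \<in> shifting 1" for f g
    using shifting_mult[OF that] shifting_antimono[of 1 "1 + 1"] by auto
  show "{bq e f | e f. e \<in> arcs E \<and> f \<in> arcs E} \<subseteq> shifting 1"
  proof
    fix h assume "h \<in> {bq e f | e f. e \<in> arcs E \<and> f \<in> arcs E}"
    then obtain e f where ef: "e \<in> arcs E" "f \<in> arcs E" "h = bq e f" by blast
    have "h (coset x) \<in> coset ` X (j + 1)" if x: "x \<in> X j" for x j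
      using b_quot_coset[OF ef(1,2) subsetD[OF X_subset x]] b_X[OF ef(1,2) x X_in[OF x]] ef(3)
      by (simp del: Xi_seq.simps)
    then show "h \<in> shifting 1" using b_quot_in_L[OF ef(1,2)] ef(3) by (simp add: shifting_def del: Xi_seq.simps)
  qed
qed

text \<open>The exponents differ by one since \<open>rng_power\<close> with index \<open>n\<close> is the power with exponent \<open>n + 1\<close>.\<close>

lemma rng_power_shifting: "rng_power L AR n \<subseteq> shifting (Suc n)"
proof (induction n)
  case 0
  then show ?case using A_ring_shifting by simp
next
  case (Suc n)
  show ?case
  proof
    fix f assume "f \<in> rng_power L AR (Suc n)"
    then have "f \<in> ideal_prod L (rng_power L AR n) AR" by simp
    then show "f \<in> shifting (Suc (Suc n))"
    proof induction
      case (prod f g)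
      then show ?case using shifting_mult[of f "Suc n" g 1] Suc A_ring_shifting by auto
    next
      case (sum f g)
      then show ?case by (intro shifting_add)
    qed
  qed
qed

lemma rng_power_in_L: "f \<in> rng_power L AR n \<Longrightarrow> f \<in> carrier L"
  using rng_power_shifting by (auto simp: shifting_def)

text \<open>Elements of a high power carry the whole quotient, the image of \<open>X 0\<close>, into the image of a space
  contained in \<open>D\<^sup>0\<close>.\<close>

lemma nilpotent_if_X_vanishes:
  assumes r: "X r \<subseteq> D 0"
  shows "nilpotent_rng L AR"
proof -
  have "f = \<zero>\<^bsub>L\<^esub>" if f: "f \<in> rng_power L AR r" for f
  proof (rule L_eqI[OF rng_power_in_L[OF f] abelian_groupE(2)[OF L_abelian_group]])
    fix x assume x: "x \<in> D (k - 1)"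
    have "f (coset x) \<in> coset ` X (0 + Suc r)"
      using x by (intro shiftingD[OF subsetD[OF rng_power_shifting f]]) simp
    then obtain y where y: "y \<in> X (Suc r)" "f (coset x) = coset y" by auto
    have "y \<in> D 0" using y(1) X_Suc_subset r by blast
    then have "coset y = coset \<zero>" using coset_eq_D0_iff[OF X_in[OF y(1)]] by (simp add: coset_zero)
    then show "f (coset x) = \<zero>\<^bsub>L\<^esub> (coset x)"
      using y(2) coset_in_V[OF x] by (simp add: linear_map_ring_simps V_zero)
  qed
  moreover have "AR \<noteq> {}" using zero_in_generate_rng unfolding A_ring_def by blast
  then have "rng_power L AR r \<noteq> {}" by (rule rng_power_nonempty)
  ultimately have "rng_power L AR r = {\<zero>\<^bsub>L\<^esub>}" by blast
  then show ?thesis unfolding nilpotent_rng_def by blast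
qed

text \<open>Representatives of the vectors that are killed by the power with index \<open>n\<close>. A one-step map leads from
  index \<open>n + 1\<close> to index \<open>n\<close> (\<open>b_annihilated\<close>), so these sets record how many one-step maps suffice to
  reach \<open>D\<^sup>0\<close>.\<close>

definition annihilated :: "nat \<Rightarrow> 'a set" where
  "annihilated n = {x \<in> D (k - 1). \<forall>f\<in>rng_power L AR n. f (coset x) = D 0}"

lemma annihilated_submodule: "submodule (annihilated n) complex_ring A"
  unfolding submodule_iff
proof (intro conjI ballI allI)
  note lin = rng_power_in_L[unfolded linear_map_ring_simps]
  show "annihilated n \<subseteq> carrier A" using D_in by (auto simp: annihilated_def)
  have zero: "f (coset \<zero>) = D 0" if f: "f \<in> rng_power L AR n" for f
  proof -
    obtain y where y: "y \<in> D (k - 1)" "f (coset \<zero>) = coset y"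
      using L_closed[OF rng_power_in_L[OF f] D_zero] by (auto simp: V_carrier)
    have "f (coset \<zero>) = f (0 \<odot>\<^bsub>V\<^esub> coset \<zero>)" by (simp add: V_smult)
    also have "\<dots> = 0 \<odot>\<^bsub>V\<^esub> f (coset \<zero>)"
      using lin[OF f] coset_in_V[OF D_zero] by blast
    also have "\<dots> = coset \<zero>"
      unfolding y(2) using D_in[OF y(1)] by (simp add: V_smult)
    finally show ?thesis by (simp add: coset_zero)
  qed
  then show "\<zero> \<in> annihilated n" using D_zero by (simp add: annihilated_def)
  fix x y c assume "x \<in> annihilated n"
  then have x: "x \<in> D (k - 1)" "\<And>f. f \<in> rng_power L AR n \<Longrightarrow> f (coset x) = D 0" by (auto simp: annihilated_def)
  have "f (coset (c \<odot> x)) = D 0" if f: "f \<in> rng_power L AR n" for f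
  proof -
    have "f (c \<odot>\<^bsub>V\<^esub> coset x) = c \<odot>\<^bsub>V\<^esub> f (coset x)" using lin[OF f] coset_in_V[OF x(1)] by blast
    then show ?thesis using x(2)[OF f] V_smult[OF D_in[OF x(1)]] V_smult[of \<zero> c] by (simp add: coset_zero)
  qed
  then show "c \<odot> x \<in> annihilated n" using D_smult[OF x(1)] by (simp add: annihilated_def)
  assume "y \<in> annihilated n"
  then have y: "y \<in> D (k - 1)" "\<And>f. f \<in> rng_power L AR n \<Longrightarrow> f (coset y) = D 0" by (auto simp: annihilated_def)
  have "f (coset (x \<oplus> y)) = D 0" if f: "f \<in> rng_power L AR n" for f
  proof -
    have "f (coset x \<oplus>\<^bsub>V\<^esub> coset y) = f (coset x) \<oplus>\<^bsub>V\<^esub> f (coset y)"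
      using lin[OF f] coset_in_V[OF x(1)] coset_in_V[OF y(1)] by blast
    then show ?thesis
      using x(2)[OF f] y(2)[OF f] V_add[OF D_in[OF x(1)] D_in[OF y(1)]] V_add[of \<zero> \<zero>] by (simp add: coset_zero)
  qed
  then show "x \<oplus> y \<in> annihilated n" using D_add[OF x(1) y(1)] by (simp add: annihilated_def)
qed

lemma b_quot_in_A_ring: "\<lbrakk>e \<in> arcs E; f \<in> arcs E\<rbrakk> \<Longrightarrow> bq e f \<in> AR"
  unfolding A_ring_def by (rule subsetD[OF generate_rng_incl]) blast

lemma b_annihilated:
  assumes ef: "e \<in> arcs E" "f \<in> arcs E" and x: "x \<in> annihilated (Suc n)"
  shows "b e f x \<in> annihilated n"
proof -
  have xD: "x \<in> D (k - 1)" using x by (simp add: annihilated_def)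
  have "h (coset (b e f x)) = D 0" if h: "h \<in> rng_power L AR n" for h
  proof -
    have "h \<otimes>\<^bsub>L\<^esub> bq e f \<in> rng_power L AR (Suc n)"
      using h b_quot_in_A_ring[OF ef] by (simp add: ideal_prod.prod)
    then have "(h \<otimes>\<^bsub>L\<^esub> bq e f) (coset x) = D 0" using x unfolding annihilated_def by blast
    then show ?thesis using coset_in_V[OF xD] b_quot_coset[OF ef xD] by (simp add: linear_map_ring_simps compose_def)
  qed
  then show ?thesis using b_D[OF ef xD] by (simp add: annihilated_def)
qed

text \<open>If the power with index \<open>n\<close> is zero, it annihilates all of \<open>X 0\<close>. After \<open>n\<close> further steps the ring
  itself annihilates \<open>X n\<close>, and one more step ends in \<open>D\<^sup>0\<close>.\<close>

lemma X_vanishes_if_nilpotent: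
  assumes "nilpotent_rng L AR"
  shows "\<exists>r. X r \<subseteq> D 0"
proof -
  obtain n where n: "rng_power L AR n = {\<zero>\<^bsub>L\<^esub>}" using assms by (auto simp: nilpotent_rng_def)
  have "X j \<subseteq> annihilated (n - j)" if "j \<le> n" for j
    using that
  proof (induction j)
    case 0
    have "\<zero>\<^bsub>L\<^esub> (coset x) = D 0" if "x \<in> D (k - 1)" for x
      using coset_in_V[OF that] by (simp add: linear_map_ring_simps V_zero coset_zero)
    then show ?case using n by (auto simp: annihilated_def)
  next
    case (Suc j)
    have eq: "n - j = Suc (n - Suc j)" using Suc.prems by simp
    have "X j \<subseteq> annihilated (Suc (n - Suc j))" using Suc eq by (simp del: Xi_seq.simps)
    then show ?case
      by (intro X_Suc_least[OF annihilated_submodule] b_annihilated) (use X_in in blast)+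
  qed
  from this[of n] have base: "X n \<subseteq> annihilated 0" by simp
  have "X (Suc n) \<subseteq> D 0"
  proof (rule X_Suc_least[OF D_submodule])
    show "X n \<subseteq> carrier A" using X_in by blast
    fix e f x assume ef: "e \<in> arcs E" "f \<in> arcs E" and x: "x \<in> X n"
    have xD: "x \<in> D (k - 1)" using x X_subset by blast
    have "bq e f (coset x) = D 0"
      using x base b_quot_in_A_ring[OF ef] by (auto simp: annihilated_def)
    then show "b e f x \<in> D 0"
      using b_quot_coset[OF ef xD] coset_eq_D0_iff[of "b e f x"] ef D_in[OF xD] by simp
  qed
  then show ?thesis by blast
qed

end

section \<open>Equivalence of the three conditions\<close>

theorem theorem5p3:
  fixes E :: "('v, 'e) pre_digraph" and A :: "'a cstar"
    and P :: "'v \<Rightarrow> 'a" and S :: "'e \<Rightarrow> 'a" and u :: 'a and k :: nat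
  assumes "fin_digraph E" and "\<forall>v\<in>verts E. \<not> is_sink E v"
    and "is_graph_cstar_algebra E A P S"
    and "k \<ge> 1"
    and "u \<in> U_group E A P \<inter> normalizer A (F_level E A P S k) (D_level E A P S k)"
  shows "(star_aut (A\<lparr>carrier := D_alg E A P S\<rparr>) (graph_endo E A P S u) \<longleftrightarrow>
      nilpotent_rng (linear_map_ring (V_space E A P S k)) (A_ring E A P S k u)) \<and>
    (nilpotent_rng (linear_map_ring (V_space E A P S k)) (A_ring E A P S k u) \<longleftrightarrow>
      Xi E A P S k u \<subseteq> D_level E A P S 0)"
proof -
  have alg: "cstar_algebra A" and fam: "ck_family E A P S"
    and gen: "carrier A = cstar_gen A (P ` verts E \<union> S ` arcs E)"
    and univ: "\<And>Q T. ck_family E A Q T \<Longrightarrow>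
      \<exists>\<phi>. star_hom A A \<phi> \<and> (\<forall>v\<in>verts E. \<phi> (P v) = Q v) \<and> (\<forall>e\<in>arcs E. \<phi> (S e) = T e)"
    using assms(3) unfolding is_graph_cstar_algebra_def by blast+
  interpret fin_digraph E by fact
  interpret cuntz_krieger A E P S
    using alg fam gen assms(1,2) by (intro cuntz_krieger.intro cuntz_krieger_axioms.intro) auto
  have u: "u \<in> F_level E A P S k" "adj\<^bsub>A\<^esub> u \<otimes>\<^bsub>A\<^esub> u = \<one>\<^bsub>A\<^esub>" "u \<otimes>\<^bsub>A\<^esub> adj\<^bsub>A\<^esub> u = \<one>\<^bsub>A\<^esub>"
    "\<And>v. v \<in> verts E \<Longrightarrow> u \<otimes>\<^bsub>A\<^esub> P v = P v \<otimes>\<^bsub>A\<^esub> u"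
    "(\<lambda>x. u \<otimes>\<^bsub>A\<^esub> x \<otimes>\<^bsub>A\<^esub> adj\<^bsub>A\<^esub> u) ` D_level E A P S k = D_level E A P S k"
    using assms(5) by (auto simp: U_group_def normalizer_def unitaries_def)
  obtain \<phi> where "star_hom A A \<phi>" "\<forall>v\<in>verts E. \<phi> (P v) = P v" "\<forall>e\<in>arcs E. \<phi> (S e) = u \<otimes>\<^bsub>A\<^esub> S e"
    using univ[OF ck_family_twist[OF F_in[OF u(1)] u(2-4)]] by blast
  moreover from this have "\<phi> \<one>\<^bsub>A\<^esub> = \<one>\<^bsub>A\<^esub>"
    using star_hom_fixes_one by blast
  ultimately have "\<exists>\<phi>. star_hom A A \<phi> \<and> \<phi> \<one>\<^bsub>A\<^esub> = \<one>\<^bsub>A\<^esub> \<and>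
    (\<forall>e\<in>arcs E. \<phi> (S e) = u \<otimes>\<^bsub>A\<^esub> S e) \<and> (\<forall>v\<in>verts E. \<phi> (P v) = P v)" by blast
  then have endo: "star_hom A A (graph_endo E A P S u) \<and> graph_endo E A P S u \<one>\<^bsub>A\<^esub> = \<one>\<^bsub>A\<^esub> \<and>
    (\<forall>e\<in>arcs E. graph_endo E A P S u (S e) = u \<otimes>\<^bsub>A\<^esub> S e) \<and> (\<forall>v\<in>verts E. graph_endo E A P S u (P v) = P v)"
    unfolding graph_endo_def by (rule someI_ex)
  interpret localized_endomorphism A E P S u k
    by unfold_locales (use assms(4) u endo in auto)
  show ?thesis
    using automorphism_iff Xi_subset_D0_iff nilpotent_if_X_vanishes X_vanishes_if_nilpotent by blast
qed

end
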